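(* Let $m,n\ge2$ be integers. For $0\le i\le\lfloor mn/2\rfloor$, let $\mathbf{1}_i\in E_i^-$ denote the all-ones vector in the basis indexed by $\mathcal{S}_i^-$. For integers $p\ge0$, define $$C_{m,n;p}^{(i)}:=\frac{1}{2mn}\log\left\{\max_{[U]\in\mathcal{S}_i^-}\frac{\big((X_{m,n}^{(i)}Y_{m,n}^{(i)})^{p+1}\mathbf{1}_i\big)_{[U]}}{\big((X_{m,n}^{(i)}Y_{m,n}^{(i)})^{p}\,\mathbf{1}_i\big)_{[U]}}\right\}.$$ Then, for each $0\le i\le\lfloor mn/2\rfloor$, the sequence $(C_{m,n;p}^{(i)})_{p\ge0}$ is non-increasing, and $$\ell_3\le\frac{1}{mn}\log\rho(\widehat{T}_{m,n})=\lim_{p\to\infty}\left\{\max_{0\le i\le\lfloor mn/2\rfloor}C_{m,n;p}^{(i)}\right\}=\inf_{p\ge0}\left\{\max_{0\le i\le\lfloor mn/2\rfloor}C_{m,n;p}^{(i)}\right\},$$ where $\rho$ denotes the spectral radius and $\ell_3$ is the dimer constant of $\mathbb{Z}^3$.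
   Context: Dimer constant. The cubic lattice is the graph on $\mathbb{Z}^3$ in which two vertices are adjacent if and only if they are at Euclidean distance one. For positive integers $a_1,a_2,a_3$ with $a_1a_2a_3$ even, $f(a_1,a_2,a_3)$ is the number of perfect matchings in the subgraph of the cubic lattice induced by $\{(x_1,x_2,x_3)\in\mathbb{Z}^3 : 0\le x_i<a_i,\ i=1,2,3\}$. The dimer constant is $\ell_3:=\lim \frac{1}{a_1a_2a_3}\log f(a_1,a_2,a_3)$, the limit being over $a_1,a_2,a_3\to\infty$ with $a_1a_2a_3$ even ($\log$ is the natural logarithm); this limit is known to exist and to be independent of the sequence taken (Hammersley, 1966). Transfer matrix. For integers $m,n\ge2$, let $V_{m,n}:=\mathbb{Z}/m\mathbb{Z}\times\mathbb{Z}/n\mathbb{Z}$ with componentwise addition, and $D:=\{(0,0),(1,0),(0,1)\}\subset V_{m,n}$. The matrix $A_{m,n}$, with rows and columns indexed by $V_{m,n}$, has entries $A_{m,n}(\mathbf{u},\mathbf{v})=1$ if $\mathbf{v}-\mathbf{u}\in D$ and $0$ otherwise. For $R,C\subseteq V_{m,n}$, $A_{m,n}[R,C]$ is the submatrix with row set $R$ and column set $C$. The matrix $T_{m,n}$, with rows and columns indexed by the power set $2^{V_{m,n}}$, has entries $$T_{m,n}(U,V):=\begin{cases}\operatorname{per}A_{m,n}[U,V_{m,n}\setminus V] & \text{if }|U|+|V|=mn,\\ 0&\text{otherwise,}\end{cases}$$ where for $|R|=|C|$, $\operatorname{per}A_{m,n}[R,C]=\sum_{\sigma:R\to C\text{ bijection}}\prod_{\mathbf{u}\in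 R}A_{m,n}(\mathbf{u},\sigma(\mathbf{u}))$ is the permanent, and the permanent of the empty matrix is $1$. Compression. Let $K_{m,n}:=\{\varphi\in\operatorname{Aut}(V_{m,n}) : \text{there exists }\mathbf{t}_\varphi\in V_{m,n}\text{ such that }\varphi(D)=\mathbf{t}_\varphi+D\}$, where $\operatorname{Aut}(V_{m,n})$ is the group of group automorphisms, and let $G_{m,n}:=V_{m,n}\rtimes K_{m,n}$, with $K_{m,n}$ acting on $V_{m,n}$ in the natural way. $G_{m,n}$ acts on $V_{m,n}$ by $(\mathbf{u},\varphi)\cdot\mathbf{v}:=\mathbf{u}+\varphi(\mathbf{v})$, and hence on subsets of $V_{m,n}$ elementwise; $2^{V_{m,n}}/G_{m,n}$ denotes the set of orbits of subsets, and $[U]$ the orbit of $U\subseteq V_{m,n}$. The compressed matrix $\widehat{T}_{m,n}$ has rows and columns indexed by $2^{V_{m,n}}/G_{m,n}$ and entries $\widehat{T}_{m,n}(\mathcal{O}_1,\mathcal{O}_2):=\sum_{V\in\mathcal{O}_2}T_{m,n}(U,V)$ for any $U\in\mathcal{O}_1$; the value does not depend on the choice of $U\in\mathcal{O}_1$. It vanishes at $([U],[V])$ unless $|U|+|V|=mn$. Sectors. For $0\le i\le\lfloor mn/2\rfloor$, let $\mathcal{S}_i^-:=\{[U]\in2^{V_{m,n}}/G_{m,n}: |U|=i\}$ and $\mathcal{S}_i^+:=\{[U]\in2^{V_{m,n}}/G_{m,n}: |U|=mn-i\}$, and let $E_i^{\pm}$ be the corresponding coordinate subspaces. Viewing $\widehat{T}_{m,n}$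 as acting on column vectors, let $X_{m,n}^{(i)}:E_i^+\to E_i^-$ and $Y_{m,n}^{(i)}:E_i^-\to E_i^+$ be the restrictions of $\widehat{T}_{m,n}$ to $E_i^+$ and $E_i^-$ respectively; that is, $X_{m,n}^{(i)}$ is the submatrix of $\widehat{T}_{m,n}$ with rows $\mathcal{S}_i^-$ and columns $\mathcal{S}_i^+$, and $Y_{m,n}^{(i)}$ is the submatrix with rows $\mathcal{S}_i^+$ and columns $\mathcal{S}_i^-$. For a vector $\mathbf{w}\in E_i^-$, $(\mathbf{w})_{[U]}$ denotes its coordinate at $[U]\in\mathcal{S}_i^-$. *)

theory Defs
  imports
    "HOL-Library.Countable_Set"
    "HOL-Library.FuncSet"
    "HOL-Algebra.Elementary_Groups"
    "HOL-Algebra.Group_Action"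
    "Jordan_Normal_Form.Spectral_Radius"
begin

subsection \<open>The dimer constant\<close>

definition cubic_adj :: "int \<times> int \<times> int \<Rightarrow> int \<times> int \<times> int \<Rightarrow> bool" where
  "cubic_adj = (\<lambda>(x1, x2, x3) (y1, y2, y3).
     sqrt ((real_of_int x1 - real_of_int y1)\<^sup>2 + (real_of_int x2 - real_of_int y2)\<^sup>2
         + (real_of_int x3 - real_of_int y3)\<^sup>2) = 1)"

definition lattice_box :: "nat \<Rightarrow> nat \<Rightarrow> nat \<Rightarrow> (int \<times> int \<times> int) set" where
  "lattice_box a1 a2 a3 = {0..<int a1} \<times> {0..<int a2} \<times> {0..<int a3}"

definition induced_edges :: "(int \<times> int \<times> int) set \<Rightarrow> (int \<times> int \<times> int) set set" where
  "induced_edges S = {{x, y} | x y. x \<in> S \<and> y \<in> S \<and> cubic_adj x y}"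

definition perfect_matching :: "'v set \<Rightarrow> 'v set set \<Rightarrow> 'v set set \<Rightarrow> bool" where
  "perfect_matching S E M \<longleftrightarrow> M \<subseteq> E \<and> (\<forall>v\<in>S. \<exists>!e. e \<in> M \<and> v \<in> e)"

definition num_matchings :: "nat \<Rightarrow> nat \<Rightarrow> nat \<Rightarrow> nat" where
  "num_matchings a1 a2 a3 =
     card {M. perfect_matching (lattice_box a1 a2 a3) (induced_edges (lattice_box a1 a2 a3)) M}"

text \<open>The filter expresses that the three side lengths tend to infinity independently of each
  other, subject to their product being even.\<close>

definition dimer_constant :: real where
  "dimer_constant =
     Lim (inf (at_top \<times>\<^sub>F at_top \<times>\<^sub>F at_top) (principal {(a1, a2, a3). even (a1 * a2 * a3)}))
       (\<lambda>(a1, a2, a3). ln (real (num_matchings a1 a2 a3)) / real (a1 * a2 * a3))"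

subsection \<open>The transfer matrix\<close>

text \<open>Throughout, matrices are functions of a row and a column index; the index sets are supplied
  where the matrix is used.\<close>

abbreviation VG :: "nat \<Rightarrow> nat \<Rightarrow> (int \<times> int) monoid" where
  "VG m n \<equiv> integer_mod_group m \<times>\<times> integer_mod_group n"

definition D_steps :: "(int \<times> int) set" where
  "D_steps = {(0, 0), (1, 0), (0, 1)}"

definition A_mat :: "nat \<Rightarrow> nat \<Rightarrow> int \<times> int \<Rightarrow> int \<times> int \<Rightarrow> real" where
  "A_mat m n u v = (if v \<otimes>\<^bsub>VG m n\<^esub> inv\<^bsub>VG m n\<^esub> u \<in> D_steps then 1 else 0)"

definition permanent :: "('a \<Rightarrow> 'b \<Rightarrow> real) \<Rightarrow> 'a set \<Rightarrow> 'b set \<Rightarrow> real" where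
  "permanent A R C = (\<Sum>\<sigma> \<in> {\<sigma> \<in> R \<rightarrow>\<^sub>E C. bij_betw \<sigma> R C}. \<Prod>u\<in>R. A u (\<sigma> u))"

definition T_mat :: "nat \<Rightarrow> nat \<Rightarrow> (int \<times> int) set \<Rightarrow> (int \<times> int) set \<Rightarrow> real" where
  "T_mat m n U V =
     (if card U + card V = m * n then permanent (A_mat m n) U (carrier (VG m n) - V) else 0)"

subsection \<open>Compression\<close>

definition K_grp :: "nat \<Rightarrow> nat \<Rightarrow> (int \<times> int \<Rightarrow> int \<times> int) set" where
  "K_grp m n = {\<phi> \<in> auto (VG m n). \<exists>t \<in> carrier (VG m n). \<phi> ` D_steps = t <#\<^bsub>VG m n\<^esub> D_steps}"

definition G_grp :: "nat \<Rightarrow> nat \<Rightarrow> ((int \<times> int) \<times> (int \<times> int \<Rightarrow> int \<times> int)) monoid" where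
  "G_grp m n =
     \<lparr>carrier = carrier (VG m n) \<times> K_grp m n,
      monoid.mult = (\<lambda>(u, \<phi>) (v, \<psi>). (u \<otimes>\<^bsub>VG m n\<^esub> \<phi> v, compose (carrier (VG m n)) \<phi> \<psi>)),
      one = (\<one>\<^bsub>VG m n\<^esub>, \<lambda>v \<in> carrier (VG m n). v)\<rparr>"

definition act ::
  "nat \<Rightarrow> nat \<Rightarrow> (int \<times> int) \<times> (int \<times> int \<Rightarrow> int \<times> int) \<Rightarrow> (int \<times> int) set \<Rightarrow> (int \<times> int) set"
  where
  "act m n = (\<lambda>(u, \<phi>). \<lambda>U \<in> Pow (carrier (VG m n)). (\<lambda>v. u \<otimes>\<^bsub>VG m n\<^esub> \<phi> v) ` U)"

abbreviation orb :: "nat \<Rightarrow> nat \<Rightarrow> (int \<times> int) set \<Rightarrow> (int \<times> int) set set" where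
  "orb m n U \<equiv> orbit (G_grp m n) (act m n) U"

definition Orbs :: "nat \<Rightarrow> nat \<Rightarrow> (int \<times> int) set set set" where
  "Orbs m n = orbits (G_grp m n) (Pow (carrier (VG m n))) (act m n)"

text \<open>The choice of the representative of \<^term>\<open>\<O>1\<close> is immaterial: the sum is the same for
  every \<^term>\<open>U \<in> \<O>1\<close> when \<^term>\<open>\<O>1\<close> and \<^term>\<open>\<O>2\<close> are orbits.\<close>

definition T_hat ::
  "nat \<Rightarrow> nat \<Rightarrow> (int \<times> int) set set \<Rightarrow> (int \<times> int) set set \<Rightarrow> real" where
  "T_hat m n \<O>1 \<O>2 = (\<Sum>V\<in>\<O>2. T_mat m n (SOME U. U \<in> \<O>1) V)"

text \<open>Spectral radius of a real square matrix over a finite index set \<^term>\<open>I\<close>: the indices are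
  numbered \<open>0, \<dots>, card I - 1\<close> by \<^term>\<open>from_nat_into I\<close>. Renumbering only conjugates the matrix
  by a permutation, so the value does not depend on the numbering.\<close>

definition spectral_radius_on :: "'a set \<Rightarrow> ('a \<Rightarrow> 'a \<Rightarrow> real) \<Rightarrow> real" where
  "spectral_radius_on I M =
     spectral_radius (mat (card I) (card I)
       (\<lambda>(i, j). complex_of_real (M (from_nat_into I i) (from_nat_into I j))))"

subsection \<open>Sectors\<close>

definition S_minus :: "nat \<Rightarrow> nat \<Rightarrow> nat \<Rightarrow> (int \<times> int) set set set" where
  "S_minus m n i = {orb m n U | U. U \<subseteq> carrier (VG m n) \<and> card U = i}"

definition S_plus :: "nat \<Rightarrow> nat \<Rightarrow> nat \<Rightarrow> (int \<times> int) set set set" where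
  "S_plus m n i = {orb m n U | U. U \<subseteq> carrier (VG m n) \<and> card U = m * n - i}"

text \<open>A vector with coordinates in \<^term>\<open>R\<close> is a function that vanishes outside \<^term>\<open>R\<close>;
  the submatrix of \<^term>\<open>M\<close> with rows \<^term>\<open>R\<close> and columns \<^term>\<open>C\<close> acts on column vectors.\<close>

definition submat_apply ::
  "'a set \<Rightarrow> 'b set \<Rightarrow> ('a \<Rightarrow> 'b \<Rightarrow> real) \<Rightarrow> ('b \<Rightarrow> real) \<Rightarrow> 'a \<Rightarrow> real" where
  "submat_apply R C M w = (\<lambda>r. if r \<in> R then \<Sum>c\<in>C. M r c * w c else 0)"

definition X_op ::
  "nat \<Rightarrow> nat \<Rightarrow> nat \<Rightarrow> ((int \<times> int) set set \<Rightarrow> real) \<Rightarrow> (int \<times> int) set set \<Rightarrow> real" where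
  "X_op m n i = submat_apply (S_minus m n i) (S_plus m n i) (T_hat m n)"

definition Y_op ::
  "nat \<Rightarrow> nat \<Rightarrow> nat \<Rightarrow> ((int \<times> int) set set \<Rightarrow> real) \<Rightarrow> (int \<times> int) set set \<Rightarrow> real" where
  "Y_op m n i = submat_apply (S_plus m n i) (S_minus m n i) (T_hat m n)"

definition ones :: "nat \<Rightarrow> nat \<Rightarrow> nat \<Rightarrow> (int \<times> int) set set \<Rightarrow> real" where
  "ones m n i = (\<lambda>\<O>. if \<O> \<in> S_minus m n i then 1 else 0)"

definition C_seq :: "nat \<Rightarrow> nat \<Rightarrow> nat \<Rightarrow> nat \<Rightarrow> real" where
  "C_seq m n i p =
     1 / (2 * real m * real n) *
     ln (MAX \<O> \<in> S_minus m n i.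
           ((X_op m n i \<circ> Y_op m n i) ^^ (p + 1)) (ones m n i) \<O>
         / ((X_op m n i \<circ> Y_op m n i) ^^ p) (ones m n i) \<O>)"

end

theory Submission
  imports Defs
begin

text \<open>
  The statement has two halves: a fact about one finite nonnegative matrix, and a comparison of the
  dimer constant with the growth rate of that matrix.

  \<^emph>\<open>The matrix.\<close>  Two steps of the compressed matrix preserve the cardinality of a subset, so they
  split into the blocks \<open>X Y\<close> of the sectors.  Think of a subset as a set of particles on the torus
  \<open>Z/m \<times> Z/n\<close>.  The entry of the transfer matrix at \<open>U\<close> and the complement of \<open>V\<close> counts the ways in which
  the particles at \<open>U\<close> can move simultaneously to \<open>V\<close>, each of them staying or hopping along a step.
  Letting all of them stay gives each block a positive diagonal.  Letting one particle hop at a time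
  connects any two configurations of the same size (\<open>hop_connected\<close>), so each block is
  irreducible, hence primitive.  For a primitive matrix the largest quotient of consecutive entries
  along the orbit of the all-ones vector decreases to an eigenvalue with a nonnegative eigenvector
  (\<open>pf_eigenvector\<close>) and bounds every complex eigenvalue throughout (\<open>eigenvalue_le_cw_bound\<close>).
  If \<open>X Y v = s\<^sup>2 v\<close>, then \<open>s v\<close> plus the image of \<open>v\<close> under the compressed
  matrix is an eigenvector of that matrix for \<open>s\<close>; conversely the square of a nonzero eigenvalue of the compressed matrix is an eigenvalue of some
  block.  So the square of the spectral radius is the largest of the limits over the sectors.

  \<^emph>\<open>The dimer constant.\<close>  Cut the cubic lattice into the layers \<open>x + y + z = t\<close>.  In the coordinates
  \<open>(y, z)\<close> a vertex of layer \<open>t\<close> is joined to its translates by the three steps in layer \<open>t + 1\<close>.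
  Reducing \<open>y\<close>, \<open>z\<close>, \<open>t\<close> modulo \<open>m\<close>, \<open>n\<close>, \<open>k\<close> gives a finite torus.  Its perfect matchings correspond to
  closed paths of \<open>k\<close> steps of the transfer matrix, so for even \<open>k\<close> their number grows at most like
  the \<open>k\<close>-th power of the spectral radius (\<open>card_torus_matchings_le\<close>, \<open>T_ones_growth\<close>).  The
  \<open>k \<times> m \<times> n\<close> box is a spanning subgraph of this torus (\<open>num_matchings_le_torus\<close>).

  It remains to compare a wide torus with a narrow one.  The torus is twisted and \<open>m\<close> and \<open>n\<close> may be
  odd, so there is no reflection to exploit; but doubling \<open>m\<close> or \<open>n\<close> produces a double cover of a bipartite graph, and a double cover of a bipartite graph has at most
  the square of the number of perfect matchings of the base (\<open>bip_matchings_double_cover\<close>).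
  Doubling both circumferences \<open>j\<close> times raises the count at most to the power \<open>4\<^sup>j\<close>, which is exactly
  the growth of the volume.  Since the dimer constant is a supremum over boxes with even sides, by
  superadditivity, the boxes \<open>(2 p + 2) \<times> 2\<^sup>p m \<times> 2\<^sup>p n\<close> suffice to bound it.
\<close>

section \<open>Perfect matchings of double covers\<close>

text \<open>Joining \<open>x\<close> to \<open>\<tau> x\<close> and to \<open>\<pi> x\<close> gives a union of cycles in which the two kinds of edges alternate.
  Such cycles are even, so their vertices can be coloured alternately.  The induction removes one
  \<open>\<tau>\<close>-pair and reconnects its two \<open>\<pi>\<close>-neighbours.\<close>

lemma common_transversal_of_involutions:
  fixes \<tau> \<pi> :: "'a \<Rightarrow> 'a"
  assumes "finite X"
    and "\<And>x. x \<in> X \<Longrightarrow> \<tau> x \<in> X \<and> \<tau> x \<noteq> x \<and> \<tau> (\<tau> x) = x"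
    and "\<And>x. x \<in> X \<Longrightarrow> \<pi> x \<in> X \<and> \<pi> x \<noteq> x \<and> \<pi> (\<pi> x) = x"
  shows "\<exists>S\<subseteq>X. \<forall>x\<in>X. (\<tau> x \<in> S \<longleftrightarrow> x \<notin> S) \<and> (\<pi> x \<in> S \<longleftrightarrow> x \<notin> S)"
  using assms
proof (induction "card X" arbitrary: X \<pi> rule: less_induct)
  case less
  show ?case
  proof (cases "X = {}")
    case True
    then show ?thesis by auto
  next
    case False
    then obtain v where v: "v \<in> X" by blast
    define w where "w = \<tau> v"
    define X0 where "X0 = X - {v, w}"
    have w: "w \<in> X" "w \<noteq> v" "\<tau> w = v" using less.prems(2)[OF v] by (auto simp: w_def)
    have c: "card X0 < card X"
      unfolding X0_def using v w less.prems(1) by (intro psubset_card_mono) auto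
    have f0: "finite X0" using less.prems(1) by (simp add: X0_def)
    have t0: "\<tau> x \<in> X0 \<and> \<tau> x \<noteq> x \<and> \<tau> (\<tau> x) = x" if "x \<in> X0" for x
      using that less.prems(2)[of x] less.prems(2)[OF v] w unfolding X0_def w_def by (auto; metis)
    show ?thesis
    proof (cases "\<pi> v = w")
      case True
      have "\<pi> w = v" using less.prems(3)[OF v] True by simp
      have p0: "\<pi> x \<in> X0 \<and> \<pi> x \<noteq> x \<and> \<pi> (\<pi> x) = x" if "x \<in> X0" for x
        using that less.prems(3)[of x] less.prems(3)[OF v] True \<open>\<pi> w = v\<close> unfolding X0_def by (auto; metis)
      from less.hyps[OF c f0 t0 p0] obtain S where
        S: "S \<subseteq> X0" "\<And>x. x \<in> X0 \<Longrightarrow> (\<tau> x \<in> S \<longleftrightarrow> x \<notin> S) \<and> (\<pi> x \<in> S \<longleftrightarrow> x \<notin> S)" by blast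
      have nv: "v \<notin> S" "w \<notin> S" using S(1) by (auto simp: X0_def)
      have "\<forall>x\<in>X. (\<tau> x \<in> insert v S \<longleftrightarrow> x \<notin> insert v S) \<and> (\<pi> x \<in> insert v S \<longleftrightarrow> x \<notin> insert v S)"
      proof
        fix x assume x: "x \<in> X"
        consider "x = v" | "x = w" | "x \<in> X0" using x by (auto simp: X0_def)
        then show "(\<tau> x \<in> insert v S \<longleftrightarrow> x \<notin> insert v S) \<and> (\<pi> x \<in> insert v S \<longleftrightarrow> x \<notin> insert v S)"
        proof cases
          case 1 then show ?thesis using nv w True by (simp add: w_def[symmetric])
        next
          case 2 then show ?thesis using nv w \<open>\<pi> w = v\<close> by simp
        next
          case 3 then show ?thesis using t0[OF 3] p0[OF 3] S(2)[OF 3] by (auto simp: X0_def)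
        qed
      qed
      then show ?thesis using S(1) v by (intro exI[of _ "insert v S"]) (auto simp: X0_def)
    next
      case False
      define a where "a = \<pi> v"
      define b where "b = \<pi> w"
      have a: "a \<in> X0" "\<pi> a = v" using less.prems(3)[OF v] False by (auto simp: a_def X0_def)
      have b: "b \<in> X0" "\<pi> b = w"
        using less.prems(3)[OF w(1)] False less.prems(3)[OF v] by (auto simp: b_def X0_def)
      have ab: "a \<noteq> b" using a(2) b(2) w(2) by auto
      define \<pi>' where "\<pi>' = \<pi>(a := b, b := a)"
      have p0: "\<pi>' x \<in> X0 \<and> \<pi>' x \<noteq> x \<and> \<pi>' (\<pi>' x) = x" if x: "x \<in> X0" for x
      proof (cases "x = a \<or> x = b")
        case True
        then show ?thesis using a b ab by (auto simp: \<pi>'_def)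
      next
        case F: False
        have xX: "x \<in> X" "x \<noteq> v" "x \<noteq> w" using x by (auto simp: X0_def)
        note px = less.prems(3)[OF xX(1)]
        have "\<pi> x \<noteq> v" "\<pi> x \<noteq> w" "\<pi> x \<noteq> a" "\<pi> x \<noteq> b"
          using px F a b xX by (auto simp: a_def b_def)
        then show ?thesis using px F by (auto simp: \<pi>'_def X0_def)
      qed
      from less.hyps[OF c f0 t0 p0] obtain S where
        S: "S \<subseteq> X0" "\<And>x. x \<in> X0 \<Longrightarrow> (\<tau> x \<in> S \<longleftrightarrow> x \<notin> S) \<and> (\<pi>' x \<in> S \<longleftrightarrow> x \<notin> S)" by blast
      have nv: "v \<notin> S" "w \<notin> S" using S(1) by (auto simp: X0_def)
      have abS: "b \<in> S \<longleftrightarrow> a \<notin> S" using S(2)[OF a(1)] ab by (simp add: \<pi>'_def)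
      \<comment> \<open>\<open>v\<close> must be separated from \<open>a = \<pi> v\<close>, and \<open>w = \<tau> v\<close> from \<open>b = \<pi> w\<close>.\<close>
      define S' where "S' = (if a \<in> S then insert w S else insert v S)"
      have S'0: "x \<in> S' \<longleftrightarrow> x \<in> S" if "x \<in> X0" for x using that by (auto simp: S'_def X0_def)
      have S'v: "v \<in> S' \<longleftrightarrow> a \<notin> S" "w \<in> S' \<longleftrightarrow> a \<in> S" using nv w by (auto simp: S'_def)
      have "\<forall>x\<in>X. (\<tau> x \<in> S' \<longleftrightarrow> x \<notin> S') \<and> (\<pi> x \<in> S' \<longleftrightarrow> x \<notin> S')"
      proof
        fix x assume x: "x \<in> X"
        consider "x = v" | "x = w" | "x = a" | "x = b" | "x \<in> X0" "x \<noteq> a" "x \<noteq> b"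
          using x by (auto simp: X0_def)
        then show "(\<tau> x \<in> S' \<longleftrightarrow> x \<notin> S') \<and> (\<pi> x \<in> S' \<longleftrightarrow> x \<notin> S')"
        proof cases
          case 1 then show ?thesis
            using S'v S'0[OF a(1)] by (simp add: w_def[symmetric] a_def[symmetric])
        next
          case 2 then show ?thesis using S'v S'0[OF b(1)] abS w by (simp add: b_def[symmetric])
        next
          case 3 then show ?thesis using S'v S'0[OF a(1)] S'0 t0[OF a(1)] S(2)[OF a(1)] a by simp
        next
          case 4 then show ?thesis using S'v S'0[OF b(1)] S'0 t0[OF b(1)] S(2)[OF b(1)] b abS by simp
        next
          case 5
          then have "\<pi>' x = \<pi> x" by (simp add: \<pi>'_def)
          then show ?thesis using S'0 t0[OF 5(1)] p0[OF 5(1)] S(2)[OF 5(1)] 5 by auto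
        qed
      qed
      moreover have "S' \<subseteq> X" using S(1) v w by (auto simp: S'_def X0_def)
      ultimately show ?thesis by blast
    qed
  qed
qed

text \<open>A perfect matching of a bipartite graph with parts \<open>A\<close> and \<open>B\<close>, recorded as the map that sends a vertex
  of \<open>A\<close> to its partner; extensionality makes distinct maps distinct matchings.\<close>

definition bip_matchings :: "'a set \<Rightarrow> 'b set \<Rightarrow> ('a \<Rightarrow> 'b \<Rightarrow> bool) \<Rightarrow> ('a \<Rightarrow> 'b) set" where
  "bip_matchings A B R = {f \<in> A \<rightarrow>\<^sub>E B. bij_betw f A B \<and> (\<forall>a\<in>A. R a (f a))}"

lemma finite_bip_matchings: "finite A \<Longrightarrow> finite B \<Longrightarrow> finite (bip_matchings A B R)"
  by (rule finite_subset[of _ "A \<rightarrow>\<^sub>E B"]) (auto simp: bip_matchings_def intro: finite_PiE)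

text \<open>Let \<open>p\<close> be a double cover with deck involution \<open>\<tau>\<close>.  A matching \<open>M\<close> upstairs projects to a multigraph
  downstairs in which every vertex has degree two; \<open>Q M\<close> records it.  If \<open>S\<close> contains one of the two
  lifts of each left vertex and \<open>T\<close> one of the two lifts of each right vertex, and if \<open>M\<close> maps \<open>S\<close> to \<open>T\<close>,
  then the restrictions of \<open>M\<close> to \<open>S\<close> and to its complement project to two matchings of the base.
  A suitable \<open>S\<close> exists: it has to be exchanged with its complement by \<open>\<tau>\<close> and by the conjugate of \<open>\<tau>\<close>
  under \<open>M\<close>, so the preceding lemma applies.  Whether \<open>S\<close> and \<open>T\<close> are suitable depends on \<open>Q M\<close> only, so
  they can be chosen as functions of \<open>Q M\<close>.  The pair of projected matchings determines \<open>Q M\<close>, hence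
  \<open>S\<close>, hence \<open>M\<close>, because an edge has at most one lift at a given vertex.\<close>

lemma bip_matchings_double_cover:
  fixes E' O' :: "'a set" and E O1 :: "'b set"
  assumes fin: "finite E'" "finite O'"
    and \<tau>E: "\<And>x. x \<in> E' \<Longrightarrow> \<tau> x \<in> E' \<and> \<tau> x \<noteq> x \<and> \<tau> (\<tau> x) = x"
    and \<tau>O: "\<And>x. x \<in> O' \<Longrightarrow> \<tau> x \<in> O' \<and> \<tau> x \<noteq> x \<and> \<tau> (\<tau> x) = x"
    and pE: "p ` E' = E" "\<And>x y. x \<in> E' \<Longrightarrow> y \<in> E' \<Longrightarrow> p x = p y \<longleftrightarrow> y = x \<or> y = \<tau> x"
    and pO: "p ` O' = O1" "\<And>x y. x \<in> O' \<Longrightarrow> y \<in> O' \<Longrightarrow> p x = p y \<longleftrightarrow> y = x \<or> y = \<tau> x"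
    and R: "\<And>a b. a \<in> E' \<Longrightarrow> b \<in> O' \<Longrightarrow> R' a b \<Longrightarrow> R (p a) (p b)"
    and R\<tau>: "\<And>a b. a \<in> E' \<Longrightarrow> b \<in> O' \<Longrightarrow> R' a b \<Longrightarrow> R' (\<tau> a) (\<tau> b)"
    and simple: "\<And>a b. a \<in> E' \<Longrightarrow> b \<in> O' \<Longrightarrow> R' a b \<Longrightarrow> \<not> R' a (\<tau> b)"
  shows "card (bip_matchings E' O' R') \<le> (card (bip_matchings E O1 R))\<^sup>2"
proof -
  let ?P' = "bip_matchings E' O' R'" and ?P = "bip_matchings E O1 R"
  have finP: "finite ?P"
    using fin pE(1) pO(1) by (intro finite_bip_matchings) auto
  define Q where "Q = (\<lambda>M. \<lambda>a\<in>E'. {p (M a), p (M (\<tau> a))})"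
  define good where "good F S T \<longleftrightarrow> S \<subseteq> E' \<and> T \<subseteq> O' \<and> (\<forall>a\<in>E'. \<tau> a \<in> S \<longleftrightarrow> a \<notin> S)
      \<and> (\<forall>b\<in>O'. \<tau> b \<in> T \<longleftrightarrow> b \<notin> T)
      \<and> (\<forall>a\<in>E'. \<forall>b\<in>O'. R' a b \<and> p b \<in> F a \<longrightarrow> (a \<in> S \<longleftrightarrow> b \<in> T))" for F :: "'a \<Rightarrow> 'b set" and S T
  have M_facts: "M a \<in> O'" "R' a (M a)" if "M \<in> ?P'" "a \<in> E'" for M a
    using that by (auto simp: bip_matchings_def PiE_def)
  have M_inj: "M a = M b \<longleftrightarrow> a = b" if "M \<in> ?P'" "a \<in> E'" "b \<in> E'" for M a b
    using that by (auto simp: bip_matchings_def bij_betw_def inj_on_def)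
  have M_surj: "\<exists>a\<in>E'. M a = b" if "M \<in> ?P'" "b \<in> O'" for M b
    using that by (force simp: bip_matchings_def bij_betw_def)
  have goodD: "S \<subseteq> E'" "T \<subseteq> O'" "\<And>a. a \<in> E' \<Longrightarrow> \<tau> a \<in> S \<longleftrightarrow> a \<notin> S" "\<And>b. b \<in> O' \<Longrightarrow> \<tau> b \<in> T \<longleftrightarrow> b \<notin> T"
      "\<And>a b. a \<in> E' \<Longrightarrow> b \<in> O' \<Longrightarrow> R' a b \<Longrightarrow> p b \<in> F a \<Longrightarrow> a \<in> S \<longleftrightarrow> b \<in> T" if "good F S T" for F S T
      using that unfolding good_def by auto
  have lift_unique: "b = b'" if "a \<in> E'" "b \<in> O'" "b' \<in> O'" "R' a b" "R' a b'" "p b = p b'" for a b b'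
    using pO(2)[OF that(2,3)] that simple[OF that(1,2,4)] by blast
  have ex_good: "\<exists>S T. good (Q M) S T" if M: "M \<in> ?P'" for M
  proof -
    have bij: "bij_betw M E' O'" using M by (simp add: bip_matchings_def)
    \<comment> \<open>sends \<open>a\<close> to the vertex that is matched to the twin of the partner of \<open>a\<close>\<close>
    define \<pi> where "\<pi> a = inv_into E' M (\<tau> (M a))" for a
    have M\<pi>: "M (\<pi> a) = \<tau> (M a)" "\<pi> a \<in> E'" if "a \<in> E'" for a
    proof -
      have "\<tau> (M a) \<in> M ` E'"
        using bij M_facts(1)[OF M that] \<tau>O unfolding bij_betw_def by blast
      then show "M (\<pi> a) = \<tau> (M a)" "\<pi> a \<in> E'"
        unfolding \<pi>_def by (rule f_inv_into_f, rule inv_into_into)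
    qed
    note inj = M_inj[OF M]
    have \<pi>: "\<pi> a \<in> E' \<and> \<pi> a \<noteq> a \<and> \<pi> (\<pi> a) = a" if a: "a \<in> E'" for a
    proof (intro conjI)
      show "\<pi> a \<in> E'" by (rule M\<pi>(2)[OF a])
      show "\<pi> a \<noteq> a" using M\<pi>(1)[OF a] \<tau>O[OF M_facts(1)[OF M a]] by metis
      have "M (\<pi> (\<pi> a)) = M a"
        using M\<pi>(1)[OF M\<pi>(2)[OF a]] M\<pi>(1)[OF a] \<tau>O[OF M_facts(1)[OF M a]] by simp
      then show "\<pi> (\<pi> a) = a" using inj[OF M\<pi>(2)[OF M\<pi>(2)[OF a]] a] by simp
    qed
    obtain S where S: "S \<subseteq> E'" "\<And>x. x \<in> E' \<Longrightarrow> (\<tau> x \<in> S \<longleftrightarrow> x \<notin> S) \<and> (\<pi> x \<in> S \<longleftrightarrow> x \<notin> S)"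
      using common_transversal_of_involutions[OF fin(1) \<tau>E \<pi>] by auto
    have MS: "M a \<in> M ` S \<longleftrightarrow> a \<in> S" if "a \<in> E'" for a
    proof
      assume "M a \<in> M ` S"
      then obtain a' where a': "a' \<in> S" "M a = M a'" by blast
      then show "a \<in> S" using inj[OF that subsetD[OF S(1) a'(1)]] by simp
    qed simp
    have "good (Q M) S (M ` S)"
      unfolding good_def
    proof (intro conjI ballI impI)
      show "S \<subseteq> E'" by fact
      show "M ` S \<subseteq> O'" using S(1) M_facts(1)[OF M] by blast
      show "(\<tau> a \<in> S) = (a \<notin> S)" if "a \<in> E'" for a
        by (rule conjunct1[OF S(2)[OF that]])
      show "(\<tau> b \<in> M ` S) = (b \<notin> M ` S)" if b: "b \<in> O'" for b
      proof -
        obtain c where c: "c \<in> E'" "b = M c" using M_surj[OF M b] by blast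
        show ?thesis using MS[OF c(1)] MS[OF M\<pi>(2)[OF c(1)]] M\<pi>(1)[OF c(1)] S(2)[OF c(1)] c(2) by metis
      qed
      fix a b assume a: "a \<in> E'" and b: "b \<in> O'" and ab: "R' a b \<and> p b \<in> Q M a"
      have \<tau>a: "\<tau> a \<in> E'" "\<tau> (\<tau> a) = a" using \<tau>E[OF a] by auto
      let ?c = "M (\<tau> a)"
      have c: "?c \<in> O'" "\<tau> ?c \<in> O'" "\<tau> (\<tau> ?c) = ?c" using M_facts(1)[OF M \<tau>a(1)] \<tau>O by auto
      have "R' a (\<tau> ?c)" using R\<tau>[OF \<tau>a(1) c(1) M_facts(2)[OF M \<tau>a(1)]] unfolding \<tau>a(2) .
      have "p ?c = p (\<tau> ?c)" using pO(2)[OF c(1,2)] by blast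
      have "p b = p (M a) \<or> p b = p ?c" using ab a unfolding Q_def by simp
      then have "b = M a \<or> b = \<tau> ?c"
      proof
        assume "p b = p (M a)"
        then show ?thesis using lift_unique[OF a b M_facts(1)[OF M a] _ M_facts(2)[OF M a]] ab by blast
      next
        assume "p b = p ?c"
        then have "p b = p (\<tau> ?c)" using \<open>p ?c = p (\<tau> ?c)\<close> by (rule trans)
        then show ?thesis using lift_unique[OF a b c(2) _ \<open>R' a (\<tau> ?c)\<close>] ab by blast
      qed
      then show "(a \<in> S) = (b \<in> M ` S)"
      proof
        assume "b = M a" then show ?thesis using MS[OF a] by metis
      next
        assume b: "b = \<tau> ?c"
        have "b = M (\<pi> (\<tau> a))" using M\<pi>(1)[OF \<tau>a(1)] b by metis
        then have "b \<in> M ` S \<longleftrightarrow> \<pi> (\<tau> a) \<in> S" using MS[OF M\<pi>(2)[OF \<tau>a(1)]] by metis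
        then show ?thesis using S(2)[OF \<tau>a(1)] S(2)[OF a] by blast
      qed
    qed
    then show ?thesis by blast
  qed
  \<comment> \<open>the choice is a function of the projection, not of the matching; injectivity depends on this\<close>
  define ST where "ST F = (SOME ST. good F (fst ST) (snd ST))" for F
  define Sf Tf where "Sf F = fst (ST F)" and "Tf F = snd (ST F)" for F
  have "good F (Sf F) (Tf F)" if ex: "\<exists>S T. good F S T" for F
    using someI_ex[of "\<lambda>ST. good F (fst ST) (snd ST)"] ex by (auto simp: Sf_def Tf_def ST_def)
  then have good: "good (Q M) (Sf (Q M)) (Tf (Q M))" if "M \<in> ?P'" for M
    using ex_good[OF that] by blast
  have good_compl: "good F (E' - S) (O' - T)" if "good F S T" for F S T
  proof -
    note * = goodD[OF that]
    show ?thesis unfolding good_def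
    proof (intro conjI ballI impI)
      show "(\<tau> a \<in> E' - S) = (a \<notin> E' - S)" if "a \<in> E'" for a using *(3)[OF that] \<tau>E[OF that] that by blast
      show "(\<tau> b \<in> O' - T) = (b \<notin> O' - T)" if "b \<in> O'" for b using *(4)[OF that] \<tau>O[OF that] that by blast
      show "(a \<in> E' - S) = (b \<in> O' - T)" if "a \<in> E'" "b \<in> O'" "R' a b \<and> p b \<in> F a" for a b
        using *(5)[of a b] that by blast
    qed auto
  qed
  define lft where "lft S x = (SOME a. a \<in> S \<and> p a = x)" for S :: "'a set" and x
  have lft_eq: "lft S (p a) = a" if "a \<in> S" "good F S T" for a S T F
  proof -
    note * = goodD[OF that(2)]
    have "lft S (p a) \<in> S \<and> p (lft S (p a)) = p a" unfolding lft_def by (rule someI[of _ a]) (use that in auto)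
    then show ?thesis using *(3)[of a] subsetD[OF *(1)] that(1) pE(2)[of a "lft S (p a)"] by metis
  qed
  have transv: "\<exists>a\<in>S. p a = x" if x: "x \<in> E" and g: "good F S T" for x S T F
  proof -
    obtain a where a: "a \<in> E'" "p a = x" using x pE(1) by blast
    have "p (\<tau> a) = x" using pE(2)[of a "\<tau> a"] \<tau>E[OF a(1)] a by auto
    moreover have "a \<in> S \<or> \<tau> a \<in> S" using goodD(3)[OF g a(1)] by blast
    ultimately show ?thesis using a by blast
  qed
  define half where "half S M = (\<lambda>x\<in>E. p (M (lft S x)))" for S M
  have half: "half S M \<in> ?P" if M: "M \<in> ?P'" and g: "good (Q M) S T" for S T M
  proof -
    have S: "a \<in> E'" if "a \<in> S" for a using goodD(1)[OF g] that by blast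
    have MT: "M a \<in> T" if "a \<in> S" for a
      using goodD(5)[OF g S[OF that] M_facts(1,2)[OF M S[OF that]]] S[OF that] that by (simp add: Q_def)
    have hp: "half S M (p a) = p (M a)" if "a \<in> S" for a
      using lft_eq[OF that g] S[OF that] pE(1) by (auto simp: half_def)
    have "inj_on (half S M) E"
    proof
      fix x y assume xy: "x \<in> E" "y \<in> E" "half S M x = half S M y"
      obtain a b where ab: "a \<in> S" "b \<in> S" "p a = x" "p b = y"
        using transv[OF xy(1) g] transv[OF xy(2) g] by blast
      have O: "M a \<in> O'" "M b \<in> O'" using M_facts(1)[OF M] ab S by blast+
      have "p (M a) = p (M b)" using xy(3) hp[OF ab(1)] hp[OF ab(2)] ab by simp
      then have "M b = M a \<or> M b = \<tau> (M a)" using pO(2)[OF O] by simp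
      moreover have "M b \<noteq> \<tau> (M a)" using MT[OF ab(1)] MT[OF ab(2)] goodD(4)[OF g O(1)] by auto
      ultimately have "M a = M b" by simp
      then have "a = b" using M_inj[OF M] ab S by blast
      then show "x = y" using ab by simp
    qed
    moreover have "half S M ` E = O1"
    proof
      show "half S M ` E \<subseteq> O1" 
      proof
        fix y assume "y \<in> half S M ` E"
        then obtain x where x: "x \<in> E" "y = half S M x" by blast
        then obtain a where a: "a \<in> S" "p a = x" using transv[OF _ g] by blast
        have "y = p (M a)" using x(2) hp[OF a(1)] a(2) by simp
        then show "y \<in> O1" using M_facts(1)[OF M S[OF a(1)]] pO(1) by blast
      qed
      show "O1 \<subseteq> half S M ` E"
      proof
        fix y assume "y \<in> O1"
        then obtain b0 where b0: "b0 \<in> O'" "p b0 = y" using pO by auto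
        have "\<exists>b\<in>T. b \<in> O' \<and> p b = y"
          using b0 pO(2)[OF b0(1), of "\<tau> b0"] \<tau>O[OF b0(1)] goodD(4)[OF g b0(1)] by (cases "b0 \<in> T") auto
        then obtain b where b: "b \<in> T" "b \<in> O'" "p b = y" by blast
        then obtain a where a: "a \<in> E'" "M a = b" using M_surj[OF M] by blast
        have "a \<in> S" using goodD(5)[OF g a(1) b(2)] a b M_facts(2)[OF M a(1)] by (simp add: Q_def)
        then have "half S M (p a) = y" using hp a b by simp
        then show "y \<in> half S M ` E" using a pE(1) by blast
      qed
    qed
    moreover have "R x (half S M x)" if x: "x \<in> E" for x
    proof -
      obtain a where a: "a \<in> S" "p a = x" using transv[OF x g] by blast
      show ?thesis
        using R[OF S[OF a(1)] M_facts(1,2)[OF M S[OF a(1)]]] unfolding hp[OF a(1), symmetric] a(2) .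
    qed
    moreover have "half S M \<in> extensional E" by (simp add: half_def)
    ultimately show ?thesis unfolding bip_matchings_def PiE_def bij_betw_def by blast
  qed
  \<comment> \<open>the second component works because the complements of \<open>S\<close> and \<open>T\<close> are suitable as well\<close>
  define \<Phi> where "\<Phi> M = (half (Sf (Q M)) M, half (E' - Sf (Q M)) M)" for M
  have "card ?P' \<le> card (?P \<times> ?P)"
  proof (rule card_inj_on_le[of \<Phi>])
    show "\<Phi> ` ?P' \<subseteq> ?P \<times> ?P"
    proof
      fix x assume "x \<in> \<Phi> ` ?P'"
      then obtain M where M: "M \<in> ?P'" "x = \<Phi> M" by blast
      show "x \<in> ?P \<times> ?P" unfolding M(2) \<Phi>_def
        using half[OF M(1) good[OF M(1)]] half[OF M(1) good_compl[OF good[OF M(1)]]] by (rule SigmaI)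
    qed
    show "finite (?P \<times> ?P)" using finP by simp
    have half_p: "a \<in> S \<Longrightarrow> good F S T \<Longrightarrow> half S M (p a) = p (M a)" for a S T M F
      using lft_eq[of a S F T] goodD(1)[of F S T] pE(1) by (auto simp: half_def)
    have Q\<Phi>: "Q M a = {fst (\<Phi> M) (p a), snd (\<Phi> M) (p a)}" if M: "M \<in> ?P'" and a: "a \<in> E'" for M a
    proof -
      let ?S = "Sf (Q M)"
      note g = good[OF M] and gc = good_compl[OF good[OF M]]
      have \<tau>a: "\<tau> a \<in> E'" "p (\<tau> a) = p a" using \<tau>E[OF a] pE(2)[OF a, of "\<tau> a"] by auto
      show ?thesis
      proof (cases "a \<in> ?S")
        case True
        then have "\<tau> a \<in> E' - ?S" using goodD(3)[OF g a] \<tau>a by blast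
        from half_p[OF this gc, of M] half_p[OF True g, of M]
        show ?thesis using a unfolding Q_def \<Phi>_def \<tau>a(2) by simp
      next
        case False
        then have "\<tau> a \<in> ?S" "a \<in> E' - ?S" using goodD(3)[OF g a] a by blast+
        from half_p[OF this(1) g, of M] half_p[OF this(2) gc, of M]
        show ?thesis using a unfolding Q_def \<Phi>_def \<tau>a(2) by (simp add: insert_commute)
      qed
    qed
    show "inj_on \<Phi> ?P'"
    proof
      fix M N assume M: "M \<in> ?P'" and N: "N \<in> ?P'" and eq: "\<Phi> M = \<Phi> N"
      have "Q M = Q N"
      proof
        fix a show "Q M a = Q N a"
        proof (cases "a \<in> E'")
          case True
          then show ?thesis using Q\<Phi>[OF M, of a] Q\<Phi>[OF N, of a] eq by metis
        qed (simp add: Q_def)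
      qed
      then have h: "half (Sf (Q M)) M = half (Sf (Q M)) N" "half (E' - Sf (Q M)) M = half (E' - Sf (Q M)) N"
        using eq by (auto simp: \<Phi>_def)
      note g = good[OF M] and gc = good_compl[OF good[OF M]]
      show "M = N"
      proof (rule extensionalityI)
        show "M \<in> extensional E'" "N \<in> extensional E'" using M N by (auto simp: bip_matchings_def PiE_def)
        fix a assume a: "a \<in> E'"
        have "p (M a) = p (N a)"
        proof (cases "a \<in> Sf (Q M)")
          case True then show ?thesis
            using half_p[OF True g, of M] half_p[OF True g, of N] fun_cong[OF h(1), of "p a"] by simp
        next
          case False
          then have "a \<in> E' - Sf (Q M)" using a by simp
          then show ?thesis
            using half_p[OF _ gc, of a M] half_p[OF _ gc, of a N] fun_cong[OF h(2), of "p a"] by simp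
        qed
        then show "M a = N a"
          using lift_unique[OF a] M_facts(1,2)[OF M a] M_facts(1,2)[OF N a] by blast
      qed
    qed
  qed
  then show ?thesis by (simp add: card_cartesian_product power2_eq_square)
qed

section \<open>Existence of the dimer constant\<close>

lemma cubic_adj_iff:
  "cubic_adj (x1, x2, x3) (y1, y2, y3) \<longleftrightarrow> (x1 - y1)\<^sup>2 + (x2 - y2)\<^sup>2 + (x3 - y3)\<^sup>2 = 1"
proof -
  have "(real_of_int x1 - real_of_int y1)\<^sup>2 + (real_of_int x2 - real_of_int y2)\<^sup>2
         + (real_of_int x3 - real_of_int y3)\<^sup>2 = real_of_int ((x1 - y1)\<^sup>2 + (x2 - y2)\<^sup>2 + (x3 - y3)\<^sup>2)"
    by simp
  then show ?thesis unfolding cubic_adj_def by (simp del: of_int_add of_int_power of_int_diff)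
qed

definition pm_count :: "(int \<times> int \<times> int) set \<Rightarrow> nat" where
  "pm_count S = card {M. perfect_matching S (induced_edges S) M}"

lemma num_matchings_eq: "num_matchings a b c = pm_count (lattice_box a b c)"
  by (simp add: num_matchings_def pm_count_def)

lemma finite_perfect_matchings:
  assumes "finite S" shows "finite {M. perfect_matching S (induced_edges S) M}"
proof -
  have "induced_edges S \<subseteq> Pow S" by (auto simp: induced_edges_def)
  then have "finite (induced_edges S)" using assms by (auto intro: finite_subset)
  then show ?thesis
    by (rule_tac finite_subset[of _ "Pow (induced_edges S)"]) (auto simp: perfect_matching_def)
qed

lemma pm_count_union:
  assumes fin: "finite S" "finite T" and disj: "S \<inter> T = {}"
  shows "pm_count S * pm_count T \<le> pm_count (S \<union> T)"
proof -
  let ?P = "\<lambda>S. {M. perfect_matching S (induced_edges S) M}"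
  have edge: "e \<subseteq> S \<and> e \<noteq> {}" if "e \<in> M" "M \<in> ?P S" for e M S
    using that by (fastforce simp: perfect_matching_def induced_edges_def)
  have "card (?P S \<times> ?P T) \<le> card (?P (S \<union> T))"
  proof (rule card_inj_on_le[of "\<lambda>(M, N). M \<union> N"])
    show "finite (?P (S \<union> T))" using fin by (intro finite_perfect_matchings) simp
    show "inj_on (\<lambda>(M, N). M \<union> N) (?P S \<times> ?P T)"
    proof (rule inj_onI, clarsimp)
      fix M N M' N'
      assume *: "perfect_matching S (induced_edges S) M" "perfect_matching T (induced_edges T) N"
        "perfect_matching S (induced_edges S) M'" "perfect_matching T (induced_edges T) N'"
        and eq: "M \<union> N = M' \<union> N'"
      have sep: "M = {e \<in> M \<union> N. e \<subseteq> S}" "N = {e \<in> M \<union> N. e \<subseteq> T}"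
        if "perfect_matching S (induced_edges S) M" "perfect_matching T (induced_edges T) N" for M N
        using edge[of _ M S] edge[of _ N T] that disj by blast+
      show "M = M' \<and> N = N'"
        using sep[OF *(1,2)] sep[OF *(3,4)] eq by metis
    qed
    show "(\<lambda>(M, N). M \<union> N) ` (?P S \<times> ?P T) \<subseteq> ?P (S \<union> T)"
    proof clarsimp
      fix M N
      assume M: "perfect_matching S (induced_edges S) M" and N: "perfect_matching T (induced_edges T) N"
      have eS: "e \<subseteq> S" if "e \<in> M" for e using edge[of e M S] that M by simp
      have eT: "e \<subseteq> T" if "e \<in> N" for e using edge[of e N T] that N by simp
      have "M \<union> N \<subseteq> induced_edges (S \<union> T)"
        using M N unfolding perfect_matching_def induced_edges_def by blast
      moreover have "\<exists>!e. e \<in> M \<union> N \<and> v \<in> e" if v: "v \<in> S \<union> T" for v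
      proof (cases "v \<in> S")
        case True
        then have "v \<notin> e" if "e \<in> N" for e using eT[OF that] disj by blast
        moreover have "\<exists>!e. e \<in> M \<and> v \<in> e" using M True by (simp add: perfect_matching_def)
        ultimately show ?thesis by blast
      next
        case False
        then have "v \<notin> e" if "e \<in> M" for e using eS[OF that] by blast
        moreover have "\<exists>!e. e \<in> N \<and> v \<in> e" using N False v by (simp add: perfect_matching_def)
        ultimately show ?thesis by blast
      qed
      ultimately show "perfect_matching (S \<union> T) (induced_edges (S \<union> T)) (M \<union> N)"
        by (simp add: perfect_matching_def)
    qed
  qed
  then show ?thesis by (simp add: pm_count_def card_cartesian_product)
qed

lemma pm_count_image:
  assumes fin: "finite S" and inj: "inj_on f S"
    and adj: "\<And>x y. x \<in> S \<Longrightarrow> y \<in> S \<Longrightarrow> cubic_adj x y \<Longrightarrow> cubic_adj (f x) (f y)"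
  shows "pm_count S \<le> pm_count (f ` S)"
  unfolding pm_count_def
proof (rule card_inj_on_le[of "\<lambda>M. (\<lambda>e. f ` e) ` M"])
  let ?P = "\<lambda>S. {M. perfect_matching S (induced_edges S) M}"
  show "finite (?P (f ` S))" using fin by (intro finite_perfect_matchings) simp
  have sub: "M \<subseteq> Pow S" if "M \<in> ?P S" for M
    using that by (auto simp: perfect_matching_def induced_edges_def)
  have inj1: "inj_on (\<lambda>e. f ` e) (Pow S)" by (rule inj_on_image_Pow[OF inj])
  have inj2: "inj_on (\<lambda>M. (\<lambda>e. f ` e) ` M) (Pow (Pow S))" by (rule inj_on_image_Pow[OF inj1])
  show "inj_on (\<lambda>M. (\<lambda>e. f ` e) ` M) (?P S)"
    by (rule inj_on_subset[OF inj2]) (use sub in blast)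
  show "(\<lambda>M. (\<lambda>e. f ` e) ` M) ` ?P S \<subseteq> ?P (f ` S)"
  proof clarsimp
    fix M assume M: "perfect_matching S (induced_edges S) M"
    have MS: "e \<subseteq> S" if "e \<in> M" for e using sub[of M] M that by blast
    have "(\<lambda>e. f ` e) ` M \<subseteq> induced_edges (f ` S)"
    proof
      fix e' assume "e' \<in> (\<lambda>e. f ` e) ` M"
      then obtain e where e: "e \<in> M" "e' = f ` e" by blast
      then obtain x y where xy: "e = {x, y}" "x \<in> S" "y \<in> S" "cubic_adj x y"
        using M by (force simp: perfect_matching_def induced_edges_def)
      have "e' = {f x, f y}" using e xy by simp
      then show "e' \<in> induced_edges (f ` S)" using adj xy unfolding induced_edges_def by blast
    qed
    moreover have "\<exists>!e. e \<in> (\<lambda>e. f ` e) ` M \<and> f v \<in> e" if v: "v \<in> S" for v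
    proof -
      obtain e where e: "e \<in> M" "v \<in> e" and un: "\<And>e'. e' \<in> M \<Longrightarrow> v \<in> e' \<Longrightarrow> e' = e"
        using M v unfolding perfect_matching_def by metis
      have "v \<in> e'" if "e' \<in> M" "f v \<in> f ` e'" for e'
        using inj MS[OF that(1)] v that(2) by (metis inj_on_image_mem_iff)
      then show ?thesis using e un by (intro ex1I[of _ "f ` e"]) blast+
    qed
    ultimately show "perfect_matching (f ` S) (induced_edges (f ` S)) ((\<lambda>e. f ` e) ` M)"
      by (simp add: perfect_matching_def)
  qed
qed

lemma finite_lattice_box: "finite (lattice_box a b c)"
  by (simp add: lattice_box_def)

lemma num_matchings_swap12_le: "num_matchings a b c \<le> num_matchings b a c"
proof -
  have "lattice_box b a c = (\<lambda>(x, y, z). (y, x, z)) ` lattice_box a b c"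
    by (force simp: lattice_box_def image_iff)
  then show ?thesis unfolding num_matchings_eq
    by (simp only:) (rule pm_count_image[OF finite_lattice_box],
        auto simp: inj_on_def cubic_adj_iff algebra_simps)
qed

lemma num_matchings_swap23_le: "num_matchings a b c \<le> num_matchings a c b"
proof -
  have "lattice_box a c b = (\<lambda>(x, y, z). (x, z, y)) ` lattice_box a b c"
    by (force simp: lattice_box_def image_iff)
  then show ?thesis unfolding num_matchings_eq
    by (simp only:) (rule pm_count_image[OF finite_lattice_box],
        auto simp: inj_on_def cubic_adj_iff algebra_simps)
qed

lemma num_matchings_swap12: "num_matchings a b c = num_matchings b a c"
  by (intro antisym num_matchings_swap12_le)

lemma num_matchings_swap23: "num_matchings a b c = num_matchings a c b"
  by (intro antisym num_matchings_swap23_le)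

lemma num_matchings_add:
  "num_matchings a b c * num_matchings a' b c \<le> num_matchings (a + a') b c"
proof -
  let ?f = "\<lambda>(x, y, z). (x + int a, y, z)"
  let ?S = "lattice_box a b c" and ?T = "lattice_box a' b c"
  have "pm_count ?T \<le> pm_count (?f ` ?T)"
    by (rule pm_count_image[OF finite_lattice_box]) (auto simp: inj_on_def cubic_adj_iff)
  then have "pm_count ?S * pm_count ?T \<le> pm_count ?S * pm_count (?f ` ?T)" by simp
  also have "\<dots> \<le> pm_count (?S \<union> ?f ` ?T)"
    by (rule pm_count_union) (auto simp: finite_lattice_box lattice_box_def)
  also have "?S \<union> ?f ` ?T = lattice_box (a + a') b c"
  proof
    show "?S \<union> ?f ` ?T \<subseteq> lattice_box (a + a') b c" by (auto simp: lattice_box_def)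
    show "lattice_box (a + a') b c \<subseteq> ?S \<union> ?f ` ?T"
    proof
      fix v assume v: "v \<in> lattice_box (a + a') b c"
      obtain x y z where xyz: "v = (x, y, z)" by (metis prod_cases3)
      show "v \<in> ?S \<union> ?f ` ?T"
      proof (cases "x < int a")
        case True then show ?thesis using v xyz by (auto simp: lattice_box_def)
      next
        case False
        then have "(x - int a, y, z) \<in> ?T" "v = ?f (x - int a, y, z)"
          using v xyz by (auto simp: lattice_box_def)
        then show ?thesis by blast
      qed
    qed
  qed
  finally show ?thesis by (simp add: num_matchings_eq)
qed

lemma num_matchings_ge_1I:
  assumes "perfect_matching (lattice_box a b c) (induced_edges (lattice_box a b c)) M"
  shows "1 \<le> num_matchings a b c"
proof -
  have "0 < num_matchings a b c"
    unfolding num_matchings_def using assms finite_perfect_matchings[OF finite_lattice_box]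
    by (subst card_gt_0_iff) auto
  then show ?thesis by simp
qed

lemma num_matchings_0: "1 \<le> num_matchings 0 b c"
  by (rule num_matchings_ge_1I[of _ _ _ "{}"]) (simp add: perfect_matching_def lattice_box_def)

lemma num_matchings_dimer: "1 \<le> num_matchings 2 1 1"
proof (rule num_matchings_ge_1I)
  let ?e = "{(0, 0, 0), (1, 0, 0)} :: (int \<times> int \<times> int) set"
  have box: "lattice_box 2 1 1 = ?e" by (auto simp: lattice_box_def)
  have "cubic_adj (0, 0, 0) (1, 0, 0)" by (simp add: cubic_adj_iff)
  then have "?e \<in> induced_edges ?e" unfolding induced_edges_def by blast
  then show "perfect_matching (lattice_box 2 1 1) (induced_edges (lattice_box 2 1 1)) {?e}"
    unfolding box perfect_matching_def by blast
qed

lemma num_matchings_mult1: "num_matchings a b c ^ q \<le> num_matchings (q * a) b c"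
proof (induction q)
  case 0 show ?case using num_matchings_0 by simp
next
  case (Suc q)
  have "num_matchings a b c ^ Suc q \<le> num_matchings a b c * num_matchings (q * a) b c"
    using Suc by simp
  also have "\<dots> \<le> num_matchings (Suc q * a) b c" using num_matchings_add[of a b c "q * a"] by simp
  finally show ?case .
qed

lemma num_matchings_mult2: "num_matchings a b c ^ q \<le> num_matchings a (q * b) c"
  using num_matchings_mult1[of b a c q] by (simp add: num_matchings_swap12)

lemma num_matchings_mult3: "num_matchings a b c ^ q \<le> num_matchings a b (q * c)"
  using num_matchings_mult2[of a c b q] by (simp add: num_matchings_swap23)

lemma num_matchings_mult:
  "num_matchings a b c ^ (p * q * r) \<le> num_matchings (p * a) (q * b) (r * c)"
proof -
  have "num_matchings a b c ^ (p * q * r) = ((num_matchings a b c ^ p) ^ q) ^ r"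
    by (simp add: power_mult)
  also have "\<dots> \<le> (num_matchings (p * a) b c ^ q) ^ r"
    by (intro power_mono num_matchings_mult1) auto
  also have "\<dots> \<le> (num_matchings (p * a) (q * b) c) ^ r"
    by (intro power_mono num_matchings_mult2) auto
  also have "\<dots> \<le> num_matchings (p * a) (q * b) (r * c)" by (rule num_matchings_mult3)
  finally show ?thesis .
qed

lemma num_matchings_even1: assumes "even a" shows "1 \<le> num_matchings a b c"
proof -
  obtain k where k: "a = k * 2" using assms by (metis dvdE mult.commute)
  have "1 \<le> num_matchings 2 1 1 ^ (k * b * c)" using num_matchings_dimer by (rule one_le_power)
  also have "\<dots> \<le> num_matchings (k * 2) (b * 1) (c * 1)" by (rule num_matchings_mult)
  finally show ?thesis by (simp add: k)
qed

lemma num_matchings_even: assumes "even (a * b * c)" shows "1 \<le> num_matchings a b c"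
proof -
  consider "even a" | "even b" | "even c" using assms by auto
  then show ?thesis
  proof cases
    case 1 then show ?thesis by (rule num_matchings_even1)
  next
    case 2 then show ?thesis using num_matchings_even1[of b a c] num_matchings_swap12[of a b c] by simp
  next
    case 3
    then show ?thesis using num_matchings_even1[of c a b] num_matchings_swap12[of a c b] num_matchings_swap23[of a b c] by simp
  qed
qed

text \<open>The slab that is cut off has thickness \<open>A mod a\<close>: if \<open>A\<close> is even, so is this, and if \<open>A\<close> is odd, then
  \<open>B * C\<close> is even.\<close>

lemma num_matchings_trim1:
  assumes "even a" "even (A * B * C)"
  shows "num_matchings (A div a * a) B C \<le> num_matchings A B C"
proof -
  have A: "A = A div a * a + A mod a" by simp
  have "even (A mod a * B * C)"
    using assms by (metis A dvd_add_right_iff dvd_mult even_mult_iff)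
  then have "num_matchings (A div a * a) B C * 1 \<le> num_matchings (A div a * a) B C * num_matchings (A mod a) B C"
    by (intro mult_left_mono num_matchings_even) auto
  also have "\<dots> \<le> num_matchings (A div a * a + A mod a) B C" by (rule num_matchings_add)
  finally show ?thesis by simp
qed

text \<open>Fill a corner of the large box with copies of the small one.  What is left can be cut into three
  slabs, each of even volume because \<open>a\<close>, \<open>b\<close>, \<open>c\<close> are even, and a box of even volume has at least one
  perfect matching.\<close>

lemma num_matchings_tile:
  assumes "even a" "even b" "even c" "even (A * B * C)"
  shows "num_matchings a b c ^ (A div a * (B div b) * (C div c)) \<le> num_matchings A B C"
proof -
  have "num_matchings a b c ^ (A div a * (B div b) * (C div c))
      \<le> num_matchings (A div a * a) (B div b * b) (C div c * c)" by (rule num_matchings_mult)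
  also have "\<dots> = num_matchings (C div c * c) (B div b * b) (A div a * a)"
    using num_matchings_swap12 num_matchings_swap23 by metis
  also have "\<dots> \<le> num_matchings C (B div b * b) (A div a * a)"
    using assms by (intro num_matchings_trim1) auto
  also have "\<dots> = num_matchings (B div b * b) C (A div a * a)" by (rule num_matchings_swap12)
  also have "\<dots> \<le> num_matchings B C (A div a * a)"
    using assms by (intro num_matchings_trim1) auto
  also have "\<dots> = num_matchings (A div a * a) B C"
    using num_matchings_swap12 num_matchings_swap23 by metis
  also have "\<dots> \<le> num_matchings A B C"
    using assms by (intro num_matchings_trim1) auto
  finally show ?thesis .
qed

definition density :: "nat \<times> nat \<times> nat \<Rightarrow> real" where
  "density = (\<lambda>(a, b, c). ln (real (num_matchings a b c)) / real (a * b * c))"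

definition even_boxes :: "(nat \<times> nat \<times> nat) filter" where
  "even_boxes = inf (at_top \<times>\<^sub>F at_top \<times>\<^sub>F at_top) (principal {(a1, a2, a3). even (a1 * a2 * a3)})"

lemma dimer_constant_eq: "dimer_constant = Lim even_boxes density"
  by (simp add: dimer_constant_def even_boxes_def density_def)

text \<open>Without this the limit in the definition of the dimer constant would not be determined by
  convergence.\<close>

lemma even_boxes_nontrivial: "even_boxes \<noteq> bot"
proof
  assume bot: "even_boxes = bot"
  have f: "filterlim (\<lambda>k::nat. 2 * k) at_top sequentially"
    by (rule filterlim_at_top_mono[OF filterlim_ident]) auto
  have "filterlim (\<lambda>k::nat. (2 * k, 2 * k, 2 * k)) even_boxes sequentially"
    unfolding even_boxes_def filterlim_inf filterlim_principal
    by (intro conjI filterlim_Pair f) auto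
  then show False by (simp add: bot filterlim_def filtermap_bot_iff bot_unique)
qed


lemma coordinates_at_top:
  "filterlim fst at_top (at_top \<times>\<^sub>F at_top \<times>\<^sub>F at_top :: (nat \<times> nat \<times> nat) filter)"
  "filterlim (\<lambda>v. fst (snd v)) at_top (at_top \<times>\<^sub>F at_top \<times>\<^sub>F at_top :: (nat \<times> nat \<times> nat) filter)"
  "filterlim (\<lambda>v. snd (snd v)) at_top (at_top \<times>\<^sub>F at_top \<times>\<^sub>F at_top :: (nat \<times> nat \<times> nat) filter)"
proof -
  show "filterlim fst at_top (at_top \<times>\<^sub>F at_top \<times>\<^sub>F at_top :: (nat \<times> nat \<times> nat) filter)"
    by (simp add: filterlim_def filtermap_fst_prod_filter)
  show "filterlim (\<lambda>v. fst (snd v)) at_top (at_top \<times>\<^sub>F at_top \<times>\<^sub>F at_top :: (nat \<times> nat \<times> nat) filter)"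
    by (rule filterlim_compose[where g = fst and ?F2.0 = "at_top \<times>\<^sub>F at_top"]) (simp_all add: filterlim_def filtermap_fst_prod_filter filtermap_snd_prod_filter)
  show "filterlim (\<lambda>v. snd (snd v)) at_top (at_top \<times>\<^sub>F at_top \<times>\<^sub>F at_top :: (nat \<times> nat \<times> nat) filter)"
    by (rule filterlim_compose[where g = snd and ?F2.0 = "at_top \<times>\<^sub>F at_top"]) (simp_all add: filterlim_def filtermap_snd_prod_filter)
qed

lemma div_ratio_tendsto: assumes "0 < a"
  shows "(\<lambda>A. real (A div a) / real A) \<longlonglongrightarrow> 1 / real a"
proof (rule tendsto_sandwich)
  show "(\<lambda>A. 1 / real a - 1 / real A) \<longlonglongrightarrow> 1 / real a"
    using tendsto_diff[OF tendsto_const lim_1_over_n, of "1 / real a"] by simp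
  show "(\<lambda>A. 1 / real a) \<longlonglongrightarrow> 1 / real a" by simp
  show "\<forall>\<^sub>F A in sequentially. 1 / real a - 1 / real A \<le> real (A div a) / real A"
    using eventually_gt_at_top[of 0]
  proof eventually_elim
    case (elim A)
    have "real (A mod a) / real a \<le> 1" using assms by (simp add: less_imp_le)
    then have "real A / real a - 1 \<le> real (A div a)" by (simp add: of_nat_of_nat_div_aux[of A a])
    then have "(real A / real a - 1) / real A \<le> real (A div a) / real A" by (rule divide_right_mono) simp
    then show ?case using elim by (simp add: diff_divide_distrib)
  qed
  show "\<forall>\<^sub>F A in sequentially. real (A div a) / real A \<le> 1 / real a"
    using eventually_gt_at_top[of 0]
  proof eventually_elim
    case (elim A)
    have "real (A div a) / real A \<le> real A / real a / real A"
      by (rule divide_right_mono[OF of_nat_div_le_of_nat]) simp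
    then show ?case using elim by simp
  qed
qed

lemma density_liminf:
  assumes e: "even a" "even b" "even c" and pos: "0 < a" "0 < b" "0 < c" and x: "x < density (a, b, c)"
  shows "\<forall>\<^sub>F v in even_boxes. x < density v"
proof -
  define L where "L = ln (real (num_matchings a b c))"
  define g where "g = (\<lambda>(A, B, C). real (A div a) / real A * (real (B div b) / real B) * (real (C div c) / real C) * L)"
  note 1 = coordinates_at_top(1) and 2 = coordinates_at_top(2) and 3 = coordinates_at_top(3)
  have "(g \<longlongrightarrow> 1 / real a * (1 / real b) * (1 / real c) * L) (at_top \<times>\<^sub>F at_top \<times>\<^sub>F at_top)"
    unfolding g_def case_prod_beta
    by (intro tendsto_mult tendsto_const filterlim_compose[OF div_ratio_tendsto 1]
        filterlim_compose[OF div_ratio_tendsto 2] filterlim_compose[OF div_ratio_tendsto 3] pos)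
  then have "(g \<longlongrightarrow> density (a, b, c)) even_boxes"
    unfolding even_boxes_def by (rule_tac tendsto_mono[OF inf_le1]) (simp add: density_def L_def)
  then have "\<forall>\<^sub>F v in even_boxes. x < g v" using x by (rule order_tendstoD)
  moreover have "\<forall>\<^sub>F v in even_boxes. g v \<le> density v"
    unfolding even_boxes_def eventually_inf_principal
  proof (rule always_eventually, clarify)
    fix A B C :: nat assume ev: "even (A * B * C)"
    let ?q = "A div a * (B div b) * (C div c)"
    have n: "1 \<le> num_matchings a b c" using e by (intro num_matchings_even) auto
    have "real ?q * L = ln (real (num_matchings a b c) ^ ?q)" using n by (simp add: L_def ln_realpow)
    also have "\<dots> \<le> ln (real (num_matchings A B C))"
    proof -
      have "real (num_matchings a b c) ^ ?q \<le> real (num_matchings A B C)"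
        using num_matchings_tile[OF e ev] by (metis of_nat_le_iff of_nat_power)
      moreover have "0 < real (num_matchings a b c) ^ ?q" using n by (intro zero_less_power) simp
      ultimately show ?thesis by (intro ln_mono) auto
    qed
    finally have "real ?q * L / real (A * B * C) \<le> density (A, B, C)"
      unfolding density_def by (simp add: divide_right_mono)
    then show "g (A, B, C) \<le> density (A, B, C)" by (simp add: g_def mult_ac)
  qed
  ultimately show ?thesis by eventually_elim simp
qed

text \<open>Doubling all sides makes every side even, which reduces boxes of even volume to boxes with even
  sides, to which the tiling argument applies.\<close>

lemma density_double:
  assumes "even (a * b * c)" "0 < a" "0 < b" "0 < c"
  shows "density (a, b, c) \<le> density (2 * a, 2 * b, 2 * c)"
proof -
  have n: "1 \<le> num_matchings a b c" using assms by (intro num_matchings_even)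
  have "num_matchings a b c ^ (2 * 2 * 2) \<le> num_matchings (2 * a) (2 * b) (2 * c)"
    by (rule num_matchings_mult)
  then have "real (num_matchings a b c) ^ 8 \<le> real (num_matchings (2 * a) (2 * b) (2 * c))"
    by (metis of_nat_le_iff of_nat_power eval_nat_numeral(2) mult_numeral_1_right numeral_Bit0 numeral_times_numeral semiring_norm(11) semiring_norm(13))
  then have "ln (real (num_matchings a b c) ^ 8) \<le> ln (real (num_matchings (2 * a) (2 * b) (2 * c)))"
    using n by (intro ln_mono) auto
  then have "8 * ln (real (num_matchings a b c)) \<le> ln (real (num_matchings (2 * a) (2 * b) (2 * c)))"
    using n by (simp add: ln_realpow)
  then show ?thesis using assms by (simp add: density_def field_simps)
qed

text \<open>The limit exists and is the supremum of the densities over boxes with even sides: a single such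
  box bounds the limit inferior from below by tiling, and every box of even volume is bounded from
  above by its double.  The bound \<open>u\<close> also makes this supremum finite.\<close>

lemma dimer_constant_le:
  assumes u: "\<And>a b c. even a \<Longrightarrow> even b \<Longrightarrow> even c \<Longrightarrow> 0 < a \<Longrightarrow> 0 < b \<Longrightarrow> 0 < c \<Longrightarrow> density (a, b, c) \<le> u"
  shows "dimer_constant \<le> u"
proof -
  define D where "D = density ` {(a, b, c). even a \<and> even b \<and> even c \<and> 0 < a \<and> 0 < b \<and> 0 < c}"
  define l where "l = Sup D"
  have ne: "D \<noteq> {}" unfolding D_def by (auto intro!: exI[of _ 2])
  have Du: "x \<le> u" if "x \<in> D" for x using that u by (auto simp: D_def)
  have bdd: "bdd_above D" using Du by (rule bdd_aboveI)
  have "(density \<longlongrightarrow> l) even_boxes"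
  proof (rule order_tendstoI)
    fix x assume "x < l"
    then obtain y where "y \<in> D" "x < y" unfolding l_def using less_cSup_iff[OF ne bdd] by blast
    then show "\<forall>\<^sub>F v in even_boxes. x < density v"
      unfolding D_def using density_liminf by blast
  next
    fix x assume x: "l < x"
    have "density (a, b, c) \<le> l" if "even (a * b * c)" "0 < a" "0 < b" "0 < c" for a b c
    proof -
      have "density (2 * a, 2 * b, 2 * c) \<in> D" unfolding D_def using that(2-4) by (intro imageI) simp
      then have "density (2 * a, 2 * b, 2 * c) \<le> l" unfolding l_def using bdd by (rule cSup_upper)
      then show ?thesis using density_double[OF that] by simp
    qed
    then have *: "density (a, b, c) < x" if "even (a * b * c)" "0 < a" "0 < b" "0 < c" for a b c
      using x that by (meson le_less_trans)
    have "\<forall>\<^sub>F v in (at_top \<times>\<^sub>F at_top \<times>\<^sub>F at_top :: (nat \<times> nat \<times> nat) filter). 0 < fst v \<and> 0 < fst (snd v) \<and> 0 < snd (snd v)"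
      by (intro eventually_conj coordinates_at_top[THEN eventually_compose_filterlim[OF eventually_gt_at_top]])
    then show "\<forall>\<^sub>F v in even_boxes. density v < x"
      unfolding even_boxes_def eventually_inf_principal
      by eventually_elim (auto intro: *)
  qed
  then have "dimer_constant = l" unfolding dimer_constant_eq by (rule tendsto_Lim[OF even_boxes_nontrivial])
  then show ?thesis unfolding l_def using cSup_least[OF ne Du] by simp
qed

section \<open>The twisted torus\<close>

text \<open>A spanning embedding of bipartite graphs transports matchings injectively.  It is used for the box
  inside the torus, for exchanging coordinates, and in both directions for symmetries of a layer.\<close>

lemma card_bip_matchings_mono:
  assumes fin: "finite A'" "finite B'" and f: "bij_betw f A A'" and g: "bij_betw g B B'"
    and R: "\<And>a b. a \<in> A \<Longrightarrow> b \<in> B \<Longrightarrow> R a b \<Longrightarrow> R' (f a) (g b)"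
  shows "card (bip_matchings A B R) \<le> card (bip_matchings A' B' R')"
proof (rule card_inj_on_le[of "\<lambda>\<sigma>. \<lambda>x\<in>A'. g (\<sigma> (inv_into A f x))"])
  let ?h = "inv_into A f"
  have h: "bij_betw ?h A' A" using f by (rule bij_betw_inv_into)
  have hA: "?h x \<in> A" "f (?h x) = x" if "x \<in> A'" for x
    using bij_betw_apply[OF h that] bij_betw_inv_into_right[OF f that] by auto
  show "finite (bip_matchings A' B' R')" using fin by (rule finite_bip_matchings)
  show "(\<lambda>\<sigma>. \<lambda>x\<in>A'. g (\<sigma> (?h x))) ` bip_matchings A B R \<subseteq> bip_matchings A' B' R'"
  proof clarify
    fix \<sigma> assume s: "\<sigma> \<in> bip_matchings A B R"
    then have bij: "bij_betw \<sigma> A B" and sR: "\<And>a. a \<in> A \<Longrightarrow> R a (\<sigma> a)" by (auto simp: bip_matchings_def)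
    have "bij_betw (g \<circ> (\<sigma> \<circ> ?h)) A' B'" by (intro bij_betw_trans[OF bij_betw_trans[OF h bij] g])
    then have "bij_betw (\<lambda>x\<in>A'. g (\<sigma> (?h x))) A' B'" by (simp add: o_def cong: bij_betw_cong)
    moreover have "R' x (g (\<sigma> (?h x)))" if "x \<in> A'" for x
      using R[OF hA(1)[OF that] bij_betw_apply[OF bij hA(1)[OF that]] sR[OF hA(1)[OF that]]] hA(2)[OF that] by simp
    ultimately show "(\<lambda>x\<in>A'. g (\<sigma> (?h x))) \<in> bip_matchings A' B' R'"
      unfolding bip_matchings_def using bij_betw_apply by (fastforce simp: PiE_def)
  qed
  show "inj_on (\<lambda>\<sigma>. \<lambda>x\<in>A'. g (\<sigma> (?h x))) (bip_matchings A B R)"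
  proof
    fix \<sigma> \<sigma>' assume s: "\<sigma> \<in> bip_matchings A B R" "\<sigma>' \<in> bip_matchings A B R"
      and eq: "(\<lambda>x\<in>A'. g (\<sigma> (?h x))) = (\<lambda>x\<in>A'. g (\<sigma>' (?h x)))"
    have B: "\<sigma> a \<in> B" "\<sigma>' a \<in> B" if "a \<in> A" for a using s that by (auto simp: bip_matchings_def)
    show "\<sigma> = \<sigma>'"
    proof (rule extensionalityI)
      show "\<sigma> \<in> extensional A" "\<sigma>' \<in> extensional A" using s by (auto simp: bip_matchings_def PiE_def)
      fix a assume a: "a \<in> A"
      have fa: "f a \<in> A'" "?h (f a) = a" using f a by (auto simp: bij_betw_apply bij_betw_inv_into_left)
      have "g (\<sigma> a) = g (\<sigma>' a)" using fun_cong[OF eq, of "f a"] fa by simp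
      then show "\<sigma> a = \<sigma>' a" using g B[OF a] by (auto simp: bij_betw_def inj_on_def)
    qed
  qed
qed

definition layer :: "nat \<Rightarrow> nat \<Rightarrow> (int \<times> int) set" where
  "layer m n = {0..<int m} \<times> {0..<int n}"

definition step :: "nat \<Rightarrow> nat \<Rightarrow> int \<times> int \<Rightarrow> int \<times> int \<Rightarrow> bool" where
  "step m n u v \<longleftrightarrow> (\<exists>d\<in>D_steps. v = ((fst u + fst d) mod int m, (snd u + snd d) mod int n))"

text \<open>Vertices are \<open>(t, y, z)\<close>, layer index first.  The edges run between layers \<open>t\<close> and \<open>t + 1\<close> modulo \<open>k\<close>
  along the steps, so this is the quotient of the cubic lattice, with \<open>t = x + y + z\<close>, by the lattice
  spanned by \<open>(-m, m, 0)\<close>, \<open>(-n, 0, n)\<close> and \<open>(k, 0, 0)\<close>.  For even \<open>k\<close> it is bipartite by the parity of \<open>t\<close>.\<close>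

definition torus :: "nat \<Rightarrow> nat \<Rightarrow> nat \<Rightarrow> (int \<times> int \<times> int) set" where
  "torus m n k = {0..<int k} \<times> layer m n"

definition torus_up :: "nat \<Rightarrow> nat \<Rightarrow> nat \<Rightarrow> int \<times> int \<times> int \<Rightarrow> int \<times> int \<times> int \<Rightarrow> bool" where
  "torus_up m n k x y \<longleftrightarrow> fst y = (fst x + 1) mod int k \<and> step m n (snd x) (snd y)"

definition torus_adj :: "nat \<Rightarrow> nat \<Rightarrow> nat \<Rightarrow> int \<times> int \<times> int \<Rightarrow> int \<times> int \<times> int \<Rightarrow> bool" where
  "torus_adj m n k x y \<longleftrightarrow> torus_up m n k x y \<or> torus_up m n k y x"

definition torus_part :: "nat \<Rightarrow> nat \<Rightarrow> nat \<Rightarrow> bool \<Rightarrow> (int \<times> int \<times> int) set" where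
  "torus_part m n k e = {x \<in> torus m n k. even (fst x) = e}"

definition torus_matchings :: "nat \<Rightarrow> nat \<Rightarrow> nat \<Rightarrow> (int \<times> int \<times> int \<Rightarrow> int \<times> int \<times> int) set" where
  "torus_matchings m n k = bip_matchings (torus_part m n k True) (torus_part m n k False) (torus_adj m n k)"

lemma finite_torus_part: "finite (torus_part m n k e)"
  by (simp add: torus_part_def torus_def layer_def)

lemma torus_partD:
  "(t, y, z) \<in> torus_part m n k e \<longleftrightarrow>
    0 \<le> t \<and> t < int k \<and> 0 \<le> y \<and> y < int m \<and> 0 \<le> z \<and> z < int n \<and> even t = e"
  by (auto simp: torus_part_def torus_def layer_def)

lemma half_turn:
  fixes y M :: int assumes "0 \<le> y" "y < 2 * M"
  shows "(y + M) mod (2 * M) = (if y < M then y + M else y - M)"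
    and "y mod M = (if y < M then y else y - M)"
proof -
  show "(y + M) mod (2 * M) = (if y < M then y + M else y - M)"
  proof (cases "y < M")
    case True then show ?thesis using assms by simp
  next
    case False
    have "(y + M) mod (2 * M) = (y - M + 2 * M) mod (2 * M)" by (simp add: algebra_simps)
    also have "\<dots> = (y - M) mod (2 * M)" by (rule mod_add_self2)
    also have "\<dots> = y - M" using assms False by simp
    finally show ?thesis using False by simp
  qed
  show "y mod M = (if y < M then y else y - M)"
  proof (cases "y < M")
    case True then show ?thesis using assms by simp
  next
    case False
    have "y mod M = (y - M + M) mod M" by simp
    also have "\<dots> = (y - M) mod M" by (rule mod_add_self2)
    also have "\<dots> = y - M" using assms False by (intro mod_pos_pos_trivial) auto
    finally show ?thesis using False by simp
  qed
qed

text \<open>With at least three layers an edge has a well-defined upward direction.\<close>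

lemma no_two_cycle:
  fixes x y k :: int
  assumes "3 \<le> k" "0 \<le> x" "x < k" "y = (x + 1) mod k" "x = (y + 1) mod k"
  shows False
proof -
  have "((x + 1) mod k + 1) mod k = (x + 2) mod k" by (simp add: mod_add_left_eq add.assoc)
  moreover have "((x + 1) mod k + 1) mod k = x" using assms(4,5) by (simp only:)
  moreover have "x mod k = x" using assms(2,3) by (rule mod_pos_pos_trivial)
  ultimately have "(x + 2) mod k = x mod k" by (simp only:)
  then have "k dvd (x + 2) - x" by (simp add: mod_eq_dvd_iff)
  then show False using assms(1) zdvd_imp_le[of k 2] by simp
qed

lemma step_fst:
  "step m n u v \<Longrightarrow> \<exists>d. (d = 0 \<or> d = 1) \<and> fst v = (fst u + d) mod int m"
  unfolding step_def D_steps_def by force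

text \<open>Two steps differ by at most one in the first coordinate, so they cannot differ by \<open>M \<ge> 2\<close> modulo
  \<open>2 * M\<close>: the cover has no two edges from one vertex to both lifts of another.\<close>

lemma step_half_turn_unique:
  assumes M: "2 \<le> M" and s: "step (2 * M) n u v" "step (2 * M) n u v'" "fst v' = (fst v + int M) mod int (2 * M)"
  shows False
proof -
  obtain d d' where d: "d = 0 \<or> d = 1" "d' = 0 \<or> d' = 1"
    "fst v = (fst u + d) mod int (2 * M)" "fst v' = (fst u + d') mod int (2 * M)"
    using step_fst[OF s(1)] step_fst[OF s(2)] by blast
  then have "(fst u + d + int M) mod int (2 * M) = (fst u + d') mod int (2 * M)"
    using s(3) by (simp add: mod_add_left_eq)
  then have dv: "int (2 * M) dvd int M + (d - d')" by (simp add: mod_eq_dvd_iff algebra_simps)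
  have "0 < int M + (d - d')" using d M by auto
  from zdvd_imp_le[OF dv this] show False using d M by auto
qed

lemma step_half_turn:
  assumes "step (2 * M) n u v"
  shows "step (2 * M) n ((fst u + int M) mod int (2 * M), snd u) ((fst v + int M) mod int (2 * M), snd v)"
proof -
  obtain d where d: "d \<in> D_steps" "v = ((fst u + fst d) mod int (2 * M), (snd u + snd d) mod int n)"
    using assms by (auto simp: step_def)
  have "((fst u + fst d) mod int (2 * M) + int M) mod int (2 * M)
      = ((fst u + int M) mod int (2 * M) + fst d) mod int (2 * M)"
    unfolding mod_add_left_eq by (simp only: add_ac)
  then show ?thesis unfolding step_def using d by (intro bexI[of _ d]) simp_all
qed

lemma step_project:
  assumes "step (2 * M) n u v"
  shows "step M n (fst u mod int M, snd u) (fst v mod int M, snd v)"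
proof -
  obtain d where d: "d \<in> D_steps" "v = ((fst u + fst d) mod int (2 * M), (snd u + snd d) mod int n)"
    using assms by (auto simp: step_def)
  have "(fst u + fst d) mod int (2 * M) mod int M = (fst u mod int M + fst d) mod int M"
    by (simp add: mod_mod_cancel mod_add_left_eq)
  then show ?thesis unfolding step_def using d by (intro bexI[of _ d]) simp_all
qed

text \<open>Reduction of \<open>y\<close> modulo \<open>M\<close> is a double cover whose deck involution is the half turn in \<open>y\<close>.\<close>

lemma card_torus_matchings_double:
  assumes M: "2 \<le> M" and k: "3 \<le> k"
  shows "card (torus_matchings (2 * M) n k) \<le> (card (torus_matchings M n k))\<^sup>2"
proof -
  define \<tau> :: "int \<times> int \<times> int \<Rightarrow> int \<times> int \<times> int"
    where "\<tau> = (\<lambda>(t, y, z). (t, (y + int M) mod int (2 * M), z))"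
  define p :: "int \<times> int \<times> int \<Rightarrow> int \<times> int \<times> int"
    where "p = (\<lambda>(t, y, z). (t, y mod int M, z))"
  have two: "int (2 * M) = 2 * int M" by simp
  have \<tau>: "\<tau> x \<in> torus_part (2 * M) n k e \<and> \<tau> x \<noteq> x \<and> \<tau> (\<tau> x) = x"
    if "x \<in> torus_part (2 * M) n k e" for x e
  proof -
    obtain t y z where x: "x = (t, y, z)" by (metis prod_cases3)
    show ?thesis using that M unfolding x \<tau>_def two by (auto simp: torus_partD half_turn)
  qed
  have p1: "p ` torus_part (2 * M) n k e = torus_part M n k e" for e
  proof
    show "p ` torus_part (2 * M) n k e \<subseteq> torus_part M n k e"
      using M by (auto simp: p_def torus_partD)
    show "torus_part M n k e \<subseteq> p ` torus_part (2 * M) n k e"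
    proof
      fix x assume x: "x \<in> torus_part M n k e"
      obtain t y z where xyz: "x = (t, y, z)" by (metis prod_cases3)
      then have "p x = x" "x \<in> torus_part (2 * M) n k e" using x M by (auto simp: p_def torus_partD)
      then show "x \<in> p ` torus_part (2 * M) n k e" by (metis imageI)
    qed
  qed
  have p2: "p x = p y \<longleftrightarrow> y = x \<or> y = \<tau> x"
    if "x \<in> torus_part (2 * M) n k e" "y \<in> torus_part (2 * M) n k e" for x y e
  proof -
    obtain t a z where x: "x = (t, a, z)" by (metis prod_cases3)
    obtain t' b z' where y: "y = (t', b, z')" by (metis prod_cases3)
    show ?thesis using that M unfolding x y \<tau>_def p_def two by (auto simp: torus_partD half_turn)
  qed
  have snd\<tau>: "snd (\<tau> x) = ((fst (snd x) + int M) mod int (2 * M), snd (snd x))" "fst (\<tau> x) = fst x" for x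
    by (simp_all add: \<tau>_def case_prod_beta)
  have sndp: "snd (p x) = (fst (snd x) mod int M, snd (snd x))" "fst (p x) = fst x" for x
    by (simp_all add: p_def case_prod_beta)
  have up\<tau>: "torus_up (2 * M) n k (\<tau> a) (\<tau> b)" if "torus_up (2 * M) n k a b" for a b
    using that step_half_turn[of M n "snd a" "snd b"] by (simp add: torus_up_def snd\<tau>)
  have upp: "torus_up M n k (p a) (p b)" if "torus_up (2 * M) n k a b" for a b
    using that step_project[of M n "snd a" "snd b"] by (simp add: torus_up_def sndp)
  have upu: "\<not> torus_up (2 * M) n k a (\<tau> b)" if "torus_up (2 * M) n k a b" for a b
    using that step_half_turn_unique[OF M, of n "snd a" "snd b" "snd (\<tau> b)"] by (auto simp: torus_up_def snd\<tau>)
  show ?thesis unfolding torus_matchings_def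
  proof (rule bip_matchings_double_cover[of _ _ \<tau> p])
    show "\<tau> x \<in> torus_part (2 * M) n k True \<and> \<tau> x \<noteq> x \<and> \<tau> (\<tau> x) = x" if "x \<in> torus_part (2 * M) n k True" for x
      by (rule \<tau>[OF that])
    show "\<tau> x \<in> torus_part (2 * M) n k False \<and> \<tau> x \<noteq> x \<and> \<tau> (\<tau> x) = x" if "x \<in> torus_part (2 * M) n k False" for x
      by (rule \<tau>[OF that])
    show "(p x = p y) = (y = x \<or> y = \<tau> x)" if "x \<in> torus_part (2 * M) n k True" "y \<in> torus_part (2 * M) n k True" for x y
      by (rule p2[OF that])
    show "(p x = p y) = (y = x \<or> y = \<tau> x)" if "x \<in> torus_part (2 * M) n k False" "y \<in> torus_part (2 * M) n k False" for x y
      by (rule p2[OF that])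
    fix a b assume a: "a \<in> torus_part (2 * M) n k True" and b: "b \<in> torus_part (2 * M) n k False"
      and ab: "torus_adj (2 * M) n k a b"
    show "torus_adj M n k (p a) (p b)" using ab upp unfolding torus_adj_def by blast
    show "torus_adj (2 * M) n k (\<tau> a) (\<tau> b)" using ab up\<tau> unfolding torus_adj_def by blast
    have ra: "0 \<le> fst a" "fst a < int k" using a by (auto simp: torus_part_def torus_def)
    show "\<not> torus_adj (2 * M) n k a (\<tau> b)"
    proof
      assume "torus_adj (2 * M) n k a (\<tau> b)"
      then consider "torus_up (2 * M) n k a b" "torus_up (2 * M) n k a (\<tau> b)"
        | "torus_up (2 * M) n k b a" "torus_up (2 * M) n k (\<tau> b) a"
        | "torus_up (2 * M) n k a b" "torus_up (2 * M) n k (\<tau> b) a"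
        | "torus_up (2 * M) n k b a" "torus_up (2 * M) n k a (\<tau> b)"
        using ab unfolding torus_adj_def by blast
      then show False
      proof cases
        case 1 then show False using upu by blast
      next
        case 2
        have "torus_up (2 * M) n k b (\<tau> a)" using up\<tau>[OF 2(2)] \<tau>[OF b] by simp
        then show False using upu[OF 2(1)] by blast
      next
        case 3
        have cyc: "fst b = (fst a + 1) mod int k" "fst a = (fst b + 1) mod int k"
          using 3 unfolding torus_up_def snd\<tau> by blast+
        show False by (rule no_two_cycle[OF _ ra cyc]) (use k in simp)
      next
        case 4
        have cyc: "fst b = (fst a + 1) mod int k" "fst a = (fst b + 1) mod int k"
          using 4 unfolding torus_up_def snd\<tau> by blast+
        show False by (rule no_two_cycle[OF _ ra cyc]) (use k in simp)
      qed
    qed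
  qed (use p1 finite_torus_part in auto)
qed

lemma card_torus_matchings_swap: "card (torus_matchings m n k) \<le> card (torus_matchings n m k)"
proof -
  let ?s = "\<lambda>(t, y, z). (t, z, y) :: int \<times> int \<times> int"
  have bij: "bij_betw ?s (torus_part m n k e) (torus_part n m k e)" for e
    by (rule bij_betw_byWitness[of _ ?s]) (auto simp: torus_partD)
  have "step n m (z, y) (z', y')" if "step m n (y, z) (y', z')" for y z y' z'
    using that by (auto simp: step_def D_steps_def)
  then show ?thesis unfolding torus_matchings_def
    by (intro card_bip_matchings_mono[OF _ _ bij bij] finite_torus_part)
      (auto simp: torus_adj_def torus_up_def case_prod_beta)
qed

lemma card_torus_matchings_double2:
  assumes "2 \<le> N" "3 \<le> k"
  shows "card (torus_matchings m (2 * N) k) \<le> (card (torus_matchings m N k))\<^sup>2"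
proof -
  have "card (torus_matchings m (2 * N) k) \<le> card (torus_matchings (2 * N) m k)"
    by (rule card_torus_matchings_swap)
  also have "\<dots> \<le> (card (torus_matchings N m k))\<^sup>2" by (rule card_torus_matchings_double[OF assms])
  also have "\<dots> \<le> (card (torus_matchings m N k))\<^sup>2" by (intro power_mono card_torus_matchings_swap) simp
  finally show ?thesis .
qed

lemma card_torus_matchings_double_iterate:
  assumes "2 \<le> m" "2 \<le> n" "3 \<le> k"
  shows "card (torus_matchings (2 ^ j * m) (2 ^ j * n) k) \<le> card (torus_matchings m n k) ^ (4 ^ j)"
proof (induction j)
  case (Suc j)
  have ge: "2 \<le> 2 ^ j * l" if "2 \<le> l" for l :: nat
    using that mult_le_mono[of 1 "2 ^ j" 2 l] by simp
  have ge': "2 \<le> 2 ^ Suc j * l" if "2 \<le> l" for l :: nat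
    using that mult_le_mono[of 1 "2 ^ Suc j" 2 l] by simp
  have "card (torus_matchings (2 ^ Suc j * m) (2 ^ Suc j * n) k) \<le> (card (torus_matchings (2 ^ j * m) (2 ^ Suc j * n) k))\<^sup>2"
    using card_torus_matchings_double[OF ge[OF assms(1)] assms(3), of "2 ^ Suc j * n"] by (simp add: mult.assoc)
  also have "\<dots> \<le> ((card (torus_matchings (2 ^ j * m) (2 ^ j * n) k))\<^sup>2)\<^sup>2"
    using card_torus_matchings_double2[OF ge[OF assms(2)] assms(3), of "2 ^ j * m"]
    by (intro power_mono) (simp_all add: mult.assoc)
  also have "\<dots> \<le> ((card (torus_matchings m n k) ^ (4 ^ j))\<^sup>2)\<^sup>2"
    by (intro power_mono Suc.IH) auto
  also have "\<dots> = card (torus_matchings m n k) ^ (4 ^ Suc j)"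
    by (simp add: power_mult[symmetric] mult_ac)
  finally show ?case .
qed simp

definition box_part :: "nat \<Rightarrow> nat \<Rightarrow> nat \<Rightarrow> bool \<Rightarrow> (int \<times> int \<times> int) set" where
  "box_part a b c e = {v \<in> lattice_box a b c. even (fst v + fst (snd v) + snd (snd v)) = e}"

lemma box_partD:
  "(x, y, z) \<in> box_part a b c e \<longleftrightarrow>
    0 \<le> x \<and> x < int a \<and> 0 \<le> y \<and> y < int b \<and> 0 \<le> z \<and> z < int c \<and> even (x + y + z) = e"
  by (auto simp: box_part_def lattice_box_def)

lemma cubic_adj_parity:
  assumes "cubic_adj v w"
  shows "even (fst v + fst (snd v) + snd (snd v)) \<longleftrightarrow> odd (fst w + fst (snd w) + snd (snd w))"
proof -
  obtain x y z x' y' z' where v: "v = (x, y, z)" and w: "w = (x', y', z')" by (metis prod_cases3)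
  have "odd ((x - x')\<^sup>2 + (y - y')\<^sup>2 + (z - z')\<^sup>2)" using assms unfolding v w cubic_adj_iff by simp
  then show ?thesis unfolding v w by (simp; blast)
qed

lemma cubic_adj_cases:
  assumes "cubic_adj (x, y, z) (x', y', z')"
  shows "(x' = x + 1 \<or> x = x' + 1) \<and> y' = y \<and> z' = z \<or> x' = x \<and> (y' = y + 1 \<or> y = y' + 1) \<and> z' = z
    \<or> x' = x \<and> y' = y \<and> (z' = z + 1 \<or> z = z' + 1)"
proof -
  have s: "(x - x')\<^sup>2 + (y - y')\<^sup>2 + (z - z')\<^sup>2 = 1" using assms by (simp add: cubic_adj_iff)
  have small: "d = 0 \<or> d\<^sup>2 \<ge> 1" for d :: int by (cases "d = 0") (auto simp: int_one_le_iff_zero_less)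
  have one: "d = 1 \<or> d = - 1" if "d\<^sup>2 = 1" for d :: int using that by (simp add: power2_eq_1_iff)
  have nn: "0 \<le> (x - x')\<^sup>2" "0 \<le> (y - y')\<^sup>2" "0 \<le> (z - z')\<^sup>2" by simp_all
  consider "x - x' \<noteq> 0" | "x - x' = 0" "y - y' \<noteq> 0" | "x - x' = 0" "y - y' = 0" by blast
  then show ?thesis
  proof cases
    case 1
    then have "(x - x')\<^sup>2 \<ge> 1" using small[of "x - x'"] by blast
    then have "(x - x')\<^sup>2 = 1" "(y - y')\<^sup>2 = 0" "(z - z')\<^sup>2 = 0" using s nn by linarith+
    then show ?thesis using one[of "x - x'"] by auto
  next
    case 2
    then have "(y - y')\<^sup>2 \<ge> 1" using small[of "y - y'"] by blast
    moreover have "(y - y')\<^sup>2 + (z - z')\<^sup>2 = 1" using s 2(1) by simp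
    ultimately have "(y - y')\<^sup>2 = 1" "(z - z')\<^sup>2 = 0" using nn by linarith+
    then show ?thesis using one[of "y - y'"] 2 by auto
  next
    case 3
    then have "(z - z')\<^sup>2 = 1" using s by simp
    then show ?thesis using one[of "z - z'"] 3 by auto
  qed
qed

lemma cubic_adj_sym: "cubic_adj v w \<longleftrightarrow> cubic_adj w v"
proof -
  obtain x y z x' y' z' where v: "v = (x, y, z)" and w: "w = (x', y', z')" by (metis prod_cases3)
  show ?thesis unfolding v w cubic_adj_iff by (simp add: power2_commute)
qed

text \<open>An edge of the cubic lattice changes the parity of \<open>x + y + z\<close>, so a perfect matching is determined
  by the partners of the even vertices.\<close>

lemma num_matchings_le_bip:
  "num_matchings a b c \<le> card (bip_matchings (box_part a b c True) (box_part a b c False) cubic_adj)"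
proof -
  let ?S = "lattice_box a b c" and ?E = "box_part a b c True" and ?O = "box_part a b c False"
  let ?P = "{M. perfect_matching ?S (induced_edges ?S) M}"
  have S: "v \<in> ?S \<longleftrightarrow> v \<in> ?E \<or> v \<in> ?O" for v by (auto simp: box_part_def)
  have EO: "v \<in> ?E \<Longrightarrow> v \<notin> ?O" for v by (auto simp: box_part_def)
  define partner where "partner M v = (THE w. {v, w} \<in> M)" for M :: "(int \<times> int \<times> int) set set" and v
  have edge: "\<exists>x y. e = {x, y} \<and> x \<in> ?E \<and> y \<in> ?O \<and> cubic_adj x y" if M: "M \<in> ?P" and e: "e \<in> M" for M e
  proof -
    have "e \<in> induced_edges ?S" using M e by (auto simp: perfect_matching_def)
    then obtain x y where xy: "e = {x, y}" "x \<in> ?S" "y \<in> ?S" "cubic_adj x y"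
      unfolding induced_edges_def by blast
    note par = cubic_adj_parity[OF xy(4)]
    show ?thesis
    proof (cases "x \<in> ?E")
      case True
      then have "y \<in> ?O" using par xy by (auto simp: box_part_def)
      then show ?thesis using True xy by blast
    next
      case False
      then have "x \<in> ?O" "y \<in> ?E" using par xy by (auto simp: box_part_def)
      moreover have "e = {y, x}" "cubic_adj y x" using xy cubic_adj_sym[of x y] by auto
      ultimately show ?thesis by blast
    qed
  qed
  have uniq: "e = e'" if "M \<in> ?P" "v \<in> ?S" "e \<in> M" "e' \<in> M" "v \<in> e" "v \<in> e'" for M v e e'
    using that unfolding perfect_matching_def mem_Collect_eq by metis
  have cover: "\<exists>e\<in>M. v \<in> e" if "M \<in> ?P" "v \<in> ?S" for M v
    using that unfolding perfect_matching_def mem_Collect_eq by metis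
  have partner_eq: "partner M v = w" if M: "M \<in> ?P" and v: "v \<in> ?S" and vw: "{v, w} \<in> M" for M v w
    unfolding partner_def
  proof (rule the_equality[of _ w])
    show "{v, w} \<in> M" by fact
    fix w' assume "{v, w'} \<in> M"
    then have "{v, w'} = {v, w}" using uniq[OF M v _ vw] by blast
    then show "w' = w" by (auto simp: doubleton_eq_iff)
  qed
  have partner: "{v, partner M v} \<in> M \<and> partner M v \<in> ?O \<and> cubic_adj v (partner M v)"
    if M: "M \<in> ?P" and v: "v \<in> ?E" for M v
  proof -
    have vS: "v \<in> ?S" using v S by blast
    obtain e where e: "e \<in> M" "v \<in> e" using cover[OF M vS] by blast
    obtain x y where xy: "e = {x, y}" "x \<in> ?E" "y \<in> ?O" "cubic_adj x y" using edge[OF M e(1)] by blast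
    have "v = x" using xy e EO v by blast
    then show ?thesis using partner_eq[OF M vS, of y] e xy by simp
  qed
  show ?thesis unfolding num_matchings_def
  proof (rule card_inj_on_le[of "\<lambda>M. restrict (partner M) ?E"])
    show "finite (bip_matchings ?E ?O cubic_adj)"
      by (rule finite_bip_matchings; rule finite_subset[OF _ finite_lattice_box[of a b c]]) (auto simp: box_part_def)
    show "(\<lambda>M. restrict (partner M) ?E) ` ?P \<subseteq> bip_matchings ?E ?O cubic_adj"
    proof
      fix f assume "f \<in> (\<lambda>M. restrict (partner M) ?E) ` ?P"
      then obtain M where M: "M \<in> ?P" and f: "f = restrict (partner M) ?E" by blast
      have fv: "f v = partner M v" if "v \<in> ?E" for v using that f by simp
      have "inj_on f ?E"
      proof
        fix v w assume v: "v \<in> ?E" and w: "w \<in> ?E" and eq: "f v = f w"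
        note pv = partner[OF M v] and pw = partner[OF M w]
        have "partner M v = partner M w" using eq fv v w by simp
        then have "{v, partner M v} = {w, partner M v}"
          using uniq[OF M, of "partner M v" "{v, partner M v}" "{w, partner M w}"] pv pw S by simp
        then show "v = w" by (auto simp: doubleton_eq_iff)
      qed
      moreover have "f ` ?E = ?O"
      proof
        show "f ` ?E \<subseteq> ?O" using partner[OF M] fv by auto
        show "?O \<subseteq> f ` ?E"
        proof
          fix w assume w: "w \<in> ?O"
          then have "w \<in> ?S" using S by blast
          then obtain e where e: "e \<in> M" "w \<in> e" using cover[OF M] by blast
          obtain x y where xy: "e = {x, y}" "x \<in> ?E" "y \<in> ?O" "cubic_adj x y" using edge[OF M e(1)] by blast
          have "w = y" using xy e EO w by blast
          moreover have "partner M x = y" using partner_eq[OF M, of x y] xy e S by blast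
          ultimately show "w \<in> f ` ?E" using xy(2) fv by (metis imageI)
        qed
      qed
      ultimately show "f \<in> bip_matchings ?E ?O cubic_adj"
        using partner[OF M] fv by (auto simp: bip_matchings_def bij_betw_def f PiE_def)
    qed
    show "inj_on (\<lambda>M. restrict (partner M) ?E) ?P"
    proof
      fix M N assume M: "M \<in> ?P" and N: "N \<in> ?P" and eq: "restrict (partner M) ?E = restrict (partner N) ?E"
      have *: "M = (\<lambda>v. {v, partner M v}) ` ?E" if M: "M \<in> ?P" for M
      proof
        show "(\<lambda>v. {v, partner M v}) ` ?E \<subseteq> M" using partner[OF M] by blast
        show "M \<subseteq> (\<lambda>v. {v, partner M v}) ` ?E"
        proof
          fix e assume e: "e \<in> M"
          obtain x y where xy: "e = {x, y}" "x \<in> ?E" "y \<in> ?O" "cubic_adj x y" using edge[OF M e] by blast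
          then have "partner M x = y" using partner_eq[OF M, of x y] e S by blast
          then show "e \<in> (\<lambda>v. {v, partner M v}) ` ?E" using xy by blast
        qed
      qed
      have "partner M v = partner N v" if "v \<in> ?E" for v
        using fun_cong[OF eq, of v] that by simp
      then have "(\<lambda>v. {v, partner M v}) ` ?E = (\<lambda>v. {v, partner N v}) ` ?E"
        by (intro image_cong) auto
      then show "M = N" using *[OF M] *[OF N] by simp
    qed
  qed
qed

text \<open>The shear \<open>(x, y, z) \<mapsto> (x + y + z, y, z)\<close> maps the box bijectively to the torus, with inverse
  \<open>x = t - y - z\<close> modulo \<open>k\<close>, and turns the three unit vectors into the three steps.\<close>

lemma num_matchings_le_torus:
  assumes k: "even k"
  shows "num_matchings k m n \<le> card (torus_matchings m n k)"
proof -
  define f :: "int \<times> int \<times> int \<Rightarrow> int \<times> int \<times> int"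
    where "f = (\<lambda>(x, y, z). ((x + y + z) mod int k, y, z))"
  define g :: "int \<times> int \<times> int \<Rightarrow> int \<times> int \<times> int"
    where "g = (\<lambda>(t, y, z). ((t - y - z) mod int k, y, z))"
  have par: "even (t mod int k) \<longleftrightarrow> even t" for t :: int
    using k by (simp add: dvd_mod_iff)
  have bij: "bij_betw f (box_part k m n e) (torus_part m n k e)" for e
  proof (rule bij_betw_byWitness[of _ g])
    have r: "0 \<le> t mod int k \<and> t mod int k < int k" if "0 < k" for t using that by simp
    show "\<forall>a\<in>box_part k m n e. g (f a) = a"
    proof
      fix a assume a: "a \<in> box_part k m n e"
      obtain x y z where xyz: "a = (x, y, z)" by (metis prod_cases3)
      have "((x + y + z) mod int k - y - z) mod int k = (x + y + z - y - z) mod int k"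
        by (simp only: diff_diff_eq mod_diff_left_eq)
      also have "\<dots> = x" using a xyz by (simp add: box_partD)
      finally show "g (f a) = a" by (simp add: f_def g_def xyz)
    qed
    show "\<forall>a\<in>torus_part m n k e. f (g a) = a"
    proof
      fix a assume a: "a \<in> torus_part m n k e"
      obtain t y z where xyz: "a = (t, y, z)" by (metis prod_cases3)
      have "((t - y - z) mod int k + y + z) mod int k = (t - y - z + y + z) mod int k"
        by (simp only: add.assoc mod_add_left_eq)
      also have "\<dots> = t" using a xyz by (simp add: torus_partD)
      finally show "f (g a) = a" by (simp add: f_def g_def xyz)
    qed
    show "f ` box_part k m n e \<subseteq> torus_part m n k e"
      using par r by (auto simp: f_def box_partD torus_partD)
    show "g ` torus_part m n k e \<subseteq> box_part k m n e"
      using par r by (auto simp: g_def box_partD torus_partD)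
  qed
  have up: "torus_up m n k (f v) (f w)"
    if v: "v \<in> lattice_box k m n" "w \<in> lattice_box k m n" and d: "d \<in> {(1, 0, 0), (0, 1, 0), (0, 0, 1)}"
      and w: "w = (fst v + fst d, fst (snd v) + fst (snd d), snd (snd v) + snd (snd d))" for v w d
  proof -
    obtain x y z where xyz: "v = (x, y, z)" by (metis prod_cases3)
    have st: "step m n (y, z) (y + fst (snd d), z + snd (snd d))"
      unfolding step_def using that(2) d xyz w
      by (intro bexI[of _ "snd d"]) (auto simp: lattice_box_def D_steps_def)
    have "(x + fst d + (y + fst (snd d)) + (z + snd (snd d))) mod int k = ((x + y + z) + 1) mod int k"
      using d by (auto simp: algebra_simps)
    then have "(x + fst d + (y + fst (snd d)) + (z + snd (snd d))) mod int k = ((x + y + z) mod int k + 1) mod int k"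
      by (simp only: mod_add_left_eq)
    then show ?thesis using st by (simp add: torus_up_def f_def xyz w)
  qed
  have adj: "torus_adj m n k (f v) (f w)"
    if "v \<in> box_part k m n True" "w \<in> box_part k m n False" "cubic_adj v w" for v w
  proof -
    have vw: "v \<in> lattice_box k m n" "w \<in> lattice_box k m n" using that by (auto simp: box_part_def)
    obtain x y z where v: "v = (x, y, z)" by (metis prod_cases3)
    obtain x' y' z' where w: "w = (x', y', z')" by (metis prod_cases3)
    from cubic_adj_cases[OF that(3)[unfolded v w]] consider
      "w = (x + 1, y, z)" | "v = (x' + 1, y', z')" | "w = (x, y + 1, z)" | "v = (x', y' + 1, z')"
      | "w = (x, y, z + 1)" | "v = (x', y', z' + 1)"
      using v w by auto
    then show ?thesis
    proof cases
      case 1 then show ?thesis using up[OF vw, of "(1, 0, 0)"] v by (simp add: torus_adj_def)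
    next
      case 2 then show ?thesis using up[OF vw(2,1), of "(1, 0, 0)"] w by (simp add: torus_adj_def)
    next
      case 3 then show ?thesis using up[OF vw, of "(0, 1, 0)"] v by (simp add: torus_adj_def)
    next
      case 4 then show ?thesis using up[OF vw(2,1), of "(0, 1, 0)"] w by (simp add: torus_adj_def)
    next
      case 5 then show ?thesis using up[OF vw, of "(0, 0, 1)"] v by (simp add: torus_adj_def)
    next
      case 6 then show ?thesis using up[OF vw(2,1), of "(0, 0, 1)"] w by (simp add: torus_adj_def)
    qed
  qed
  have "card (bip_matchings (box_part k m n True) (box_part k m n False) cubic_adj) \<le> card (torus_matchings m n k)"
    unfolding torus_matchings_def
    by (intro card_bip_matchings_mono[OF _ _ bij bij] finite_torus_part adj)
  then show ?thesis using num_matchings_le_bip[of k m n] by simp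
qed

section \<open>Matchings of the torus as paths of the transfer matrix\<close>

lemma carrier_VG: "2 \<le> m \<Longrightarrow> 2 \<le> n \<Longrightarrow> carrier (VG m n) = layer m n"
  by (simp add: carrier_integer_mod_group layer_def)

lemma mod_diff_eq_iff:
  fixes u v d k :: int
  assumes "0 \<le> v" "v < k" "0 \<le> d" "d < k"
  shows "(v + (- u) mod k) mod k = d \<longleftrightarrow> v = (u + d) mod k"
proof
  assume "(v + (- u) mod k) mod k = d"
  then have "d = (v - u) mod k" by (simp add: mod_add_right_eq)
  then have "(u + d) mod k = v mod k" by (simp add: mod_add_right_eq)
  then show "v = (u + d) mod k" using assms by simp
next
  assume "v = (u + d) mod k"
  then have "(v + (- u) mod k) mod k = ((u + d) - u) mod k" by (simp add: mod_add_eq mod_diff_left_eq)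
  then show "(v + (- u) mod k) mod k = d" using assms by simp
qed

lemma A_mat_eq:
  assumes mn: "2 \<le> m" "2 \<le> n" and u: "u \<in> layer m n" and v: "v \<in> layer m n"
  shows "A_mat m n u v = (if step m n u v then 1 else 0)"
proof -
  obtain a b where ab: "u = (a, b)" by (cases u)
  obtain c d where cd: "v = (c, d)" by (cases v)
  have car: "a \<in> carrier (integer_mod_group m)" "b \<in> carrier (integer_mod_group n)"
    using u mn by (auto simp: ab layer_def carrier_integer_mod_group)
  have "v \<otimes>\<^bsub>VG m n\<^esub> inv\<^bsub>VG m n\<^esub> u = ((c + (- a) mod int m) mod int m, (d + (- b) mod int n) mod int n)"
    using car by (simp add: ab cd)
  moreover have "((c + (- a) mod int m) mod int m, (d + (- b) mod int n) mod int n) \<in> D_steps \<longleftrightarrow> step m n u v"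
  proof -
    have 1: "(c + (- a) mod int m) mod int m = e \<longleftrightarrow> c = (a + e) mod int m" if "0 \<le> e" "e < int m" for e
      using v by (intro mod_diff_eq_iff that) (auto simp: cd layer_def)
    have 2: "(d + (- b) mod int n) mod int n = e \<longleftrightarrow> d = (b + e) mod int n" if "0 \<le> e" "e < int n" for e
      using v by (intro mod_diff_eq_iff that) (auto simp: cd layer_def)
    show ?thesis
      unfolding D_steps_def step_def ab cd using mn 1[of 0] 1[of 1] 2[of 0] 2[of 1] by auto
  qed
  ultimately show ?thesis unfolding A_mat_def by simp
qed

text \<open>The permanent of a zero-one matrix counts the bijections supported on its ones.  If the sizes do
  not add up, there is no bijection, so the case distinction in the transfer matrix disappears.\<close>

lemma T_mat_eq_card:
  assumes mn: "2 \<le> m" "2 \<le> n" and U: "U \<subseteq> layer m n" and V: "V \<subseteq> layer m n"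
  shows "T_mat m n U V = real (card (bip_matchings U (layer m n - V) (step m n)))"
proof -
  let ?C = "layer m n - V"
  have fin: "finite (layer m n)" by (simp add: layer_def)
  have card_layer: "card (layer m n) = m * n" by (simp add: layer_def card_cartesian_product)
  have finU: "finite U" "finite ?C" using fin U by (auto intro: finite_subset)
  show ?thesis
  proof (cases "card U + card V = m * n")
    case True
    have "permanent (A_mat m n) U ?C = (\<Sum>\<sigma> \<in> {\<sigma> \<in> U \<rightarrow>\<^sub>E ?C. bij_betw \<sigma> U ?C}. if \<forall>u\<in>U. step m n u (\<sigma> u) then 1 else 0)"
      unfolding permanent_def
    proof (rule sum.cong[OF refl])
      fix \<sigma> assume s: "\<sigma> \<in> {\<sigma> \<in> U \<rightarrow>\<^sub>E ?C. bij_betw \<sigma> U ?C}"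
      have "A_mat m n u (\<sigma> u) = (if step m n u (\<sigma> u) then 1 else 0)" if "u \<in> U" for u
      proof -
        have "\<sigma> u \<in> ?C" using s that by (intro PiE_mem[of \<sigma> U "\<lambda>_. ?C"]) auto
        then show ?thesis using that U by (intro A_mat_eq mn) auto
      qed
      then have "(\<Prod>u\<in>U. A_mat m n u (\<sigma> u)) = (\<Prod>u\<in>U. if step m n u (\<sigma> u) then 1 else (0::real))"
        by (rule prod.cong[OF refl])
      also have "\<dots> = (if \<forall>u\<in>U. step m n u (\<sigma> u) then 1 else 0)"
      proof (cases "\<forall>u\<in>U. step m n u (\<sigma> u)")
        case False
        then show ?thesis using finU by (auto simp: prod_zero_iff)
      qed simp
      finally show "(\<Prod>u\<in>U. A_mat m n u (\<sigma> u)) = (if \<forall>u\<in>U. step m n u (\<sigma> u) then 1 else 0)" .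
    qed
    also have "\<dots> = (\<Sum>\<sigma> \<in> bip_matchings U ?C (step m n). 1)"
    proof (rule sum.mono_neutral_cong_right)
      show "finite {\<sigma> \<in> U \<rightarrow>\<^sub>E ?C. bij_betw \<sigma> U ?C}"
        by (rule finite_subset[of _ "U \<rightarrow>\<^sub>E ?C"]) (use finU in \<open>auto intro: finite_PiE\<close>)
    qed (auto simp: bip_matchings_def)
    finally show ?thesis unfolding T_mat_def carrier_VG[OF mn] using True by simp
  next
    case False
    have "\<not> bij_betw \<sigma> U ?C" for \<sigma>
    proof
      assume "bij_betw \<sigma> U ?C"
      then have "card U = card ?C" by (rule bij_betw_same_card)
      also have "\<dots> = m * n - card V" using V fin card_layer by (simp add: card_Diff_subset finite_subset)
      finally show False using False V fin card_layer card_mono[of "layer m n" V] by simp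
    qed
    then have "bip_matchings U ?C (step m n) = {}" by (simp add: bip_matchings_def)
    then show ?thesis using False by (simp add: T_mat_def)
  qed
qed

definition T_op :: "nat \<Rightarrow> nat \<Rightarrow> ((int \<times> int) set \<Rightarrow> real) \<Rightarrow> (int \<times> int) set \<Rightarrow> real" where
  "T_op m n w U = (\<Sum>V\<in>Pow (layer m n). T_mat m n U V * w V)"

text \<open>Paths of the transfer matrix with the weights resolved into single bijections: an entry \<open>(\<sigma>, V)\<close>
  says that \<open>\<sigma>\<close> matches the current subset with the complement of the next subset \<open>V\<close>.\<close>

fun layer_paths :: "nat \<Rightarrow> nat \<Rightarrow> nat \<Rightarrow> (int \<times> int) set \<Rightarrow> ((int \<times> int \<Rightarrow> int \<times> int) \<times> (int \<times> int) set) list set" where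
  "layer_paths m n 0 U = {[]}"
| "layer_paths m n (Suc j) U = (\<Union>V\<in>Pow (layer m n).
     (\<lambda>(\<sigma>, ps). (\<sigma>, V) # ps) ` (bip_matchings U (layer m n - V) (step m n) \<times> layer_paths m n j V))"

lemma layer_paths_card:
  assumes mn: "2 \<le> m" "2 \<le> n" and U: "U \<subseteq> layer m n"
  shows "finite (layer_paths m n j U) \<and> real (card (layer_paths m n j U)) \<le> ((T_op m n) ^^ j) (\<lambda>_. 1) U"
  using U
proof (induction j arbitrary: U)
  case (Suc j)
  let ?B = "\<lambda>V. bip_matchings U (layer m n - V) (step m n)"
  have fin: "finite (layer m n)" by (simp add: layer_def)
  have finB: "finite (?B V)" for V using fin Suc.prems by (intro finite_bip_matchings) (auto intro: finite_subset)
  have f: "finite ((\<lambda>(\<sigma>, ps). (\<sigma>, V) # ps) ` (?B V \<times> layer_paths m n j V))" if "V \<in> Pow (layer m n)" for V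
    using finB Suc.IH that by auto
  have "real (card (layer_paths m n (Suc j) U))
      \<le> real (\<Sum>V\<in>Pow (layer m n). card ((\<lambda>(\<sigma>, ps). (\<sigma>, V) # ps) ` (?B V \<times> layer_paths m n j V)))"
    using fin by (simp only: layer_paths.simps of_nat_le_iff) (intro card_UN_le, simp)
  also have "\<dots> \<le> (\<Sum>V\<in>Pow (layer m n). T_mat m n U V * ((T_op m n) ^^ j) (\<lambda>_. 1) V)"
    unfolding of_nat_sum
  proof (rule sum_mono)
    fix V assume V: "V \<in> Pow (layer m n)"
    have "card ((\<lambda>(\<sigma>, ps). (\<sigma>, V) # ps) ` (?B V \<times> layer_paths m n j V)) \<le> card (?B V \<times> layer_paths m n j V)"
      using finB Suc.IH V by (intro card_image_le) auto
    also have "\<dots> = card (?B V) * card (layer_paths m n j V)" by (rule card_cartesian_product)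
    finally have "real (card ((\<lambda>(\<sigma>, ps). (\<sigma>, V) # ps) ` (?B V \<times> layer_paths m n j V)))
        \<le> real (card (?B V) * card (layer_paths m n j V))" by (rule of_nat_mono)
    also have "\<dots> = real (card (?B V)) * real (card (layer_paths m n j V))" by (rule of_nat_mult)
    also have "\<dots> \<le> real (card (?B V)) * ((T_op m n) ^^ j) (\<lambda>_. 1) V"
      using Suc.IH[of V] V by (intro mult_left_mono) auto
    finally show "real (card ((\<lambda>(\<sigma>, ps). (\<sigma>, V) # ps) ` (?B V \<times> layer_paths m n j V)))
        \<le> T_mat m n U V * ((T_op m n) ^^ j) (\<lambda>_. 1) V"
      using T_mat_eq_card[OF mn Suc.prems, of V] V by simp
  qed
  also have "\<dots> = ((T_op m n) ^^ Suc j) (\<lambda>_. 1) U" by (simp add: T_op_def[of m n "((T_op m n) ^^ j) (\<lambda>_. 1)"])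
  finally show ?case using f fin by simp
qed simp

lemma layer_paths_memI:
  assumes "\<And>t. t < i + j \<Longrightarrow> \<sigma> t \<in> bip_matchings (U t) (layer m n - U (Suc t)) (step m n)"
    and "\<And>t. U t \<subseteq> layer m n"
  shows "map (\<lambda>t. (\<sigma> t, U (Suc t))) [i..<i + j] \<in> layer_paths m n j (U i)"
  using assms(1)
proof (induction j arbitrary: i)
  case (Suc j)
  have "map (\<lambda>t. (\<sigma> t, U (Suc t))) [Suc i..<Suc i + j] \<in> layer_paths m n j (U (Suc i))"
    by (rule Suc.IH) (use Suc.prems in auto)
  moreover have "[i..<i + Suc j] = i # [Suc i..<Suc i + j]" by (simp add: upt_rec)
  ultimately show ?case using Suc.prems[of i] assms(2)[of "Suc i"] by (auto intro!: bexI[of _ "U (Suc i)"])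
qed simp

text \<open>Let \<open>U s t\<close> be the set of vertices of layer \<open>t\<close> whose partner lies in layer \<open>t + 1\<close>.  The vertices of layer
  \<open>t + 1\<close> with partner in layer \<open>t\<close> are then those outside \<open>U s (t + 1)\<close>, and the matching restricts to a
  bijection between the two sets: this is a path.  The path closes up after \<open>k\<close> steps; forgetting this
  bounds the count by the sum of all entries of the power instead of its trace.\<close>

lemma card_torus_matchings_le:
  assumes mn: "2 \<le> m" "2 \<le> n" and k: "3 \<le> k" "even k"
  shows "real (card (torus_matchings m n k)) \<le> (\<Sum>U\<in>Pow (layer m n). ((T_op m n) ^^ k) (\<lambda>_. 1) U)"
proof -
  let ?L = "layer m n" and ?E = "torus_part m n k True" and ?O = "torus_part m n k False"
  have fin: "finite ?L" by (simp add: layer_def)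
  \<comment> \<open>\<open>pr s x\<close> is the partner of \<open>x\<close>, also for vertices in odd layers\<close>
  define pr where "pr s x = (if x \<in> ?E then s x else inv_into ?E s x)" for s :: "int \<times> int \<times> int \<Rightarrow> int \<times> int \<times> int" and x
  define tt where "tt t = int t mod int k" for t :: nat
  define U where "U s t = {u \<in> ?L. fst (pr s (tt t, u)) = (tt t + 1) mod int k}" for s t
  define \<sigma> where "\<sigma> s t = (\<lambda>u\<in>U s t. snd (pr s (tt t, u)))" for s t
  define \<Phi> where "\<Phi> s = (U s 0, map (\<lambda>t. (\<sigma> s t, U s (Suc t))) [0..<0 + k])" for s
  have tt: "0 \<le> tt t" "tt t < int k" "tt (Suc t) = (tt t + 1) mod int k" for t
    using k by (simp_all add: tt_def mod_simps add.commute)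
  have torus: "x \<in> torus m n k \<longleftrightarrow> x \<in> ?E \<or> x \<in> ?O" for x by (auto simp: torus_part_def)
  have disj: "x \<in> ?O \<Longrightarrow> x \<notin> ?E" for x by (auto simp: torus_part_def)
  have torus_iff: "x \<in> torus m n k \<longleftrightarrow> 0 \<le> fst x \<and> fst x < int k \<and> snd x \<in> ?L" for x
    by (cases x) (auto simp: torus_def)
  have pr: "pr s x \<in> torus m n k" "pr s (pr s x) = x" "torus_adj m n k x (pr s x)"
    if s: "s \<in> torus_matchings m n k" and x: "x \<in> torus m n k" for s x
  proof -
    have bij: "bij_betw s ?E ?O" and adj: "\<And>a. a \<in> ?E \<Longrightarrow> torus_adj m n k a (s a)"
      using s by (auto simp: torus_matchings_def bip_matchings_def)
    have sym: "torus_adj m n k a b \<Longrightarrow> torus_adj m n k b a" for a b unfolding torus_adj_def by blast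
    have "pr s x \<in> torus m n k \<and> pr s (pr s x) = x \<and> torus_adj m n k x (pr s x)"
    proof (cases "x \<in> ?E")
      case True
      have "s x \<in> ?O" by (rule bij_betw_apply[OF bij True])
      moreover have "inv_into ?E s (s x) = x" by (rule bij_betw_inv_into_left[OF bij True])
      ultimately show ?thesis using True disj[of "s x"] adj[OF True] torus[of "s x"] by (simp add: pr_def)
    next
      case False
      then have xO: "x \<in> ?O" using x torus by blast
      define y where "y = inv_into ?E s x"
      have y: "y \<in> ?E" unfolding y_def by (rule bij_betw_apply[OF bij_betw_inv_into[OF bij] xO])
      have sy: "s y = x" unfolding y_def by (rule bij_betw_inv_into_right[OF bij xO])
      have "pr s x = y" using False by (simp add: pr_def y_def)
      moreover have "pr s y = x" using y sy by (simp add: pr_def)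
      moreover have "torus_adj m n k x y" using sym[OF adj[OF y]] sy by simp
      ultimately show ?thesis using y torus[of y] by simp
    qed
    then show "pr s x \<in> torus m n k" "pr s (pr s x) = x" "torus_adj m n k x (pr s x)" by blast+
  qed
  \<comment> \<open>a vertex of layer \<open>t\<close> is matched upwards if and only if it lies in \<open>U s t\<close>\<close>
  have upU: "torus_up m n k (tt t, u) (pr s (tt t, u))" if "u \<in> U s t" "s \<in> torus_matchings m n k" for s t u
  proof -
    let ?x = "(tt t, u)"
    have x: "?x \<in> torus m n k" using that tt by (simp add: torus_iff U_def)
    have up: "fst (pr s ?x) = (tt t + 1) mod int k" using that by (simp add: U_def)
    have "\<not> torus_up m n k (pr s ?x) ?x"
    proof
      assume "torus_up m n k (pr s ?x) ?x"
      then have "tt t = (fst (pr s ?x) + 1) mod int k" by (simp add: torus_up_def)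
      then show False using no_two_cycle[OF _ tt(1,2) up] k by simp
    qed
    then show ?thesis using pr(3)[OF that(2) x] by (simp add: torus_adj_def)
  qed
  have downU: "torus_up m n k (pr s (tt t, u)) (tt t, u)" if "u \<in> ?L" "u \<notin> U s t" "s \<in> torus_matchings m n k" for s t u
  proof -
    have x: "(tt t, u) \<in> torus m n k" using that tt by (simp add: torus_iff)
    have "\<not> torus_up m n k (tt t, u) (pr s (tt t, u))" using that by (auto simp: U_def torus_up_def)
    then show ?thesis using pr(3)[OF that(3) x] by (simp add: torus_adj_def)
  qed
  have up_pr: "pr s (tt t, u) = (tt (Suc t), \<sigma> s t u)" if "u \<in> U s t" for s t u
    using that tt(3) by (simp add: \<sigma>_def U_def prod_eq_iff)
  have mod_inj: "a = b" if "(a + 1) mod int k = (b + 1) mod int k" "0 \<le> a" "a < int k" "0 \<le> b" "b < int k" for a b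
  proof -
    have "((a + 1) mod int k - 1) mod int k = ((b + 1) mod int k - 1) mod int k" using that by simp
    then have "a mod int k = b mod int k" by (simp add: mod_diff_left_eq)
    then show ?thesis using that by simp
  qed
  have \<sigma>: "\<sigma> s t \<in> bip_matchings (U s t) (?L - U s (Suc t)) (step m n)" if s: "s \<in> torus_matchings m n k" for s t
  proof -
    have into: "\<sigma> s t u \<in> ?L - U s (Suc t)" if u: "u \<in> U s t" for u
    proof -
      have x: "(tt t, u) \<in> torus m n k" using u tt by (simp add: torus_iff U_def)
      have "\<sigma> s t u \<in> ?L" using pr(1)[OF s x] up_pr[OF u] by (simp add: torus_iff)
      moreover have "\<sigma> s t u \<notin> U s (Suc t)"
      proof
        assume "\<sigma> s t u \<in> U s (Suc t)"
        then have "fst (pr s (pr s (tt t, u))) = (tt (Suc t) + 1) mod int k" using up_pr[OF u] by (simp add: U_def)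
        then have "tt t = (tt (Suc t) + 1) mod int k" using pr(2)[OF s x] by simp
        then show False using no_two_cycle[OF _ tt(1,2) tt(3)] k by simp
      qed
      ultimately show ?thesis by simp
    qed
    have st: "step m n u (\<sigma> s t u)" if u: "u \<in> U s t" for u
      using upU[OF u s] up_pr[OF u] by (simp add: torus_up_def)
    have inj: "inj_on (\<sigma> s t) (U s t)"
    proof
      fix u v assume u: "u \<in> U s t" and v: "v \<in> U s t" and eq: "\<sigma> s t u = \<sigma> s t v"
      have x: "(tt t, u) \<in> torus m n k" "(tt t, v) \<in> torus m n k" using u v tt by (simp_all add: torus_iff U_def)
      have "pr s (tt t, u) = pr s (tt t, v)" using up_pr[OF u] up_pr[OF v] eq by simp
      then have "(tt t, u) = (tt t, v)" using pr(2)[OF s x(1)] pr(2)[OF s x(2)] by metis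
      then show "u = v" by simp
    qed
    have surj: "?L - U s (Suc t) \<subseteq> \<sigma> s t ` U s t"
    proof
      fix v assume v: "v \<in> ?L - U s (Suc t)"
      define y where "y = (tt (Suc t), v)"
      have yT: "y \<in> torus m n k" using v tt(1,2)[of "Suc t"] by (simp add: torus_iff y_def)
      have "torus_up m n k (pr s y) y" using downU[of v s "Suc t"] v s by (simp add: y_def)
      then have e: "(fst (pr s y) + 1) mod int k = (tt t + 1) mod int k"
        using tt(3)[of t] by (simp add: torus_up_def y_def)
      have pT: "pr s y \<in> torus m n k" by (rule pr(1)[OF s yT])
      have f: "fst (pr s y) = tt t" by (rule mod_inj[OF e]) (use pT tt(1,2)[of t] in \<open>auto simp: torus_iff\<close>)
      define u where "u = snd (pr s y)"
      have pu: "pr s y = (tt t, u)" using f by (simp add: u_def prod_eq_iff)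
      have "pr s (tt t, u) = y" using pr(2)[OF s yT] pu by simp
      moreover have "u \<in> U s t" using pT pu \<open>pr s (tt t, u) = y\<close> tt(3)[of t] by (simp add: U_def y_def torus_iff)
      ultimately show "v \<in> \<sigma> s t ` U s t" using up_pr[of u s t] by (auto simp: y_def)
    qed
    show ?thesis using into st inj surj
      by (auto simp: bip_matchings_def bij_betw_def \<sigma>_def PiE_def)
  qed
  have UL: "U s t \<subseteq> ?L" for s t by (auto simp: U_def)
  let ?X = "SIGMA U:Pow ?L. layer_paths m n k U"
  have "card (torus_matchings m n k) \<le> card ?X"
  proof (rule card_inj_on_le[of \<Phi>])
    show "finite ?X" using fin layer_paths_card[OF mn] by (intro finite_SigmaI) auto
    show "\<Phi> ` torus_matchings m n k \<subseteq> ?X"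
    proof
      fix z assume "z \<in> \<Phi> ` torus_matchings m n k"
      then obtain s where s: "s \<in> torus_matchings m n k" "z = \<Phi> s" by blast
      have "map (\<lambda>t. (\<sigma> s t, U s (Suc t))) [0..<0 + k] \<in> layer_paths m n k (U s 0)"
        by (rule layer_paths_memI) (rule \<sigma>[OF s(1)], rule UL)
      then show "z \<in> ?X" using UL s(2) by (auto simp: \<Phi>_def)
    qed
    show "inj_on \<Phi> (torus_matchings m n k)"
    proof
      fix s s' assume s: "s \<in> torus_matchings m n k" and s': "s' \<in> torus_matchings m n k" and eq: "\<Phi> s = \<Phi> s'"
      have lst: "map (\<lambda>t. (\<sigma> s t, U s (Suc t))) [0..<k] = map (\<lambda>t. (\<sigma> s' t, U s' (Suc t))) [0..<k]"
        using eq by (simp add: \<Phi>_def)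
      have \<sigma>eq: "\<sigma> s t = \<sigma> s' t" "U s (Suc t) = U s' (Suc t)" if "t < k" for t
        using lst that by auto
      have U0: "U s 0 = U s' 0" using eq by (simp add: \<Phi>_def)
      have Ueq: "U s t = U s' t" if "t < k" for t
        using that U0 \<sigma>eq(2) by (cases t) auto
      have preq: "pr s x = pr s' x" if x: "x \<in> torus m n k" for x
      proof -
        define t where "t = nat (fst x)"
        define u where "u = snd x"
        have t: "t < k" "tt t = fst x" and u: "u \<in> ?L" and xt: "x = (tt t, u)"
          using x by (auto simp: torus_iff t_def u_def tt_def)
        show ?thesis
        proof (cases "u \<in> U s t")
          case True
          then show ?thesis using up_pr[of u s t] up_pr[of u s' t] Ueq[OF t(1)] \<sigma>eq(1)[OF t(1)] xt by simp
        next
          case False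
          \<comment> \<open>the layer below, cyclically\<close>
          define t' where "t' = (if t = 0 then k - 1 else t - 1)"
          have t': "t' < k" "tt (Suc t') = tt t" using t k by (auto simp: t'_def tt_def)
          have *: "\<exists>w\<in>U r t'. pr r x = (tt t', w) \<and> \<sigma> r t' w = u"
            if r: "r \<in> torus_matchings m n k" and nu: "u \<notin> U r t" for r
          proof -
            have "U r (Suc t') = U r t" using t'(2) by (simp add: U_def)
            then have "u \<in> \<sigma> r t' ` U r t'"
              using \<sigma>[OF r, of t'] u nu by (auto simp: bip_matchings_def bij_betw_def)
            then obtain w where w: "w \<in> U r t'" "\<sigma> r t' w = u" by blast
            have "pr r (tt t', w) = x" using up_pr[OF w(1)] w(2) t'(2) xt by simp
            moreover have "(tt t', w) \<in> torus m n k" using w(1) tt by (simp add: torus_iff U_def)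
            ultimately have "pr r x = (tt t', w)" using pr(2)[OF r] by metis
            then show ?thesis using w by blast
          qed
          obtain w where w: "w \<in> U s t'" "pr s x = (tt t', w)" "\<sigma> s t' w = u" using *[OF s False] by blast
          obtain w' where w': "w' \<in> U s' t'" "pr s' x = (tt t', w')" "\<sigma> s' t' w' = u"
            using *[OF s'] False Ueq[OF t(1)] by blast
          have "w = w'" using w w' Ueq[OF t'(1)] \<sigma>eq(1)[OF t'(1)] \<sigma>[OF s, of t']
            by (auto simp: bip_matchings_def bij_betw_def inj_on_def)
          then show ?thesis using w w' by simp
        qed
      qed
      show "s = s'"
      proof (rule extensionalityI)
        show "s \<in> extensional ?E" "s' \<in> extensional ?E"
          using s s' by (auto simp: torus_matchings_def bip_matchings_def PiE_def)
        fix x assume "x \<in> ?E"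
        then show "s x = s' x" using preq[of x] torus[of x] by (simp add: pr_def)
      qed
    qed
  qed
  then have "real (card (torus_matchings m n k)) \<le> real (card ?X)" by simp
  also have "\<dots> = (\<Sum>U\<in>Pow ?L. real (card (layer_paths m n k U)))"
    using fin layer_paths_card[OF mn] by (subst card_SigmaI) auto
  also have "\<dots> \<le> (\<Sum>U\<in>Pow ?L. ((T_op m n) ^^ k) (\<lambda>_. 1) U)"
    using layer_paths_card[OF mn] by (intro sum_mono) auto
  finally show ?thesis .
qed

section \<open>Collatz--Wielandt quotients of a primitive matrix\<close>

lemma bounded_functions_convergent_subseq:
  fixes x :: "nat \<Rightarrow> 'a \<Rightarrow> real"
  assumes "finite I" and "\<And>p r. r \<in> I \<Longrightarrow> \<bar>x p r\<bar> \<le> 1"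
  shows "\<exists>\<phi> l. strict_mono (\<phi> :: nat \<Rightarrow> nat) \<and> (\<forall>r\<in>I. (\<lambda>j. x (\<phi> j) r) \<longlonglongrightarrow> l r)"
  using assms
proof (induction I rule: finite_induct)
  case empty
  show ?case by (auto intro: exI[of _ id] simp: strict_mono_def)
next
  case (insert s I)
  have "\<exists>\<phi> l. strict_mono (\<phi> :: nat \<Rightarrow> nat) \<and> (\<forall>r\<in>I. (\<lambda>j. x (\<phi> j) r) \<longlonglongrightarrow> l r)"
    using insert.IH insert.prems by simp
  then obtain \<phi> :: "nat \<Rightarrow> nat" and l
    where \<phi>: "strict_mono \<phi>" "\<And>r. r \<in> I \<Longrightarrow> (\<lambda>j. x (\<phi> j) r) \<longlonglongrightarrow> l r" by blast
  obtain f :: "nat \<Rightarrow> nat" where f: "strict_mono f" "monoseq (\<lambda>j. x (\<phi> (f j)) s)"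
    using seq_monosub[of "\<lambda>j. x (\<phi> j) s"] by blast
  have "Bseq (\<lambda>j. x (\<phi> (f j)) s)"
    using insert.prems by (intro BseqI'[of _ 1]) auto
  then obtain L where L: "(\<lambda>j. x (\<phi> (f j)) s) \<longlonglongrightarrow> L"
    using Bseq_monoseq_convergent f(2) convergent_def by blast
  have "(\<lambda>j. x ((\<phi> \<circ> f) j) r) \<longlonglongrightarrow> (l(s := L)) r" if "r \<in> insert s I" for r
  proof (cases "r = s")
    case True then show ?thesis using L by simp
  next
    case False
    then have "(\<lambda>j. x (\<phi> j) r) \<longlonglongrightarrow> l r" using that \<phi>(2) by simp
    from LIMSEQ_subseq_LIMSEQ[OF this f(1)] show ?thesis using False by (simp add: o_def)
  qed
  moreover have "strict_mono (\<phi> \<circ> f)" using \<phi>(1) f(1) by (rule strict_mono_o)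
  ultimately show ?case by blast
qed

text \<open>The kernel acts by \<open>w \<mapsto> \<Sum>c. K r c * w c\<close>.  Irreducibility is stated through sets: a nonempty set of
  indices that contains every index with a positive entry in one of its columns is everything.
  Together with the positive diagonal this makes the matrix primitive.\<close>

locale primitive_kernel =
  fixes I :: "'a set" and K :: "'a \<Rightarrow> 'a \<Rightarrow> real"
  assumes finI: "finite I" and neI: "I \<noteq> {}"
    and nonneg: "\<And>r c. r \<in> I \<Longrightarrow> c \<in> I \<Longrightarrow> 0 \<le> K r c"
    and diag: "\<And>r. r \<in> I \<Longrightarrow> 0 < K r r"
    and irred: "\<And>Z. Z \<subseteq> I \<Longrightarrow> Z \<noteq> {} \<Longrightarrow>
      (\<And>r c. r \<in> I \<Longrightarrow> c \<in> Z \<Longrightarrow> 0 < K r c \<Longrightarrow> r \<in> Z) \<Longrightarrow> Z = I"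
begin

definition K_op :: "('a \<Rightarrow> real) \<Rightarrow> 'a \<Rightarrow> real" where
  "K_op w = (\<lambda>r. if r \<in> I then \<Sum>c\<in>I. K r c * w c else 0)"

definition K_ones :: "nat \<Rightarrow> 'a \<Rightarrow> real" where
  "K_ones p = (K_op ^^ p) (\<lambda>r. if r \<in> I then 1 else 0)"

text \<open>The Collatz--Wielandt bound of the \<open>p\<close>-th iterate of the all-ones vector.\<close>

definition cw_bound :: "nat \<Rightarrow> real" where
  "cw_bound p = (MAX r\<in>I. K_ones (p + 1) r / K_ones p r)"

lemma K_op_mono: "(\<And>r. r \<in> I \<Longrightarrow> v r \<le> w r) \<Longrightarrow> r \<in> I \<Longrightarrow> K_op v r \<le> K_op w r"
  unfolding K_op_def using nonneg by (auto intro!: sum_mono mult_left_mono)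

lemma K_op_scale: "r \<in> I \<Longrightarrow> K_op (\<lambda>r. a * v r) r = a * K_op v r"
  by (simp add: K_op_def sum_distrib_left mult_ac)

lemma K_op_diff: "r \<in> I \<Longrightarrow> K_op (\<lambda>r. v r - w r) r = K_op v r - K_op w r"
  by (simp add: K_op_def right_diff_distrib sum_subtractf)

lemma K_op_cong: "(\<And>r. r \<in> I \<Longrightarrow> v r = w r) \<Longrightarrow> K_op v = K_op w"
  by (auto simp: K_op_def)

lemma K_op_nonneg: "(\<And>r. r \<in> I \<Longrightarrow> 0 \<le> v r) \<Longrightarrow> 0 \<le> K_op v r"
  unfolding K_op_def using nonneg by (auto intro!: sum_nonneg)

lemma K_op_pos:
  assumes "\<And>r. r \<in> I \<Longrightarrow> 0 \<le> v r" "r \<in> I" "c \<in> I" "0 < K r c" "0 < v c"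
  shows "0 < K_op v r"
proof -
  have "0 < (\<Sum>c\<in>I. K r c * v c)"
    using assms nonneg finI by (intro sum_pos2[of I c]) auto
  then show ?thesis using assms by (simp add: K_op_def)
qed

lemma K_op_pow_diff: "r \<in> I \<Longrightarrow> (K_op ^^ N) (\<lambda>r. v r - w r) r = (K_op ^^ N) v r - (K_op ^^ N) w r"
proof (induction N arbitrary: r)
  case (Suc N)
  have "K_op ((K_op ^^ N) (\<lambda>r. v r - w r)) = K_op (\<lambda>r. (K_op ^^ N) v r - (K_op ^^ N) w r)"
    by (rule K_op_cong) (rule Suc.IH)
  then show ?case using K_op_diff[OF Suc.prems] by simp
qed simp

lemma K_op_pow_scale: "r \<in> I \<Longrightarrow> (K_op ^^ N) (\<lambda>r. a * v r) r = a * (K_op ^^ N) v r"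
proof (induction N arbitrary: r)
  case (Suc N)
  have "K_op ((K_op ^^ N) (\<lambda>r. a * v r)) = K_op (\<lambda>r. a * (K_op ^^ N) v r)"
    by (rule K_op_cong) (rule Suc.IH)
  then show ?case using K_op_scale[OF Suc.prems] by simp
qed simp

lemma K_op_tendsto:
  assumes "\<And>r. r \<in> I \<Longrightarrow> (\<lambda>j. x j r) \<longlonglongrightarrow> l r"
  shows "(\<lambda>j. K_op (x j) r) \<longlonglongrightarrow> K_op l r"
  unfolding K_op_def using assms by (auto intro!: tendsto_intros)

lemma K_op_pow_tendsto:
  assumes "\<And>r. r \<in> I \<Longrightarrow> (\<lambda>j. x j r) \<longlonglongrightarrow> l r" "r \<in> I"
  shows "(\<lambda>j. (K_op ^^ N) (x j) r) \<longlonglongrightarrow> (K_op ^^ N) l r"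
  using assms(2)
proof (induction N arbitrary: r)
  case (Suc N)
  then show ?case by (auto intro: K_op_tendsto)
qed (use assms in auto)

text \<open>The support of a nonnegative vector does not shrink, by the positive diagonal, and grows strictly
  until it is everything, by irreducibility.\<close>

lemma K_op_pow_card_pos:
  assumes v: "\<And>r. r \<in> I \<Longrightarrow> 0 \<le> v r" and c: "c \<in> I" "0 < v c" and r: "r \<in> I"
  shows "0 < (K_op ^^ card I) v r"
proof -
  define Z where "Z N = {r\<in>I. 0 < (K_op ^^ N) v r}" for N
  have nn: "0 \<le> (K_op ^^ N) v r" if "r \<in> I" for N r
    using that v by (induction N arbitrary: r) (auto intro: K_op_nonneg)
  have step: "r \<in> Z (Suc N)" if "r \<in> I" "c \<in> Z N" "0 < K r c" for r c N
    using that K_op_pos[of "(K_op ^^ N) v" r c] nn by (auto simp: Z_def)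
  have mono: "Z N \<subseteq> Z (Suc N)" for N
    using step[of _ _ N] diag by (auto simp: Z_def)
  have finZ: "finite (Z N)" "Z N \<subseteq> I" for N using finI by (auto simp: Z_def)
  have ne: "Z N \<noteq> {}" for N
  proof (induction N)
    case 0 show ?case using c by (auto simp: Z_def)
  next
    case (Suc N) then show ?case using mono by blast
  qed
  have "N \<le> card (Z N) \<or> Z N = I" for N
  proof (induction N)
    case (Suc N)
    show ?case
    proof (cases "Z (Suc N) = Z N")
      case True
      have "Z N = I" using irred[OF finZ(2) ne] step True by blast
      then show ?thesis using True by simp
    next
      case False
      then have "card (Z N) < card (Z (Suc N))" using mono finZ(1) by (intro psubset_card_mono) auto
      then show ?thesis using Suc mono finZ(2)[of "Suc N"] by auto
    qed
  qed simp
  from this[of "card I"] have "Z (card I) = I"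
    using finZ finI card_seteq by blast
  then show ?thesis using r by (auto simp: Z_def)
qed

lemma K_ones_Suc: "K_ones (Suc p) = K_op (K_ones p)" by (simp add: K_ones_def)

lemma K_ones_pos: "r \<in> I \<Longrightarrow> 0 < K_ones p r"
proof (induction p arbitrary: r)
  case (Suc p)
  then show ?case unfolding K_ones_Suc using K_op_pos[of "K_ones p" r r] diag by (simp add: less_imp_le)
qed (simp add: K_ones_def)

lemma K_ones_le: assumes "r \<in> I" shows "K_ones (Suc p) r \<le> cw_bound p * K_ones p r"
proof -
  have "K_ones (p + 1) r / K_ones p r \<le> cw_bound p"
    unfolding cw_bound_def using assms finI by (intro Max_ge) auto
  then show ?thesis using K_ones_pos[OF assms, of p] by (simp add: divide_le_eq)
qed

lemma cw_bound_leI: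
  assumes "\<And>r. r \<in> I \<Longrightarrow> K_ones (Suc p) r \<le> a * K_ones p r" shows "cw_bound p \<le> a"
  unfolding cw_bound_def using finI neI assms K_ones_pos by (auto simp: divide_le_eq)

lemma decseq_cw_bound: "decseq cw_bound"
proof (rule decseq_SucI, rule cw_bound_leI)
  fix p r assume r: "r \<in> I"
  have "K_op (K_ones (Suc p)) r \<le> K_op (\<lambda>r. cw_bound p * K_ones p r) r"
    by (rule K_op_mono[OF K_ones_le r])
  then show "K_ones (Suc (Suc p)) r \<le> cw_bound p * K_ones (Suc p) r"
    using K_op_scale[OF r] by (simp add: K_ones_Suc)
qed

lemma diag_le_cw_bound: assumes "r \<in> I" shows "K r r \<le> cw_bound p"
proof -
  have "K r r * K_ones p r \<le> K_ones (Suc p) r"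
    unfolding K_ones_Suc K_op_def using assms finI K_ones_pos nonneg
    by (auto intro!: member_le_sum[of r I "\<lambda>c. K r c * K_ones p c"] simp: less_imp_le)
  also have "\<dots> \<le> cw_bound p * K_ones p r" by (rule K_ones_le[OF assms])
  finally show ?thesis using K_ones_pos[OF assms, of p] by simp
qed

text \<open>The Perron--Frobenius eigenvalue, which is the limit of the decreasing bounds.\<close>

definition pf_value :: real where "pf_value = (INF p. cw_bound p)"

lemma cw_bound_pos: "0 < cw_bound p"
  using neI diag diag_le_cw_bound by (metis ex_in_conv less_le_trans)

lemma cw_bound_bdd: "bdd_below (range cw_bound)"
  using cw_bound_pos by (auto intro!: bdd_belowI[of _ 0] less_imp_le)

lemma cw_bound_tendsto: "cw_bound \<longlonglongrightarrow> pf_value"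
  unfolding pf_value_def by (rule LIMSEQ_decseq_INF[OF cw_bound_bdd decseq_cw_bound])

lemma pf_value_le: "pf_value \<le> cw_bound p"
  unfolding pf_value_def by (rule cINF_lower[OF cw_bound_bdd]) simp

lemma pf_value_pos: "0 < pf_value"
proof -
  obtain r where r: "r \<in> I" using neI by blast
  have "K r r \<le> pf_value" unfolding pf_value_def
    by (rule cINF_greatest) (use r diag_le_cw_bound in auto)
  then show ?thesis using diag[OF r] by simp
qed

text \<open>Let \<open>v\<close> be an accumulation point of the normalised iterates, and let \<open>L\<close> be the limit of the bounds.
  Then \<open>L v - K v\<close> is nonnegative.  If it were not zero, enough applications of the kernel would make
  it strictly positive; by continuity the same would hold for a late iterate in place of \<open>v\<close>, and all
  quotients would be smaller than \<open>L\<close> some steps later.\<close>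

lemma pf_eigenvector:
  "\<exists>v. (\<forall>r\<in>I. 0 \<le> v r) \<and> (\<exists>r\<in>I. 0 < v r) \<and> (\<forall>r\<in>I. K_op v r = pf_value * v r)"
proof -
  define nrm where "nrm p = (\<Sum>r\<in>I. K_ones p r)" for p
  define x where "x p r = K_ones p r / nrm p" for p r
  have nrm_pos: "0 < nrm p" for p
    unfolding nrm_def using finI neI K_ones_pos by (intro sum_pos) auto
  have x_nn: "0 \<le> x p r" if "r \<in> I" for p r
    using K_ones_pos[OF that, of p] nrm_pos[of p] by (simp add: x_def)
  have x_sum: "(\<Sum>r\<in>I. x p r) = 1" for p
    using nrm_pos[of p] by (simp add: x_def nrm_def sum_divide_distrib[symmetric])
  have "\<bar>x p r\<bar> \<le> 1" if "r \<in> I" for p r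
    using x_nn[OF that] x_sum[of p] member_le_sum[of r I "x p"] finI x_nn that by auto
  from bounded_functions_convergent_subseq[of I x, OF finI this] obtain \<phi> :: "nat \<Rightarrow> nat" and v
    where \<phi>: "strict_mono \<phi>" and v: "\<And>r. r \<in> I \<Longrightarrow> (\<lambda>j. x (\<phi> j) r) \<longlonglongrightarrow> v r" by blast
  have v_nn: "0 \<le> v r" if "r \<in> I" for r
    using v[OF that] by (rule LIMSEQ_le_const) (use x_nn that in auto)
  have "(\<lambda>j. \<Sum>r\<in>I. x (\<phi> j) r) \<longlonglongrightarrow> (\<Sum>r\<in>I. v r)" by (intro tendsto_sum v)
  then have "(\<Sum>r\<in>I. v r) = 1" using x_sum LIMSEQ_unique[OF _ tendsto_const] by auto
  have v_pos: "\<exists>r\<in>I. 0 < v r"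
  proof (rule ccontr)
    assume "\<not> (\<exists>r\<in>I. 0 < v r)"
    then have "(\<Sum>r\<in>I. v r) \<le> 0" by (intro sum_nonpos) (auto simp: not_less)
    then show False using \<open>(\<Sum>r\<in>I. v r) = 1\<close> by simp
  qed
  define d where "d r = pf_value * v r - K_op v r" for r
  have Kx: "K_op (x p) r = K_ones (Suc p) r / nrm p" if "r \<in> I" for p r
    using that by (simp add: x_def K_ones_Suc K_op_def sum_divide_distrib)
  have "0 \<le> d r" if r: "r \<in> I" for r
  proof -
    have lim: "(\<lambda>j. cw_bound (\<phi> j)) \<longlonglongrightarrow> pf_value"
      using LIMSEQ_subseq_LIMSEQ[OF cw_bound_tendsto \<phi>] by (simp add: o_def)
    have "K_op (x (\<phi> j)) r \<le> cw_bound (\<phi> j) * x (\<phi> j) r" for j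
      using K_ones_le[OF r, of "\<phi> j"] nrm_pos[of "\<phi> j"] by (simp add: Kx[OF r] x_def divide_right_mono)
    then have "K_op v r \<le> pf_value * v r"
      using LIMSEQ_le[OF K_op_tendsto[of "\<lambda>j. x (\<phi> j)" v r, OF v] tendsto_mult[OF lim v[OF r]]] by blast
    then show ?thesis by (simp add: d_def)
  qed
  note d_nn = this
  have d0: "d r = 0" if "r \<in> I" for r
  proof (rule ccontr)
    \<comment> \<open>otherwise the ratios drop strictly below their infimum after \<open>card I\<close> further steps\<close>
    assume "d r \<noteq> 0"
    then have "0 < d r" using d_nn[OF that] by simp
    let ?N = "card I"
    have pos: "0 < (K_op ^^ ?N) d s" if "s \<in> I" for s
      using K_op_pow_card_pos[of d r s] d_nn \<open>r \<in> I\<close> \<open>0 < d r\<close> that by blast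
    have lim: "(\<lambda>j. (K_op ^^ ?N) (\<lambda>r. pf_value * x (\<phi> j) r - K_op (x (\<phi> j)) r) s) \<longlonglongrightarrow> (K_op ^^ ?N) d s"
      if "s \<in> I" for s
      unfolding d_def using v that by (intro K_op_pow_tendsto tendsto_intros K_op_tendsto) auto
    have "\<forall>\<^sub>F j in sequentially. \<forall>s\<in>I. 0 < (K_op ^^ ?N) (\<lambda>r. pf_value * x (\<phi> j) r - K_op (x (\<phi> j)) r) s"
      using order_tendstoD(1)[OF lim pos] finI by (auto intro!: eventually_ball_finite)
    then obtain j where j: "\<And>s. s \<in> I \<Longrightarrow> 0 < (K_op ^^ ?N) (\<lambda>r. pf_value * x (\<phi> j) r - K_op (x (\<phi> j)) r) s"
      using eventually_happens'[OF sequentially_bot] by blast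
    define p where "p = \<phi> j"
    have KN: "(K_op ^^ ?N) (K_ones q) = K_ones (?N + q)" for q by (simp add: K_ones_def funpow_add)
    have *: "(K_op ^^ ?N) (x p) s = K_ones (?N + p) s / nrm p" if "s \<in> I" for s
      using K_op_pow_scale[OF that, of ?N "1 / nrm p" "K_ones p"] by (simp add: x_def[abs_def] KN)
    have **: "(K_op ^^ ?N) (K_op (x p)) s = K_ones (Suc (?N + p)) s / nrm p" if "s \<in> I" for s
    proof -
      have "(K_op ^^ ?N) (K_op (x p)) s = K_op ((K_op ^^ ?N) (x p)) s" by (simp add: funpow_swap1)
      also have "\<dots> = K_op (\<lambda>s. (1 / nrm p) * K_ones (?N + p) s) s"
        by (rule fun_cong[OF K_op_cong]) (simp add: *)
      finally show ?thesis using K_op_scale[OF that, of "1 / nrm p" "K_ones (?N + p)"] by (simp add: K_ones_Suc)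
    qed
    have "K_ones (Suc (?N + p)) s < pf_value * K_ones (?N + p) s" if "s \<in> I" for s
    proof -
      have "0 < (K_op ^^ ?N) (\<lambda>r. pf_value * x p r) s - (K_op ^^ ?N) (K_op (x p)) s"
        using j[OF that] K_op_pow_diff[OF that, of ?N "\<lambda>r. pf_value * x p r" "K_op (x p)"] by (simp add: p_def)
      then have "0 < (pf_value * K_ones (?N + p) s - K_ones (Suc (?N + p)) s) / nrm p"
        using K_op_pow_scale[OF that, of ?N pf_value "x p"] *[OF that] **[OF that] by (simp add: diff_divide_distrib)
      then show ?thesis using nrm_pos[of p] by (simp add: zero_less_divide_iff)
    qed
    then have "K_ones (Suc (?N + p)) s / K_ones (?N + p) s < pf_value" if "s \<in> I" for s
      using that K_ones_pos[OF that, of "?N + p"] by (simp add: divide_less_eq)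
    then have "cw_bound (?N + p) < pf_value"
      unfolding cw_bound_def using finI neI by (subst Max_less_iff) auto
    then show False using pf_value_le[of "?N + p"] by simp
  qed
  show ?thesis using v_nn v_pos d0 by (intro exI[of _ v]) (auto simp: d_def)
qed

text \<open>Compare the eigenvector with the positive vector \<open>K_ones p\<close> at an index where the quotient of the
  moduli is largest.\<close>

lemma eigenvalue_le_cw_bound:
  fixes x :: "'a \<Rightarrow> complex"
  assumes ne: "\<exists>r\<in>I. x r \<noteq> 0"
    and eig: "\<And>r. r \<in> I \<Longrightarrow> (\<Sum>c\<in>I. complex_of_real (K r c) * x c) = \<mu> * x r"
  shows "norm \<mu> \<le> cw_bound p"
proof -
  define t where "t = (MAX r\<in>I. norm (x r) / K_ones p r)"
  have le_t: "norm (x r) \<le> t * K_ones p r" if "r \<in> I" for r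
  proof -
    have "norm (x r) / K_ones p r \<le> t" unfolding t_def using finI that by (intro Max_ge) auto
    then show ?thesis using K_ones_pos[OF that, of p] by (simp add: divide_le_eq)
  qed
  \<comment> \<open>an index at which the maximum is attained\<close>
  have "t \<in> (\<lambda>r. norm (x r) / K_ones p r) ` I" unfolding t_def using finI neI by (intro Max_in) auto
  then obtain s where s: "s \<in> I" "norm (x s) = t * K_ones p s" using K_ones_pos[of _ p] by (force simp: field_simps)
  obtain r where r: "r \<in> I" "x r \<noteq> 0" using ne by blast
  then have "0 < t * K_ones p r" using le_t[OF r(1)] by (meson less_le_trans zero_less_norm_iff)
  then have t: "0 < t" using K_ones_pos[OF r(1), of p] by (simp add: zero_less_mult_iff)
  have "norm \<mu> * norm (x s) = norm (\<Sum>c\<in>I. complex_of_real (K s c) * x c)"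
    using eig[OF s(1)] by (simp add: norm_mult)
  also have "\<dots> \<le> (\<Sum>c\<in>I. K s c * norm (x c))"
    by (rule order_trans[OF norm_sum]) (use nonneg s in \<open>simp add: norm_mult\<close>)
  also have "\<dots> \<le> (\<Sum>c\<in>I. K s c * (t * K_ones p c))"
    using le_t nonneg s(1) by (intro sum_mono mult_left_mono) auto
  also have "\<dots> = t * K_ones (Suc p) s"
    using s(1) by (simp add: K_ones_Suc K_op_def sum_distrib_left mult_ac)
  also have "\<dots> \<le> t * (cw_bound p * K_ones p s)"
    using K_ones_le[OF s(1)] t by (intro mult_left_mono) auto
  also have "\<dots> = cw_bound p * norm (x s)" using s by simp
  finally have "norm \<mu> * norm (x s) \<le> cw_bound p * norm (x s)" .
  moreover have "0 < norm (x s)" using s t K_ones_pos[OF s(1), of p] by simp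
  ultimately show ?thesis by (rule mult_right_le_imp_le)
qed

lemma K_ones_growth:
  assumes a: "pf_value < a"
  obtains C where "0 < C" "\<And>p r. r \<in> I \<Longrightarrow> K_ones p r \<le> C * a ^ p"
proof -
  have "\<forall>\<^sub>F p in sequentially. cw_bound p < a" by (rule order_tendstoD(2)[OF cw_bound_tendsto a])
  then obtain q where "\<forall>p\<ge>q. cw_bound p < a" unfolding eventually_sequentially by blast
  then have q: "cw_bound p \<le> a" if "q \<le> p" for p using that by (simp add: less_imp_le)
  have a0: "0 < a" using a pf_value_pos by simp
  define C where "C = 1 + (\<Sum>p\<le>q. \<Sum>r\<in>I. K_ones p r / a ^ p)"
  have wa: "0 \<le> K_ones p r / a ^ p" if "r \<in> I" for p r using K_ones_pos[OF that, of p] a0 by simp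
  have C0: "0 < C" unfolding C_def using wa by (intro add_pos_nonneg sum_nonneg) auto
  have small: "K_ones p r / a ^ p \<le> C" if r: "r \<in> I" and p: "p \<le> q" for p r
  proof -
    have "K_ones p r / a ^ p \<le> (\<Sum>r\<in>I. K_ones p r / a ^ p)"
      using finI wa r by (intro member_le_sum[of r I "\<lambda>r. K_ones p r / a ^ p"]) auto
    also have "\<dots> \<le> (\<Sum>p\<le>q. \<Sum>r\<in>I. K_ones p r / a ^ p)"
      using p wa by (intro member_le_sum[of p "{..q}" "\<lambda>p. \<Sum>r\<in>I. K_ones p r / a ^ p"] sum_nonneg) auto
    finally show ?thesis by (simp add: C_def)
  qed
  have "K_ones (q + j) r / a ^ (q + j) \<le> C" if r: "r \<in> I" for j r
  proof (induction j)
    case 0 show ?case using small[OF r, of q] by simp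
  next
    case (Suc j)
    have "K_ones (Suc (q + j)) r \<le> cw_bound (q + j) * K_ones (q + j) r" by (rule K_ones_le[OF r])
    also have "\<dots> \<le> a * K_ones (q + j) r" using q[of "q + j"] K_ones_pos[OF r, of "q + j"] by (intro mult_right_mono) auto
    finally have "K_ones (Suc (q + j)) r / a ^ Suc (q + j) \<le> a * K_ones (q + j) r / a ^ Suc (q + j)"
      using a0 by (intro divide_right_mono) auto
    also have "\<dots> = K_ones (q + j) r / a ^ (q + j)" using a0 by simp
    finally show ?case using Suc by simp
  qed
  note large = this
  have "K_ones p r / a ^ p \<le> C" if r: "r \<in> I" for p r
  proof (cases "p \<le> q")
    case True then show ?thesis using small[OF r] by blast
  next
    case False
    then have "q + (p - q) = p" by simp
    then show ?thesis using large[OF r, of "p - q"] by metis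
  qed
  then have "K_ones p r \<le> C * a ^ p" if "r \<in> I" for p r using that a0 by (simp add: divide_le_eq)
  then show thesis using that C0 by blast
qed

end

section \<open>The spectral radius over an index set\<close>

text \<open>The numbering of the index set in the definition of the spectral radius is only a reindexing of
  sums, so eigenvectors can be read as functions on the index set.\<close>

lemma
  fixes M :: "'a \<Rightarrow> 'a \<Rightarrow> real"
  assumes fin: "finite I" and ne: "I \<noteq> {}"
  shows eigenvalue_le_spectral_radius_on:
      "(\<And>r. r \<in> I \<Longrightarrow> (\<Sum>c\<in>I. complex_of_real (M r c) * x c) = \<mu> * x r) \<Longrightarrow> \<exists>r\<in>I. x r \<noteq> 0
        \<Longrightarrow> norm \<mu> \<le> spectral_radius_on I M"
    and spectral_radius_on_attained:
      "\<exists>\<mu> x. norm \<mu> = spectral_radius_on I M \<and> (\<exists>r\<in>I. x r \<noteq> 0)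
        \<and> (\<forall>r\<in>I. (\<Sum>c\<in>I. complex_of_real (M r c) * x c) = \<mu> * x r)"
proof -
  define k where "k = card I"
  define ix where "ix = from_nat_into I"
  define A where "A = mat k k (\<lambda>(i, j). complex_of_real (M (ix i) (ix j)))"
  have A: "A \<in> carrier_mat k k" by (simp add: A_def)
  have k: "0 < k" using fin ne by (simp add: k_def card_gt_0_iff)
  have bij: "bij_betw ix {..<k} I" unfolding ix_def k_def by (rule bij_betw_from_nat_into_finite[OF fin])
  have sr: "spectral_radius_on I M = spectral_radius A" by (simp add: spectral_radius_on_def A_def k_def ix_def)
  have app: "(A *\<^sub>v v) $ i = (\<Sum>c\<in>I. complex_of_real (M (ix i) c) * x c)"
    if i: "i < k" and v: "v \<in> carrier_vec k" "\<And>j. j < k \<Longrightarrow> v $ j = x (ix j)" for v i x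
  proof -
    have "(A *\<^sub>v v) $ i = (\<Sum>j\<in>{0..<k}. A $$ (i, j) * v $ j)"
      using A i v(1) by (simp add: scalar_prod_def)
    also have "\<dots> = (\<Sum>j\<in>{..<k}. complex_of_real (M (ix i) (ix j)) * x (ix j))"
      using i v(2) by (intro sum.cong) (auto simp: A_def)
    also have "\<dots> = (\<Sum>c\<in>I. complex_of_real (M (ix i) c) * x c)"
      by (rule sum.reindex_bij_betw[OF bij])
    finally show ?thesis .
  qed
  show "norm \<mu> \<le> spectral_radius_on I M"
    if eig: "\<And>r. r \<in> I \<Longrightarrow> (\<Sum>c\<in>I. complex_of_real (M r c) * x c) = \<mu> * x r" and nz: "\<exists>r\<in>I. x r \<noteq> 0"
    for x \<mu>
  proof -
    define v where "v = vec k (\<lambda>j. x (ix j))"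
    have v: "v \<in> carrier_vec k" "\<And>j. j < k \<Longrightarrow> v $ j = x (ix j)" by (simp_all add: v_def)
    obtain r where r: "r \<in> I" "x r \<noteq> 0" using nz by blast
    obtain j where j: "j < k" "ix j = r" using bij r(1) by (auto simp: bij_betw_def image_iff)
    have "v \<noteq> 0\<^sub>v k" using v(2)[OF j(1)] j r(2) by auto
    moreover have "A *\<^sub>v v = \<mu> \<cdot>\<^sub>v v"
    proof (rule eq_vecI)
      show "dim_vec (A *\<^sub>v v) = dim_vec (\<mu> \<cdot>\<^sub>v v)" using A v(1) by simp
      fix i assume "i < dim_vec (\<mu> \<cdot>\<^sub>v v)"
      then have i: "i < k" using v(1) by simp
      have "ix i \<in> I" using bij i by (auto simp: bij_betw_def)
      then show "(A *\<^sub>v v) $ i = (\<mu> \<cdot>\<^sub>v v) $ i" using app[OF i v] eig v i by simp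
    qed
    ultimately have "eigenvector A v \<mu>" using A v(1) by (simp add: eigenvector_def)
    then have "\<mu> \<in> spectrum A" by (auto simp: spectrum_def eigenvalue_def)
    then show ?thesis unfolding sr using spectral_radius_mem_max(2)[OF A k] by blast
  qed
  show "\<exists>\<mu> x. norm \<mu> = spectral_radius_on I M \<and> (\<exists>r\<in>I. x r \<noteq> 0)
        \<and> (\<forall>r\<in>I. (\<Sum>c\<in>I. complex_of_real (M r c) * x c) = \<mu> * x r)"
  proof -
    obtain \<mu> where \<mu>: "norm \<mu> = spectral_radius A" "\<mu> \<in> spectrum A"
      using spectral_radius_mem_max(1)[OF A k] by (metis imageE)
    then obtain v where v: "v \<in> carrier_vec k" "v \<noteq> 0\<^sub>v k" "A *\<^sub>v v = \<mu> \<cdot>\<^sub>v v"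
      using A by (auto simp: spectrum_def eigenvalue_def eigenvector_def)
    define x where "x c = v $ inv_into {..<k} ix c" for c
    have x: "v $ j = x (ix j)" if "j < k" for j
      using bij_betw_inv_into_left[OF bij, of j] that by (simp add: x_def)
    obtain j where j: "j < k" "v $ j \<noteq> 0" using v(1,2) by (metis carrier_vecD eq_vecI index_zero_vec)
    have "ix j \<in> I" using bij j(1) by (auto simp: bij_betw_def)
    then have "\<exists>r\<in>I. x r \<noteq> 0" using x[OF j(1)] j(2) by auto
    moreover have "(\<Sum>c\<in>I. complex_of_real (M r c) * x c) = \<mu> * x r" if r: "r \<in> I" for r
    proof -
      obtain i where i: "i < k" "ix i = r" using bij r by (auto simp: bij_betw_def image_iff)
      have "(A *\<^sub>v v) $ i = (\<mu> \<cdot>\<^sub>v v) $ i" using v(3) by simp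
      then show ?thesis using app[OF i(1) v(1) x] i x[OF i(1)] v(1) by simp
    qed
    ultimately show ?thesis unfolding sr using \<mu>(1) by blast
  qed
qed

section \<open>Symmetries and the compressed matrix\<close>

locale torus_layer =
  fixes m n :: nat
  assumes m2: "2 \<le> m" and n2: "2 \<le> n"
begin

abbreviation G where "G \<equiv> VG m n"
abbreviation L where "L \<equiv> layer m n"
abbreviation T where "T \<equiv> T_mat m n"

lemma carrier_G: "carrier G = L" using carrier_VG[OF m2 n2] .

lemma finite_L: "finite L" by (simp add: layer_def)

lemma card_L: "card L = m * n" by (simp add: layer_def card_cartesian_product)

sublocale G: comm_group G
proof (rule group.group_comm_groupI)
  show "group G" by (rule DirProd_group[OF group_integer_mod_group group_integer_mod_group])
  fix x y show "x \<otimes>\<^bsub>G\<^esub> y = y \<otimes>\<^bsub>G\<^esub> x" by (cases x; cases y) (simp add: add.commute)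
qed

context
  notes carrier_DirProd [simp del] mult_DirProd [simp del] one_DirProd [simp del] inv_DirProd [simp del]
begin

lemma D_sub: "D_steps \<subseteq> carrier G"
  using m2 n2 unfolding carrier_G by (auto simp: D_steps_def layer_def)

lemma K_facts:
  assumes "\<phi> \<in> K_grp m n"
  shows "\<And>x. x \<in> carrier G \<Longrightarrow> \<phi> x \<in> carrier G"
    and "\<And>x y. x \<in> carrier G \<Longrightarrow> y \<in> carrier G \<Longrightarrow> \<phi> (x \<otimes>\<^bsub>G\<^esub> y) = \<phi> x \<otimes>\<^bsub>G\<^esub> \<phi> y"
    and "bij_betw \<phi> (carrier G) (carrier G)"
    and "\<And>x. x \<in> carrier G \<Longrightarrow> \<phi> (inv\<^bsub>G\<^esub> x) = inv\<^bsub>G\<^esub> \<phi> x"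
proof -
  have h: "\<phi> \<in> hom G G" and b: "bij_betw \<phi> (carrier G) (carrier G)"
    using assms unfolding K_grp_def auto_def Bij_def by blast+
  show "\<phi> x \<in> carrier G" if "x \<in> carrier G" for x using hom_in_carrier[OF h that] .
  show "\<phi> (x \<otimes>\<^bsub>G\<^esub> y) = \<phi> x \<otimes>\<^bsub>G\<^esub> \<phi> y" if "x \<in> carrier G" "y \<in> carrier G" for x y
    using hom_mult[OF h that] .
  show "bij_betw \<phi> (carrier G) (carrier G)" by fact
  interpret group_hom G G \<phi> by (intro group_hom.intro group_hom_axioms.intro G.is_group h)
  show "\<phi> (inv\<^bsub>G\<^esub> x) = inv\<^bsub>G\<^esub> \<phi> x" if "x \<in> carrier G" for x using hom_inv[OF that] .
qed

lemma K_translate: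
  assumes "\<phi> \<in> K_grp m n"
  obtains t where "t \<in> carrier G" "\<phi> ` D_steps = (\<lambda>d. t \<otimes>\<^bsub>G\<^esub> d) ` D_steps"
proof -
  obtain t where t: "t \<in> carrier G" "\<phi> ` D_steps = t <#\<^bsub>G\<^esub> D_steps"
    using assms unfolding K_grp_def by blast
  have "t <#\<^bsub>G\<^esub> D_steps = (\<lambda>d. t \<otimes>\<^bsub>G\<^esub> d) ` D_steps" unfolding l_coset_def by blast
  then show thesis using t that by simp
qed

lemma K_memI:
  assumes "\<phi> \<in> auto G" "t \<in> carrier G" "\<phi> ` D_steps = (\<lambda>d. t \<otimes>\<^bsub>G\<^esub> d) ` D_steps"
  shows "\<phi> \<in> K_grp m n"
proof -
  have "t <#\<^bsub>G\<^esub> D_steps = (\<lambda>d. t \<otimes>\<^bsub>G\<^esub> d) ` D_steps" unfolding l_coset_def by blast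
  then show ?thesis using assms unfolding K_grp_def by auto
qed

lemma K_auto: "\<phi> \<in> K_grp m n \<Longrightarrow> \<phi> \<in> auto G" by (simp add: K_grp_def)

lemma K_id: "(\<lambda>v\<in>carrier G. v) \<in> K_grp m n"
proof (rule K_memI[OF G.id_in_auto G.one_closed], rule image_cong[OF refl])
  fix d assume "d \<in> D_steps"
  then have "d \<in> carrier G" using D_sub by blast
  then show "(\<lambda>v\<in>carrier G. v) d = \<one>\<^bsub>G\<^esub> \<otimes>\<^bsub>G\<^esub> d" by simp
qed

lemma K_compose:
  assumes \<phi>: "\<phi> \<in> K_grp m n" and \<psi>: "\<psi> \<in> K_grp m n"
  shows "compose (carrier G) \<phi> \<psi> \<in> K_grp m n"
proof -
  obtain t where t: "t \<in> carrier G" "\<phi> ` D_steps = (\<lambda>d. t \<otimes>\<^bsub>G\<^esub> d) ` D_steps" by (rule K_translate[OF \<phi>])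
  obtain s where s: "s \<in> carrier G" "\<psi> ` D_steps = (\<lambda>d. s \<otimes>\<^bsub>G\<^esub> d) ` D_steps" by (rule K_translate[OF \<psi>])
  have D: "d \<in> carrier G" if "d \<in> D_steps" for d using D_sub that by blast
  have "compose (carrier G) \<phi> \<psi> ` D_steps = \<phi> ` (\<psi> ` D_steps)"
    unfolding image_image using D by (intro image_cong) (auto simp: compose_def)
  also have "\<dots> = (\<lambda>d. \<phi> s \<otimes>\<^bsub>G\<^esub> \<phi> d) ` D_steps"
    unfolding s(2) image_image using D K_facts(2)[OF \<phi> s(1)] by (intro image_cong) auto
  also have "\<dots> = (\<lambda>x. \<phi> s \<otimes>\<^bsub>G\<^esub> x) ` (\<phi> ` D_steps)" by (simp add: image_image)
  also have "\<dots> = (\<lambda>d. (\<phi> s \<otimes>\<^bsub>G\<^esub> t) \<otimes>\<^bsub>G\<^esub> d) ` D_steps"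
    unfolding t(2) image_image using D t(1) K_facts(1)[OF \<phi> s(1)] by (intro image_cong) (auto simp: G.m_assoc)
  finally have im: "compose (carrier G) \<phi> \<psi> ` D_steps = (\<lambda>d. (\<phi> s \<otimes>\<^bsub>G\<^esub> t) \<otimes>\<^bsub>G\<^esub> d) ` D_steps" .
  have "compose (carrier G) \<phi> \<psi> \<in> auto G"
    using K_auto[OF \<phi>] K_auto[OF \<psi>] unfolding auto_def by (blast intro: G.hom_compose compose_Bij)
  then show ?thesis by (rule K_memI[OF _ _ im]) (use K_facts(1)[OF \<phi> s(1)] t(1) in blast)
qed

lemma K_inverse:
  assumes \<phi>: "\<phi> \<in> K_grp m n"
  shows "restrict (inv_into (carrier G) \<phi>) (carrier G) \<in> K_grp m n"
proof -
  let ?\<chi> = "restrict (inv_into (carrier G) \<phi>) (carrier G)"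
  obtain t where t: "t \<in> carrier G" "\<phi> ` D_steps = (\<lambda>d. t \<otimes>\<^bsub>G\<^esub> d) ` D_steps" by (rule K_translate[OF \<phi>])
  have D: "d \<in> carrier G" if "d \<in> D_steps" for d using D_sub that by blast
  have bij: "\<phi> \<in> Bij (carrier G)" using K_auto[OF \<phi>] by (simp add: auto_def)
  have \<chi>: "?\<chi> \<in> auto G"
    using K_auto[OF \<phi>] G.restrict_inv_into_hom[OF _ bij] restrict_inv_into_Bij[OF bij] unfolding auto_def by blast
  then have \<chi>h: "?\<chi> \<in> hom G G" by (simp add: auto_def)
  have \<chi>\<phi>: "?\<chi> (\<phi> x) = x" if "x \<in> carrier G" for x
    using bij_betw_inv_into_left[OF K_facts(3)[OF \<phi>] that] K_facts(1)[OF \<phi> that] by simp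
  have \<chi>t: "?\<chi> t \<in> carrier G" by (rule hom_in_carrier[OF \<chi>h t(1)])
  have rel: "?\<chi> d = inv\<^bsub>G\<^esub> (?\<chi> t) \<otimes>\<^bsub>G\<^esub> d'" if d: "d \<in> D_steps" "d' \<in> D_steps" "\<phi> d' = t \<otimes>\<^bsub>G\<^esub> d" for d d'
  proof -
    have "d' = ?\<chi> (t \<otimes>\<^bsub>G\<^esub> d)" using \<chi>\<phi>[OF D[OF d(2)]] unfolding d(3) by (rule sym)
    also have "\<dots> = ?\<chi> t \<otimes>\<^bsub>G\<^esub> ?\<chi> d" by (rule hom_mult[OF \<chi>h t(1) D[OF d(1)]])
    finally show ?thesis using \<chi>t hom_in_carrier[OF \<chi>h D[OF d(1)]] by (metis G.inv_closed G.l_inv G.l_one G.m_assoc)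
  qed
  have "?\<chi> ` D_steps = (\<lambda>d. inv\<^bsub>G\<^esub> (?\<chi> t) \<otimes>\<^bsub>G\<^esub> d) ` D_steps"
  proof
    show "?\<chi> ` D_steps \<subseteq> (\<lambda>d. inv\<^bsub>G\<^esub> (?\<chi> t) \<otimes>\<^bsub>G\<^esub> d) ` D_steps"
    proof
      fix x assume "x \<in> ?\<chi> ` D_steps"
      then obtain d where d: "d \<in> D_steps" "x = ?\<chi> d" by blast
      have "t \<otimes>\<^bsub>G\<^esub> d \<in> \<phi> ` D_steps" unfolding t(2) using d(1) by blast
      then obtain d' where d': "d' \<in> D_steps" "\<phi> d' = t \<otimes>\<^bsub>G\<^esub> d" by (metis imageE)
      show "x \<in> (\<lambda>d. inv\<^bsub>G\<^esub> (?\<chi> t) \<otimes>\<^bsub>G\<^esub> d) ` D_steps" unfolding d(2) rel[OF d(1) d'] using d'(1) by blast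
    qed
    show "(\<lambda>d. inv\<^bsub>G\<^esub> (?\<chi> t) \<otimes>\<^bsub>G\<^esub> d) ` D_steps \<subseteq> ?\<chi> ` D_steps"
    proof
      fix x assume "x \<in> (\<lambda>d. inv\<^bsub>G\<^esub> (?\<chi> t) \<otimes>\<^bsub>G\<^esub> d) ` D_steps"
      then obtain d' where d': "d' \<in> D_steps" "x = inv\<^bsub>G\<^esub> (?\<chi> t) \<otimes>\<^bsub>G\<^esub> d'" by blast
      have "\<phi> d' \<in> (\<lambda>d. t \<otimes>\<^bsub>G\<^esub> d) ` D_steps" unfolding t(2)[symmetric] using d'(1) by blast
      then obtain d where d: "d \<in> D_steps" "\<phi> d' = t \<otimes>\<^bsub>G\<^esub> d" by (metis imageE)
      show "x \<in> ?\<chi> ` D_steps" unfolding d'(2) rel[OF d(1) d'(1) d(2), symmetric] using d(1) by blast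
    qed
  qed
  then show ?thesis by (rule K_memI[OF \<chi> G.inv_closed[OF \<chi>t]])
qed

text \<open>The action of the group element \<open>(u, \<phi>)\<close> on vertices.\<close>

definition affine_map :: "int \<times> int \<Rightarrow> (int \<times> int \<Rightarrow> int \<times> int) \<Rightarrow> int \<times> int \<Rightarrow> int \<times> int" where
  "affine_map u \<phi> v = u \<otimes>\<^bsub>G\<^esub> \<phi> v"

lemma orb_eq:
  assumes "U \<subseteq> carrier G"
  shows "orb m n U = {affine_map u \<phi> ` U | u \<phi>. u \<in> carrier G \<and> \<phi> \<in> K_grp m n}"
  unfolding orbit_def G_grp_def act_def affine_map_def using assms by auto

lemma affine_map_bij:
  assumes "u \<in> carrier G" "\<phi> \<in> K_grp m n" shows "bij_betw (affine_map u \<phi>) (carrier G) (carrier G)"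
proof -
  have "bij_betw (\<lambda>x. u \<otimes>\<^bsub>G\<^esub> x) (carrier G) (carrier G)"
  proof (rule bij_betw_byWitness[of _ "\<lambda>x. inv\<^bsub>G\<^esub> u \<otimes>\<^bsub>G\<^esub> x"])
    show "\<forall>a\<in>carrier G. inv\<^bsub>G\<^esub> u \<otimes>\<^bsub>G\<^esub> (u \<otimes>\<^bsub>G\<^esub> a) = a"
      using assms(1) by (metis G.inv_closed G.l_inv G.l_one G.m_assoc)
    show "\<forall>a\<in>carrier G. u \<otimes>\<^bsub>G\<^esub> (inv\<^bsub>G\<^esub> u \<otimes>\<^bsub>G\<^esub> a) = a"
      using assms(1) by (metis G.inv_closed G.r_inv G.l_one G.m_assoc)
  qed (use assms(1) in auto)
  from bij_betw_trans[OF K_facts(3)[OF assms(2)] this] show ?thesis by (simp add: affine_map_def[abs_def] o_def)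
qed

lemma image_fixed: "(\<And>v. v \<in> A \<Longrightarrow> f v = v) \<Longrightarrow> f ` A = A"
  by force

lemma orb_refl: assumes "U \<subseteq> carrier G" shows "U \<in> orb m n U"
proof -
  have "affine_map \<one>\<^bsub>G\<^esub> (\<lambda>v\<in>carrier G. v) v = v" if "v \<in> U" for v
  proof -
    have "v \<in> carrier G" using assms that by blast
    then show ?thesis by (simp add: affine_map_def)
  qed
  from image_fixed[OF this] have "affine_map \<one>\<^bsub>G\<^esub> (\<lambda>v\<in>carrier G. v) ` U = U" .
  then show ?thesis unfolding orb_eq[OF assms] using K_id G.one_closed by (metis (mono_tags, lifting) mem_Collect_eq)
qed

lemma orb_sub: assumes "U \<subseteq> carrier G" "V \<in> orb m n U" shows "V \<subseteq> carrier G \<and> card V = card U"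
proof -
  obtain u \<phi> where u: "u \<in> carrier G" "\<phi> \<in> K_grp m n" "V = affine_map u \<phi> ` U" using assms(2) unfolding orb_eq[OF assms(1)] by blast
  have "inj_on (affine_map u \<phi>) U" using affine_map_bij[OF u(1,2)] assms(1) by (meson bij_betw_def inj_on_subset)
  moreover have "V \<subseteq> carrier G" using bij_betw_imp_surj_on[OF affine_map_bij[OF u(1,2)]] assms(1) u(3) by blast
  ultimately show ?thesis using u(3) by (simp add: card_image)
qed

lemma orb_trans: assumes U: "U \<subseteq> carrier G" and V: "V \<in> orb m n U" and W: "W \<in> orb m n V" shows "W \<in> orb m n U"
proof -
  have Vc: "V \<subseteq> carrier G" using orb_sub[OF U V] by blast
  obtain u \<phi> where u: "u \<in> carrier G" "\<phi> \<in> K_grp m n" "V = affine_map u \<phi> ` U" using V unfolding orb_eq[OF U] by blast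
  obtain w \<psi> where w: "w \<in> carrier G" "\<psi> \<in> K_grp m n" "W = affine_map w \<psi> ` V" using W unfolding orb_eq[OF Vc] by blast
  have "affine_map w \<psi> (affine_map u \<phi> v) = affine_map (w \<otimes>\<^bsub>G\<^esub> \<psi> u) (compose (carrier G) \<psi> \<phi>) v" if "v \<in> U" for v
  proof -
    have v: "v \<in> carrier G" using that U by blast
    note c = K_facts(1)[OF u(2) v]
    show ?thesis using v K_facts(2)[OF w(2) u(1) c] G.m_assoc[OF w(1) K_facts(1)[OF w(2) u(1)] K_facts(1)[OF w(2) c]]
      by (simp add: affine_map_def compose_def)
  qed
  then have "W = affine_map (w \<otimes>\<^bsub>G\<^esub> \<psi> u) (compose (carrier G) \<psi> \<phi>) ` U"
    unfolding w(3) u(3) image_image by (rule image_cong[OF refl])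
  moreover have "w \<otimes>\<^bsub>G\<^esub> \<psi> u \<in> carrier G" by (intro G.m_closed w(1) K_facts(1)[OF w(2) u(1)])
  ultimately show ?thesis unfolding orb_eq[OF U] using K_compose[OF w(2) u(2)] by blast
qed

lemma orb_sym: assumes U: "U \<subseteq> carrier G" and V: "V \<in> orb m n U" shows "U \<in> orb m n V"
proof -
  have Vc: "V \<subseteq> carrier G" using orb_sub[OF U V] by blast
  obtain u \<phi> where u: "u \<in> carrier G" "\<phi> \<in> K_grp m n" "V = affine_map u \<phi> ` U" using V unfolding orb_eq[OF U] by blast
  let ?\<chi> = "restrict (inv_into (carrier G) \<phi>) (carrier G)"
  note \<chi> = K_inverse[OF u(2)]
  have "affine_map (?\<chi> (inv\<^bsub>G\<^esub> u)) ?\<chi> (affine_map u \<phi> v) = v" if "v \<in> U" for v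
  proof -
    have v: "v \<in> carrier G" using that U by blast
    note c = K_facts(1)[OF u(2) v]
    have "affine_map (?\<chi> (inv\<^bsub>G\<^esub> u)) ?\<chi> (affine_map u \<phi> v) = ?\<chi> (inv\<^bsub>G\<^esub> u \<otimes>\<^bsub>G\<^esub> (u \<otimes>\<^bsub>G\<^esub> \<phi> v))"
      unfolding affine_map_def by (rule K_facts(2)[OF \<chi> G.inv_closed[OF u(1)] G.m_closed[OF u(1) c], symmetric])
    also have "inv\<^bsub>G\<^esub> u \<otimes>\<^bsub>G\<^esub> (u \<otimes>\<^bsub>G\<^esub> \<phi> v) = \<phi> v"
      using u(1) c by (metis G.inv_closed G.l_inv G.l_one G.m_assoc)
    also have "?\<chi> (\<phi> v) = v" using bij_betw_inv_into_left[OF K_facts(3)[OF u(2)] v] c by simp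
    finally show ?thesis .
  qed
  from image_fixed[OF this] have "affine_map (?\<chi> (inv\<^bsub>G\<^esub> u)) ?\<chi> ` V = U" unfolding u(3) image_image .
  then show ?thesis unfolding orb_eq[OF Vc]
    using \<chi> K_facts(1)[OF \<chi> G.inv_closed[OF u(1)]] by (metis (mono_tags, lifting) mem_Collect_eq)
qed

lemma orb_eq_iff:
  assumes "U \<subseteq> L" "V \<subseteq> L" shows "orb m n U = orb m n V \<longleftrightarrow> V \<in> orb m n U"
proof
  have c: "U \<subseteq> carrier G" "V \<subseteq> carrier G" using assms carrier_G by auto
  show "orb m n U = orb m n V \<Longrightarrow> V \<in> orb m n U" using orb_refl[OF c(2)] by blast
  assume V: "V \<in> orb m n U"
  show "orb m n U = orb m n V"
    using orb_trans[OF c(1) V] orb_trans[OF c(2) orb_sym[OF c(1) V]] by blast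
qed

text \<open>An automorphism in the group maps the set of steps to a translate \<open>t + D\<close>, not to \<open>D\<close>.  Hence if the
  rows are moved by \<open>v \<mapsto> u + \<phi> v\<close>, the columns have to be moved by \<open>v \<mapsto> u - t + \<phi> v\<close>.  The second map
  is again a symmetry, so it preserves orbits, which is all that the compression needs.\<close>

lemma T_equivariant:
  assumes U: "U \<subseteq> L" and U': "U' \<in> orb m n U"
  obtains h where "bij_betw h L L" "\<And>V. V \<subseteq> L \<Longrightarrow> h ` V \<in> orb m n V" "\<And>V. V \<subseteq> L \<Longrightarrow> T U' (h ` V) = T U V"
proof -
  have Uc: "U \<subseteq> carrier G" using U carrier_G by simp
  obtain u \<phi> where u: "u \<in> carrier G" "\<phi> \<in> K_grp m n" "U' = affine_map u \<phi> ` U" using U' unfolding orb_eq[OF Uc] by blast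
  obtain t where t: "t \<in> carrier G" "\<phi> ` D_steps = (\<lambda>d. t \<otimes>\<^bsub>G\<^esub> d) ` D_steps" by (rule K_translate[OF u(2)])
  define u' where "u' = inv\<^bsub>G\<^esub> t \<otimes>\<^bsub>G\<^esub> u"
  have u'c: "u' \<in> carrier G" using u t by (simp add: u'_def)
  define g where "g = affine_map u \<phi>"
  define h where "h = affine_map u' \<phi>"
  have g: "bij_betw g L L" and h: "bij_betw h L L"
    using affine_map_bij[OF u(1,2)] affine_map_bij[OF u'c u(2)] carrier_G by (simp_all add: g_def h_def)
  have st: "step m n (g v) (h w) \<longleftrightarrow> step m n v w" if v: "v \<in> L" and w: "w \<in> L" for v w
  proof -
    have vc: "v \<in> carrier G" "w \<in> carrier G" using v w carrier_G by auto
    have gv: "g v \<in> L" "h w \<in> L" using g h v w by (auto simp: bij_betw_apply)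
    note \<phi>v = K_facts(1)[OF u(2) vc(1)] and \<phi>w = K_facts(1)[OF u(2) vc(2)]
    let ?d = "w \<otimes>\<^bsub>G\<^esub> inv\<^bsub>G\<^esub> v"
    have dc: "?d \<in> carrier G" using vc by simp
    have "h w \<otimes>\<^bsub>G\<^esub> inv\<^bsub>G\<^esub> (g v) = inv\<^bsub>G\<^esub> t \<otimes>\<^bsub>G\<^esub> \<phi> ?d"
    proof -
      have perm: "x \<otimes>\<^bsub>G\<^esub> y \<otimes>\<^bsub>G\<^esub> a \<otimes>\<^bsub>G\<^esub> (z \<otimes>\<^bsub>G\<^esub> b) = x \<otimes>\<^bsub>G\<^esub> (a \<otimes>\<^bsub>G\<^esub> b) \<otimes>\<^bsub>G\<^esub> (y \<otimes>\<^bsub>G\<^esub> z)"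
        if "x \<in> carrier G" "y \<in> carrier G" "a \<in> carrier G" "z \<in> carrier G" "b \<in> carrier G" for x y a z b
        using that by (simp add: G.m_ac)
      have "h w \<otimes>\<^bsub>G\<^esub> inv\<^bsub>G\<^esub> (g v) = (inv\<^bsub>G\<^esub> t \<otimes>\<^bsub>G\<^esub> u \<otimes>\<^bsub>G\<^esub> \<phi> w) \<otimes>\<^bsub>G\<^esub> (inv\<^bsub>G\<^esub> u \<otimes>\<^bsub>G\<^esub> inv\<^bsub>G\<^esub> (\<phi> v))"
        unfolding g_def h_def affine_map_def u'_def using G.inv_mult[OF u(1) \<phi>v] by simp
      also have "\<dots> = inv\<^bsub>G\<^esub> t \<otimes>\<^bsub>G\<^esub> (\<phi> w \<otimes>\<^bsub>G\<^esub> inv\<^bsub>G\<^esub> (\<phi> v)) \<otimes>\<^bsub>G\<^esub> (u \<otimes>\<^bsub>G\<^esub> inv\<^bsub>G\<^esub> u)"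
        by (rule perm) (use t(1) u(1) \<phi>v \<phi>w in simp_all)
      also have "\<dots> = inv\<^bsub>G\<^esub> t \<otimes>\<^bsub>G\<^esub> (\<phi> w \<otimes>\<^bsub>G\<^esub> inv\<^bsub>G\<^esub> (\<phi> v))"
        using t(1) u(1) \<phi>v \<phi>w by simp
      also have "\<phi> w \<otimes>\<^bsub>G\<^esub> inv\<^bsub>G\<^esub> (\<phi> v) = \<phi> ?d"
        using K_facts(2)[OF u(2) vc(2) G.inv_closed[OF vc(1)]] K_facts(4)[OF u(2) vc(1)] by simp
      finally show ?thesis .
    qed
    moreover have "inv\<^bsub>G\<^esub> t \<otimes>\<^bsub>G\<^esub> \<phi> ?d \<in> D_steps \<longleftrightarrow> ?d \<in> D_steps"
    proof
      assume "?d \<in> D_steps"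
      then have "\<phi> ?d \<in> (\<lambda>d. t \<otimes>\<^bsub>G\<^esub> d) ` D_steps" unfolding t(2)[symmetric] by (rule imageI)
      then obtain d where d: "\<phi> ?d = t \<otimes>\<^bsub>G\<^esub> d" "d \<in> D_steps" by (rule imageE)
      have "d \<in> carrier G" by (rule subsetD[OF D_sub d(2)])
      then have "inv\<^bsub>G\<^esub> t \<otimes>\<^bsub>G\<^esub> \<phi> ?d = d"
        unfolding d(1) using t(1) by (metis G.inv_closed G.l_inv G.l_one G.m_assoc)
      then show "inv\<^bsub>G\<^esub> t \<otimes>\<^bsub>G\<^esub> \<phi> ?d \<in> D_steps" using d(2) by simp
    next
      assume a: "inv\<^bsub>G\<^esub> t \<otimes>\<^bsub>G\<^esub> \<phi> ?d \<in> D_steps"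
      have "t \<otimes>\<^bsub>G\<^esub> (inv\<^bsub>G\<^esub> t \<otimes>\<^bsub>G\<^esub> \<phi> ?d) = \<phi> ?d"
        using t(1) K_facts(1)[OF u(2) dc] by (metis G.inv_closed G.r_inv G.l_one G.m_assoc)
      then have "\<phi> ?d \<in> \<phi> ` D_steps" unfolding t(2) by (rule image_eqI[OF sym a])
      then obtain d where d: "d \<in> D_steps" "\<phi> ?d = \<phi> d" by blast
      have "?d = d"
        by (rule inj_onD[OF bij_betw_imp_inj_on[OF K_facts(3)[OF u(2)]] d(2) dc subsetD[OF D_sub d(1)]])
      then show "?d \<in> D_steps" using d(1) by simp
    qed
    ultimately have "A_mat m n (g v) (h w) = A_mat m n v w" by (simp add: A_mat_def)
    then show ?thesis unfolding A_mat_eq[OF m2 n2 gv] A_mat_eq[OF m2 n2 v w] by (auto split: if_splits)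
  qed
  show thesis
  proof
    show "bij_betw h L L" by fact
    show "h ` V \<in> orb m n V" if "V \<subseteq> L" for V
    proof -
      have V: "V \<subseteq> carrier G" using that carrier_G by simp
      show ?thesis unfolding h_def orb_eq[OF V] using u'c u(2) by blast
    qed
    fix V assume V: "V \<subseteq> L"
    have gU: "bij_betw g U U'" by (rule bij_betw_subset[OF g U]) (simp add: g_def u(3))
    have hV: "bij_betw h (L - V) (L - h ` V)"
    proof -
      have "h ` (L - V) = L - h ` V"
        using inj_on_image_set_diff[OF bij_betw_imp_inj_on[OF h] Diff_subset V] bij_betw_imp_surj_on[OF h] V
        by (simp add: Diff_subset)
      then show ?thesis by (rule bij_betw_subset[OF h Diff_subset])
    qed
    have gUL: "U' \<subseteq> L" and hVL: "h ` V \<subseteq> L"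
      using bij_betw_imp_surj_on[OF g] bij_betw_imp_surj_on[OF h] U V u(3) unfolding g_def by blast+
    have fin: "finite U" "finite U'" "finite (L - V)" "finite (L - h ` V)"
      using finite_L U gUL by (auto intro: finite_subset)
    have "card (bip_matchings U (L - V) (step m n)) \<le> card (bip_matchings U' (L - h ` V) (step m n))"
      using st U by (intro card_bip_matchings_mono[OF fin(2,4) gU hV]) auto
    moreover have "card (bip_matchings U' (L - h ` V) (step m n)) \<le> card (bip_matchings U (L - V) (step m n))"
    proof (rule card_bip_matchings_mono[OF fin(1,3) bij_betw_inv_into[OF gU] bij_betw_inv_into[OF hV]])
      fix a b assume a: "a \<in> U'" and b: "b \<in> L - h ` V" and ab: "step m n a b"
      let ?a = "inv_into U g a" and ?b = "inv_into (L - V) h b"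
      have "?a \<in> U" "g ?a = a" "?b \<in> L - V" "h ?b = b"
        using bij_betw_apply[OF bij_betw_inv_into[OF gU] a] bij_betw_inv_into_right[OF gU a]
          bij_betw_apply[OF bij_betw_inv_into[OF hV] b] bij_betw_inv_into_right[OF hV b] by auto
      then show "step m n ?a ?b" using st[of ?a ?b] U ab by auto
    qed
    ultimately show "T U' (h ` V) = T U V"
      using T_mat_eq_card[OF m2 n2 gUL hVL] T_mat_eq_card[OF m2 n2 U V] by simp
  qed
qed

lemma Orbs_eq: "Orbs m n = orb m n ` Pow L"
  unfolding Orbs_def orbits_def carrier_G[symmetric] by auto

lemma finite_Orbs: "finite (Orbs m n)" unfolding Orbs_eq using finite_L by simp

lemma Orb_fiber: assumes U: "U \<subseteq> L" shows "{V \<in> Pow L. orb m n V = orb m n U} = orb m n U"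
proof -
  have "V \<subseteq> L \<and> orb m n V = orb m n U \<longleftrightarrow> V \<in> orb m n U" for V
  proof
    show "V \<in> orb m n U" if "V \<subseteq> L \<and> orb m n V = orb m n U"
      using that orb_eq_iff[OF U, of V] by simp
    show "V \<subseteq> L \<and> orb m n V = orb m n U" if "V \<in> orb m n U"
      using that orb_sub[of U V] orb_eq_iff[OF U, of V] U carrier_G by simp
  qed
  then show ?thesis by simp
qed

text \<open>The entry of the compressed matrix does not depend on the representative of the row: the symmetry
  of the columns that compensates a change of the row permutes the orbit that is summed over.\<close>

lemma T_hat_eq:
  assumes U: "U \<subseteq> L" and W: "W \<subseteq> L"
  shows "T_hat m n (orb m n U) (orb m n W) = (\<Sum>V\<in>orb m n W. T U V)"
proof -
  define U' where "U' = (SOME V. V \<in> orb m n U)"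
  have U': "U' \<in> orb m n U" unfolding U'_def by (rule someI[of _ U]) (use U orb_refl carrier_G in auto)
  obtain h where h: "bij_betw h L L" "\<And>V. V \<subseteq> L \<Longrightarrow> h ` V \<in> orb m n V" "\<And>V. V \<subseteq> L \<Longrightarrow> T U' (h ` V) = T U V"
    by (rule T_equivariant[OF U U']) blast
  have sub: "V \<subseteq> L" if "V \<in> orb m n W" for V using orb_sub[of W V] that W carrier_G by simp
  have fin: "finite (orb m n W)" by (rule finite_subset[of _ "Pow L"]) (use sub finite_L in auto)
  have "inj_on ((`) h) (orb m n W)"
    by (rule inj_on_subset[OF inj_on_image_Pow[of h L]]) (use h(1) sub in \<open>auto simp: bij_betw_def\<close>)
  moreover have "(`) h ` orb m n W \<subseteq> orb m n W"
    using h(2) sub orb_trans[of W] W carrier_G by auto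
  ultimately have "bij_betw ((`) h) (orb m n W) (orb m n W)"
    using fin by (simp add: bij_betw_def endo_inj_surj)
  then have "(\<Sum>V\<in>orb m n W. T U' V) = (\<Sum>V\<in>orb m n W. T U' (h ` V))"
    by (rule sum.reindex_bij_betw[symmetric])
  also have "\<dots> = (\<Sum>V\<in>orb m n W. T U V)" using h(3) sub by (intro sum.cong) auto
  finally show ?thesis unfolding T_hat_def U'_def by simp
qed

text \<open>The transfer matrix acts on functions that are constant on orbits, and there it is the compressed
  matrix.\<close>

lemma sum_orbits:
  fixes f :: "(int \<times> int) set set \<Rightarrow> real"
  assumes U: "U \<subseteq> L"
  shows "(\<Sum>\<O>\<in>Orbs m n. T_hat m n (orb m n U) \<O> * f \<O>) = T_op m n (\<lambda>V. f (orb m n V)) U"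
proof -
  have "(\<Sum>\<O>\<in>Orbs m n. T_hat m n (orb m n U) \<O> * f \<O>)
      = (\<Sum>\<O>\<in>Orbs m n. \<Sum>V\<in>{V \<in> Pow L. orb m n V = \<O>}. T U V * f (orb m n V))"
  proof (rule sum.cong[OF refl])
    fix \<O> assume "\<O> \<in> Orbs m n"
    then obtain W where W: "W \<subseteq> L" "\<O> = orb m n W" unfolding Orbs_eq by auto
    show "T_hat m n (orb m n U) \<O> * f \<O> = (\<Sum>V\<in>{V \<in> Pow L. orb m n V = \<O>}. T U V * f (orb m n V))"
      unfolding W(2) T_hat_eq[OF U W(1)] sum_distrib_right
      by (rule sum.cong) (use Orb_fiber[OF W(1)] in auto)
  qed
  also have "\<dots> = (\<Sum>V\<in>Pow L. T U V * f (orb m n V))"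
    using finite_L finite_Orbs by (intro sum.group) (auto simp: Orbs_eq)
  finally show ?thesis by (simp add: T_op_def)
qed

end

section \<open>Sectors\<close>

lemma S_minus_eq: "S_minus m n i = orb m n ` {U. U \<subseteq> L \<and> card U = i}"
  unfolding S_minus_def carrier_G by blast

lemma S_plus_eq: "S_plus m n i = orb m n ` {U. U \<subseteq> L \<and> card U = m * n - i}"
  unfolding S_plus_def carrier_G by blast

lemma orb_card: "U \<subseteq> L \<Longrightarrow> V \<subseteq> L \<Longrightarrow> orb m n U = orb m n V \<Longrightarrow> card U = card V"
  using orb_eq_iff[of U V] orb_sub[of U V] carrier_G by simp

lemma S_minus_iff: "U \<subseteq> L \<Longrightarrow> orb m n U \<in> S_minus m n i \<longleftrightarrow> card U = i"
proof
  assume U: "U \<subseteq> L"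
  show "orb m n U \<in> S_minus m n i" if "card U = i" using U that unfolding S_minus_eq by blast
  assume "orb m n U \<in> S_minus m n i"
  then obtain V where "V \<subseteq> L" "card V = i" "orb m n U = orb m n V" unfolding S_minus_eq by blast
  then show "card U = i" using orb_card[OF U] by metis
qed

lemma S_plus_iff: "U \<subseteq> L \<Longrightarrow> orb m n U \<in> S_plus m n i \<longleftrightarrow> card U = m * n - i"
proof
  assume U: "U \<subseteq> L"
  show "orb m n U \<in> S_plus m n i" if "card U = m * n - i" using U that unfolding S_plus_eq by blast
  assume "orb m n U \<in> S_plus m n i"
  then obtain V where "V \<subseteq> L" "card V = m * n - i" "orb m n U = orb m n V" unfolding S_plus_eq by blast
  then show "card U = m * n - i" using orb_card[OF U] by metis
qed

lemma S_sub: "S_minus m n i \<subseteq> Orbs m n" "S_plus m n i \<subseteq> Orbs m n"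
  unfolding S_minus_eq S_plus_eq Orbs_eq by auto

lemma finite_S: "finite (S_minus m n i)" "finite (S_plus m n i)"
  by (rule finite_subset[OF S_sub(1) finite_Orbs], rule finite_subset[OF S_sub(2) finite_Orbs])

lemma OrbsE: assumes "\<O> \<in> Orbs m n" obtains U where "U \<subseteq> L" "\<O> = orb m n U"
  using assms unfolding Orbs_eq by auto

lemma card_le: "U \<subseteq> L \<Longrightarrow> card U \<le> m * n"
  using card_mono[OF finite_L, of U] card_L by simp

lemma T_nonneg: "U \<subseteq> L \<Longrightarrow> V \<subseteq> L \<Longrightarrow> 0 \<le> T U V"
  using T_mat_eq_card[OF m2 n2] by simp

lemma T_zero: "card U + card V \<noteq> m * n \<Longrightarrow> T U V = 0"
  by (simp add: T_mat_def)

lemma orb_member: "W \<subseteq> L \<Longrightarrow> V \<in> orb m n W \<Longrightarrow> V \<subseteq> L \<and> card V = card W"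
  using orb_sub[of W V] carrier_G by simp

lemma finite_orb: "W \<subseteq> L \<Longrightarrow> finite (orb m n W)"
  by (rule finite_subset[of _ "Pow L"]) (use orb_member finite_L in auto)

lemma T_hat_nonneg:
  assumes "\<O>1 \<in> Orbs m n" "\<O>2 \<in> Orbs m n" shows "0 \<le> T_hat m n \<O>1 \<O>2"
proof -
  obtain U where U: "U \<subseteq> L" "\<O>1 = orb m n U" by (rule OrbsE[OF assms(1)])
  obtain W where W: "W \<subseteq> L" "\<O>2 = orb m n W" by (rule OrbsE[OF assms(2)])
  show ?thesis unfolding U(2) W(2) T_hat_eq[OF U(1) W(1)]
    using orb_member[OF W(1)] U(1) by (intro sum_nonneg T_nonneg) auto
qed

lemma T_hat_zero:
  assumes "U \<subseteq> L" "W \<subseteq> L" "card U + card W \<noteq> m * n"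
  shows "T_hat m n (orb m n U) (orb m n W) = 0"
  unfolding T_hat_eq[OF assms(1,2)]
  by (rule sum.neutral) (use assms orb_member[OF assms(2)] T_zero in auto)

lemma T_hat_ge:
  assumes "U \<subseteq> L" "W \<subseteq> L" shows "T U W \<le> T_hat m n (orb m n U) (orb m n W)"
  unfolding T_hat_eq[OF assms]
  by (rule member_le_sum) (use assms orb_refl carrier_G finite_orb orb_member T_nonneg in auto)

text \<open>The matrix product of \<open>X\<close> and \<open>Y\<close> on the sector of index \<open>i\<close>.\<close>

definition two_step :: "nat \<Rightarrow> (int \<times> int) set set \<Rightarrow> (int \<times> int) set set \<Rightarrow> real" where
  "two_step i r c = (\<Sum>s\<in>S_plus m n i. T_hat m n r s * T_hat m n s c)"

text \<open>All entries of the compressed matrix outside of the sector vanish, so two steps starting in a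
  sector return to it.\<close>

lemma T_hat_twice:
  fixes x :: "(int \<times> int) set set \<Rightarrow> 'b :: real_field"
  assumes U: "U \<subseteq> L"
  shows "(\<Sum>s\<in>Orbs m n. of_real (T_hat m n (orb m n U) s) * (\<Sum>c\<in>Orbs m n. of_real (T_hat m n s c) * x c))
    = (\<Sum>c\<in>S_minus m n (card U). of_real (two_step (card U) (orb m n U) c) * x c)"
proof -
  let ?i = "card U"
  have i: "?i \<le> m * n" by (rule card_le[OF U])
  have outer: "T_hat m n (orb m n U) s = 0" if s: "s \<in> Orbs m n - S_plus m n ?i" for s
  proof -
    from s obtain V where V: "V \<subseteq> L" "s = orb m n V" by (auto elim: OrbsE)
    then show ?thesis using s T_hat_zero[OF U V(1)] S_plus_iff[OF V(1)] by auto
  qed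
  have inner: "T_hat m n s c = 0" if s: "s \<in> S_plus m n ?i" and c: "c \<in> Orbs m n - S_minus m n ?i" for s c
  proof -
    from s obtain V where V: "V \<subseteq> L" "s = orb m n V" "card V = m * n - ?i" unfolding S_plus_eq by auto
    from c obtain W where W: "W \<subseteq> L" "c = orb m n W" by (auto elim: OrbsE)
    have "card W \<noteq> ?i" using c W S_minus_iff[OF W(1)] by auto
    then show ?thesis using T_hat_zero[OF V(1) W(1)] V W i by auto
  qed
  have "(\<Sum>s\<in>Orbs m n. of_real (T_hat m n (orb m n U) s) * (\<Sum>c\<in>Orbs m n. of_real (T_hat m n s c) * x c))
      = (\<Sum>s\<in>S_plus m n ?i. of_real (T_hat m n (orb m n U) s) * (\<Sum>c\<in>Orbs m n. of_real (T_hat m n s c) * x c))"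
    using outer S_sub finite_Orbs by (intro sum.mono_neutral_right) auto
  also have "\<dots> = (\<Sum>s\<in>S_plus m n ?i. of_real (T_hat m n (orb m n U) s) * (\<Sum>c\<in>S_minus m n ?i. of_real (T_hat m n s c) * x c))"
  proof (rule sum.cong[OF refl])
    fix s assume "s \<in> S_plus m n ?i"
    then have "(\<Sum>c\<in>Orbs m n. of_real (T_hat m n s c) * x c) = (\<Sum>c\<in>S_minus m n ?i. of_real (T_hat m n s c) * x c)"
      using inner S_sub finite_Orbs by (intro sum.mono_neutral_right) auto
    then show "of_real (T_hat m n (orb m n U) s) * (\<Sum>c\<in>Orbs m n. of_real (T_hat m n s c) * x c)
        = of_real (T_hat m n (orb m n U) s) * (\<Sum>c\<in>S_minus m n ?i. of_real (T_hat m n s c) * x c)" by simp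
  qed
  also have "\<dots> = (\<Sum>c\<in>S_minus m n ?i. \<Sum>s\<in>S_plus m n ?i. of_real (T_hat m n (orb m n U) s) * (of_real (T_hat m n s c) * x c))"
    unfolding sum_distrib_left by (rule sum.swap)
  also have "\<dots> = (\<Sum>c\<in>S_minus m n ?i. of_real (two_step ?i (orb m n U) c) * x c)"
    by (simp add: two_step_def sum_distrib_right mult.assoc)
  finally show ?thesis .
qed

text \<open>One particle moves along a step to a free place.\<close>

definition hop :: "(int \<times> int) set \<Rightarrow> (int \<times> int) set \<Rightarrow> bool" where
  "hop U U' \<longleftrightarrow> (\<exists>x\<in>U. \<exists>y\<in>L - U. step m n x y \<and> U' = insert y (U - {x}))"

text \<open>The transfer matrix takes the complement in its second argument, so the entry at \<open>(U, L - V)\<close>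
  counts the ways in which the particles at \<open>U\<close> can jump simultaneously to \<open>V\<close>.\<close>

lemma T_posI:
  assumes U: "U \<subseteq> L" and V: "V \<subseteq> L" and bij: "bij_betw \<sigma> U V" and st: "\<And>u. u \<in> U \<Longrightarrow> step m n u (\<sigma> u)"
  shows "0 < T U (L - V)"
proof -
  have LV: "L - (L - V) = V" using V by blast
  have "bij_betw (restrict \<sigma> U) U V" using bij by (simp cong: bij_betw_cong)
  then have "restrict \<sigma> U \<in> bip_matchings U V (step m n)"
    using st bij_betw_apply[OF bij] by (simp add: bip_matchings_def)
  moreover have "finite (bip_matchings U V (step m n))"
    using finite_L U V by (intro finite_bip_matchings) (auto intro: finite_subset)
  ultimately have "0 < card (bip_matchings U V (step m n))" by (auto simp: card_gt_0_iff)
  then show ?thesis using T_mat_eq_card[OF m2 n2 U, of "L - V"] LV by auto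
qed

lemma step_refl: "u \<in> L \<Longrightarrow> step m n u u"
  unfolding step_def by (intro bexI[of _ "(0, 0)"]) (auto simp: layer_def D_steps_def)

lemma T_stay: "U \<subseteq> L \<Longrightarrow> 0 < T U (L - U)"
  by (rule T_posI[of U U id]) (auto intro: step_refl)

lemma hop_sub:
  assumes "hop U U'" "U \<subseteq> L" shows "U' \<subseteq> L" "card U' = card U"
proof -
  obtain x y where xy: "x \<in> U" "y \<in> L - U" "U' = insert y (U - {x})" using assms(1) by (auto simp: hop_def)
  have "finite U" using assms(2) finite_L by (rule finite_subset)
  then show "card U' = card U" using xy card_Suc_Diff1[of U x] by simp
  show "U' \<subseteq> L" using xy assms(2) by blast
qed

lemma T_hop:
  assumes "hop U U'" "U \<subseteq> L" shows "0 < T U (L - U')"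
proof -
  obtain x y where xy: "x \<in> U" "y \<in> L - U" "step m n x y" "U' = insert y (U - {x})"
    using assms(1) by (auto simp: hop_def)
  show ?thesis
  proof (rule T_posI[OF assms(2) hop_sub(1)[OF assms]])
    show "bij_betw (\<lambda>v. if v = x then y else v) U U'"
      using xy by (auto simp: bij_betw_def inj_on_def)
    show "step m n u (if u = x then y else u)" if "u \<in> U" for u
      using that xy(3) step_refl[OF subsetD[OF assms(2) that]] by simp
  qed
qed

text \<open>A move from \<open>U\<close> to \<open>U'\<close> in the first step can be followed by a second step in which everything stays.\<close>

lemma two_step_pos:
  assumes U: "U \<subseteq> L" and U': "U' \<subseteq> L" and c: "card U = i" "card U' = i" and T: "0 < T U (L - U')"
  shows "0 < two_step i (orb m n U) (orb m n U')"
proof -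
  let ?W = "L - U'" and ?s = "orb m n (L - U')"
  have W: "?W \<subseteq> L" by blast
  have "L - ?W = U'" using U' by blast
  then have T2: "0 < T ?W U'" using T_stay[OF W] by simp
  have "card ?W = m * n - i" using U' c finite_L card_L by (simp add: card_Diff_subset finite_subset)
  then have s: "?s \<in> S_plus m n i" using S_plus_iff[OF W] by simp
  have nn: "0 \<le> T_hat m n (orb m n U) s * T_hat m n s (orb m n U')" if "s \<in> S_plus m n i" for s
  proof -
    have "s \<in> Orbs m n" using that S_sub by blast
    moreover have "orb m n U \<in> Orbs m n" "orb m n U' \<in> Orbs m n" using U U' unfolding Orbs_eq by blast+
    ultimately show ?thesis by (intro mult_nonneg_nonneg T_hat_nonneg)
  qed
  have "0 < T_hat m n (orb m n U) ?s * T_hat m n ?s (orb m n U')"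
    using T T2 T_hat_ge[OF U W] T_hat_ge[OF W U'] by (intro mult_pos_pos) auto
  then show ?thesis unfolding two_step_def using finite_S s nn by (intro sum_pos2[of _ ?s]) auto
qed

text \<open>To bring a particle from \<open>x\<close> to the free place \<open>y\<close> along a path, let \<open>x1\<close> be the next vertex.  If \<open>x1\<close> is
  free, hop there and go on.  If it is occupied, first bring the particle at \<open>x1\<close> to \<open>y\<close>, and then hop
  from \<open>x\<close> to the vacated \<open>x1\<close>; the particles are indistinguishable.\<close>

lemma hop_move:
  assumes "(\<lambda>a b. a \<in> L \<and> b \<in> L \<and> step m n a b)\<^sup>*\<^sup>* x y" "x \<in> U" "y \<in> L - U" "U \<subseteq> L"
  shows "hop\<^sup>*\<^sup>* U (insert y (U - {x}))"
  using assms
proof (induction arbitrary: U rule: converse_rtranclp_induct)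
  case base then show ?case by blast
next
  case (step x x1)
  have xx1: "x \<in> L" "x1 \<in> L" "step m n x x1" using step.hyps(1) by auto
  show ?case
  proof (cases "x1 \<in> U")
    case True
    have IH: "hop\<^sup>*\<^sup>* U (insert y (U - {x1}))" by (rule step.IH[OF True step.prems(2,3)])
    show ?thesis
    proof (cases "x1 = x")
      case True then show ?thesis using IH by simp
    next
      case False
      have "hop (insert y (U - {x1})) (insert y (U - {x}))"
        unfolding hop_def
      proof (intro bexI conjI)
        show "x \<in> insert y (U - {x1})" using False step.prems by blast
        show "x1 \<in> L - insert y (U - {x1})" using True xx1 step.prems by blast
        show "step m n x x1" by fact
        show "insert y (U - {x}) = insert x1 (insert y (U - {x1}) - {x})"
          using True False step.prems by blast
      qed
      then show ?thesis using IH by simp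
    qed
  next
    case False
    let ?U1 = "insert x1 (U - {x})"
    have h: "hop U ?U1" unfolding hop_def using False xx1 step.prems by blast
    show ?thesis
    proof (cases "x1 = y")
      case True then show ?thesis using h by auto
    next
      case F: False
      have "hop\<^sup>*\<^sup>* ?U1 (insert y (?U1 - {x1}))"
        by (rule step.IH) (use F step.prems xx1 in auto)
      moreover have "?U1 - {x1} = U - {x}" using False by blast
      ultimately show ?thesis using h by simp
    qed
  qed
qed

text \<open>The steps are directed, but on a torus one can go around.\<close>

lemma step_connected:
  assumes u: "u \<in> L" and v: "v \<in> L"
  shows "(\<lambda>a b. a \<in> L \<and> b \<in> L \<and> step m n a b)\<^sup>*\<^sup>* u v"
proof -
  let ?S = "\<lambda>a b. a \<in> L \<and> b \<in> L \<and> step m n a b"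
  have inL: "((a + j) mod int m, (b + l) mod int n) \<in> L" for a b j l using m2 n2 by (auto simp: layer_def)
  have 1: "?S ((a + j) mod int m, b mod int n) ((a + (j + 1)) mod int m, b mod int n)" for a b j
    using inL[of a j b 0] inL[of a "j + 1" b 0] unfolding step_def
    by (auto intro!: bexI[of _ "(1, 0)"] simp: D_steps_def mod_simps add.assoc)
  have 2: "?S (a mod int m, (b + j) mod int n) (a mod int m, (b + (j + 1)) mod int n)" for a b j
    using inL[of a 0 b j] inL[of a 0 b "j + 1"] unfolding step_def
    by (auto intro!: bexI[of _ "(0, 1)"] simp: D_steps_def mod_simps add.assoc)
  have A: "?S\<^sup>*\<^sup>* (a mod int m, b mod int n) ((a + int j) mod int m, b mod int n)" for a b j
  proof (induction j)
    case (Suc j)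
    then show ?case using 1[of a "int j" b] by (simp add: rtranclp.rtrancl_into_rtrancl add.commute)
  qed simp
  have B: "?S\<^sup>*\<^sup>* (a mod int m, b mod int n) (a mod int m, (b + int j) mod int n)" for a b j
  proof (induction j)
    case (Suc j)
    then show ?case using 2[of a b "int j"] by (simp add: rtranclp.rtrancl_into_rtrancl add.commute)
  qed simp
  obtain a b c d where ab: "u = (a, b)" and cd: "v = (c, d)" by (cases u, cases v)
  have r: "a mod int m = a" "b mod int n = b" "c mod int m = c" "d mod int n = d"
    using u v by (auto simp: ab cd layer_def)
  have e1: "(a + int (nat ((c - a) mod int m))) mod int m = c"
    using m2 r by (simp add: mod_simps)
  have e2: "(b + int (nat ((d - b) mod int n))) mod int n = d"
    using n2 r by (simp add: mod_simps)
  have "?S\<^sup>*\<^sup>* (a, b) (c, b)" using A[of a b "nat ((c - a) mod int m)"] unfolding e1 r .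
  also have "?S\<^sup>*\<^sup>* (c, b) (c, d)" using B[of c b "nat ((d - b) mod int n)"] unfolding e2 r .
  finally show ?thesis by (simp add: ab cd)
qed

lemma hop_connected:
  assumes "U \<subseteq> L" "U' \<subseteq> L" "card U = card U'" shows "hop\<^sup>*\<^sup>* U U'"
  using assms
proof (induction "card (U - U')" arbitrary: U)
  case 0
  have fin: "finite U" "finite U'" using 0 finite_L by (auto intro: finite_subset)
  then have "U \<subseteq> U'" using 0 by auto
  then have "U = U'" using 0 fin by (intro card_subset_eq) auto
  then show ?case by simp
next
  case (Suc k)
  have fin: "finite U" "finite U'" using Suc.prems finite_L by (auto intro: finite_subset)
  have "U - U' \<noteq> {}"
  proof
    assume "U - U' = {}"
    then have "card (U - U') = 0" by (simp only: card.empty)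
    then show False using Suc(2) by simp
  qed
  then obtain x where x: "x \<in> U" "x \<notin> U'" by blast
  have "card (U' - U) = card (U - U')"
    using fin Suc.prems(3) card_Diff_subset_Int[of U U'] card_Diff_subset_Int[of U' U]
    by (simp add: Int_commute)
  then have "0 < card (U' - U)" using Suc(2) by simp
  then have "U' - U \<noteq> {}" by (metis card.empty less_irrefl)
  then obtain y where y: "y \<in> U'" "y \<notin> U" by blast
  let ?U1 = "insert y (U - {x})"
  have "?U1 - U' = (U - U') - {x}" using y by blast
  then have c: "k = card (?U1 - U')" using Suc(2) x fin by simp
  have "hop\<^sup>*\<^sup>* U ?U1" using x y Suc.prems by (intro hop_move step_connected) auto
  moreover have "hop\<^sup>*\<^sup>* ?U1 U'"
  proof (rule Suc.hyps(1)[OF c])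
    show "?U1 \<subseteq> L" using Suc.prems y by blast
    show "U' \<subseteq> L" by fact
    show "card ?U1 = card U'" using x y fin Suc.prems card_Suc_Diff1[of U x] by simp
  qed
  ultimately show ?case by simp
qed

text \<open>This holds for all \<open>i \<le> m * n\<close>, not only up to one half, which later gives the growth of all
  entries of the powers at once.\<close>

lemma two_step_primitive:
  assumes i: "i \<le> m * n" shows "primitive_kernel (S_minus m n i) (two_step i)"
proof
  show "finite (S_minus m n i)" by (rule finite_S)
  obtain U where U: "U \<subseteq> L" "card U = i" using i card_L by (metis obtain_subset_with_card_n)
  show "S_minus m n i \<noteq> {}" unfolding S_minus_eq using U by blast
  show "0 \<le> two_step i r c" if "r \<in> S_minus m n i" "c \<in> S_minus m n i" for r c
    unfolding two_step_def using that S_sub by (intro sum_nonneg mult_nonneg_nonneg T_hat_nonneg) auto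
  show "0 < two_step i r r" if "r \<in> S_minus m n i" for r
    using that two_step_pos T_stay unfolding S_minus_eq by auto
  fix Z assume Z: "Z \<subseteq> S_minus m n i" "Z \<noteq> {}"
    and cl: "\<And>r c. r \<in> S_minus m n i \<Longrightarrow> c \<in> Z \<Longrightarrow> 0 < two_step i r c \<Longrightarrow> r \<in> Z"
  obtain V where V: "V \<subseteq> L" "card V = i" "orb m n V \<in> Z" using Z unfolding S_minus_eq by blast
  have "U \<subseteq> L \<longrightarrow> card U = i \<longrightarrow> orb m n U \<in> Z" if "hop\<^sup>*\<^sup>* U V" for U
    using that
  proof (induction rule: converse_rtranclp_induct)
    case base then show ?case using V by simp
  next
    case (step U U1)
    show ?case
    proof (intro impI)
      assume U: "U \<subseteq> L" "card U = i"
      note s = hop_sub[OF step.hyps(1) U(1)]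
      have "orb m n U1 \<in> Z" using step.IH s U by simp
      moreover have "0 < two_step i (orb m n U) (orb m n U1)"
        using two_step_pos[OF U(1) s(1) U(2)] s U T_hop[OF step.hyps(1) U(1)] by simp
      moreover have "orb m n U \<in> S_minus m n i" using S_minus_iff[OF U(1)] U(2) by simp
      ultimately show "orb m n U \<in> Z" by (rule_tac cl)
    qed
  qed
  note reach = this
  have "S_minus m n i \<subseteq> Z"
  proof
    fix r assume "r \<in> S_minus m n i"
    then obtain U where U: "U \<subseteq> L" "card U = i" "r = orb m n U" unfolding S_minus_eq by blast
    then show "r \<in> Z" using reach[OF hop_connected[OF U(1) V(1)]] V(2) by simp
  qed
  then show "Z = S_minus m n i" using Z by blast
qed

abbreviation sector_op where "sector_op i \<equiv> primitive_kernel.K_op (S_minus m n i) (two_step i)"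
abbreviation sector_ones where "sector_ones i \<equiv> primitive_kernel.K_ones (S_minus m n i) (two_step i)"
abbreviation sector_bound where "sector_bound i \<equiv> primitive_kernel.cw_bound (S_minus m n i) (two_step i)"
abbreviation sector_value where "sector_value i \<equiv> primitive_kernel.pf_value (S_minus m n i) (two_step i)"

lemma XY_eq: assumes "i \<le> m * n" shows "X_op m n i \<circ> Y_op m n i = sector_op i"
proof (intro ext)
  fix w r
  show "(X_op m n i \<circ> Y_op m n i) w r = sector_op i w r"
  proof (cases "r \<in> S_minus m n i")
    case True
    have "(X_op m n i \<circ> Y_op m n i) w r
        = (\<Sum>s\<in>S_plus m n i. T_hat m n r s * (\<Sum>c\<in>S_minus m n i. T_hat m n s c * w c))"
      using True by (simp add: X_op_def Y_op_def submat_apply_def)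
    also have "\<dots> = (\<Sum>c\<in>S_minus m n i. \<Sum>s\<in>S_plus m n i. T_hat m n r s * (T_hat m n s c * w c))"
      unfolding sum_distrib_left by (rule sum.swap)
    also have "\<dots> = (\<Sum>c\<in>S_minus m n i. two_step i r c * w c)"
      by (simp add: two_step_def sum_distrib_right mult.assoc)
    finally show ?thesis using True by (simp add: primitive_kernel.K_op_def[OF two_step_primitive[OF assms]])
  next
    case False
    then show ?thesis by (simp add: X_op_def submat_apply_def primitive_kernel.K_op_def[OF two_step_primitive[OF assms]])
  qed
qed

lemma C_seq_eq: assumes "i \<le> m * n" shows "C_seq m n i p = 1 / (2 * real m * real n) * ln (sector_bound i p)"
  unfolding C_seq_def XY_eq[OF assms] primitive_kernel.cw_bound_def[OF two_step_primitive[OF assms]]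
    primitive_kernel.K_ones_def[OF two_step_primitive[OF assms]] ones_def by simp

section \<open>Spectral radius, growth and the dimer constant\<close>

abbreviation \<rho> where "\<rho> \<equiv> spectral_radius_on (Orbs m n) (T_hat m n)"

lemma Orbs_ne: "Orbs m n \<noteq> {}" unfolding Orbs_eq by blast

text \<open>With \<open>v\<close> the Perron--Frobenius eigenvector of the sector, extended by zero, and \<open>s\<close> the square root of
  its eigenvalue, \<open>s v\<close> plus the image of \<open>v\<close> is an eigenvector for \<open>s\<close>.  It is not zero, since no
  cancellation can occur; this covers the case in which the two halves of the sector coincide.\<close>

lemma sqrt_sector_value_le_rho:
  assumes i: "i \<le> m * n" shows "sqrt (sector_value i) \<le> \<rho>"
proof -
  interpret P: primitive_kernel "S_minus m n i" "two_step i" by (rule two_step_primitive[OF i])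
  obtain v where v: "\<And>r. r \<in> S_minus m n i \<Longrightarrow> 0 \<le> v r" "\<exists>r\<in>S_minus m n i. 0 < v r"
    "\<And>r. r \<in> S_minus m n i \<Longrightarrow> sector_op i v r = sector_value i * v r" using P.pf_eigenvector by blast
  define v0 where "v0 r = (if r \<in> S_minus m n i then v r else 0)" for r
  define h where "h w r = (\<Sum>c\<in>Orbs m n. T_hat m n r c * w c)" for w :: "_ \<Rightarrow> real" and r
  have hh: "h (h v0) r = sector_value i * v0 r" if r: "r \<in> Orbs m n" for r
  proof -
    obtain U where U: "U \<subseteq> L" "r = orb m n U" by (rule OrbsE[OF r])
    have e: "h (h v0) r = (\<Sum>c\<in>S_minus m n (card U). two_step (card U) r c * v0 c)"
      using T_hat_twice[OF U(1), of v0] unfolding h_def U(2) of_real_eq_id id_apply .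
    show ?thesis
    proof (cases "card U = i")
      case True
      then have rS: "r \<in> S_minus m n i" using S_minus_iff[OF U(1)] U(2) by simp
      have v0: "v0 c = v c" if "c \<in> S_minus m n i" for c using that by (simp add: v0_def)
      have "h (h v0) r = (\<Sum>c\<in>S_minus m n i. two_step i r c * v0 c)" using e True by simp
      also have "\<dots> = (\<Sum>c\<in>S_minus m n i. two_step i r c * v c)" by (rule sum.cong) (simp_all add: v0)
      also have "\<dots> = sector_op i v r" unfolding P.K_op_def using rS by (rule if_P[symmetric])
      also have "\<dots> = sector_value i * v0 r" unfolding v0[OF rS] by (rule v(3)[OF rS])
      finally show ?thesis .
    next
      case False
      have "c \<notin> S_minus m n i" if c: "c \<in> S_minus m n (card U)" for c
      proof -
        obtain W where W: "W \<subseteq> L" "card W = card U" "c = orb m n W" using c unfolding S_minus_eq by blast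
        show ?thesis unfolding W(3) S_minus_iff[OF W(1)] W(2) using False .
      qed
      then have "h (h v0) r = 0" unfolding e by (intro sum.neutral) (simp add: v0_def)
      moreover have "r \<notin> S_minus m n i" using False S_minus_iff[OF U(1)] U(2) by simp
      ultimately show ?thesis by (simp add: v0_def)
    qed
  qed
  define s where "s = sqrt (sector_value i)"
  have s: "0 < s" "s * s = sector_value i" using P.pf_value_pos by (simp_all add: s_def)
  \<comment> \<open>an eigenvector of the whole matrix for the eigenvalue \<open>s\<close>\<close>
  define x where "x r = s * v0 r + h v0 r" for r
  have hx: "h x r = s * x r" if r: "r \<in> Orbs m n" for r
  proof -
    have "h x r = (\<Sum>c\<in>Orbs m n. s * (T_hat m n r c * v0 c) + T_hat m n r c * h v0 c)"
      unfolding h_def[of x r] by (rule sum.cong) (simp_all add: x_def algebra_simps)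
    also have "\<dots> = s * h v0 r + h (h v0) r"
      by (simp add: sum.distrib sum_distrib_left h_def[of v0 r] h_def[of "h v0" r])
    finally have "h x r = s * h v0 r + h (h v0) r" .
    then show ?thesis using hh[OF r] s(2) by (simp add: x_def distrib_left mult.assoc[symmetric])
  qed
  have nz: "\<exists>r\<in>Orbs m n. complex_of_real (x r) \<noteq> 0"
  proof -
    obtain r where r: "r \<in> S_minus m n i" "0 < v r" using v(2) by blast
    have rO: "r \<in> Orbs m n" using r(1) S_sub by blast
    have "0 \<le> h v0 r" unfolding h_def
      using v(1) S_sub by (intro sum_nonneg mult_nonneg_nonneg T_hat_nonneg rO) (auto simp: v0_def)
    moreover have "0 < s * v0 r" using r s by (simp add: v0_def)
    ultimately have "0 < x r" by (simp add: x_def)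
    then show ?thesis using rO by (intro bexI[of _ r]) auto
  qed
  have "norm (complex_of_real s) \<le> \<rho>"
  proof (rule eigenvalue_le_spectral_radius_on[OF finite_Orbs Orbs_ne _ nz])
    fix r assume r: "r \<in> Orbs m n"
    have "(\<Sum>c\<in>Orbs m n. complex_of_real (T_hat m n r c) * complex_of_real (x c)) = complex_of_real (h x r)"
      by (simp add: h_def)
    then show "(\<Sum>c\<in>Orbs m n. complex_of_real (T_hat m n r c) * complex_of_real (x c))
        = complex_of_real s * complex_of_real (x r)" using hx[OF r] by simp
  qed
  then show ?thesis using s by (simp add: s_def)
qed

lemma rho_pos: "0 < \<rho>"
proof -
  interpret P: primitive_kernel "S_minus m n 0" "two_step 0" by (rule two_step_primitive) simp
  have "0 < sqrt (sector_value 0)" using P.pf_value_pos by simp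
  then show ?thesis by (rule less_le_trans) (rule sqrt_sector_value_le_rho, simp)
qed

text \<open>An eigenvector for an eigenvalue of maximal modulus is nonzero at some orbit.  If the size of that
  orbit exceeds \<open>m * n div 2\<close>, then, as the eigenvalue is not zero, the eigenvector is also nonzero at
  an orbit of complementary size.  Its restriction to the corresponding sector is an eigenvector of
  two steps.\<close>

lemma rho_attained: "\<exists>i\<le>m * n div 2. \<rho>\<^sup>2 \<le> sector_value i"
proof -
  obtain \<mu> x where \<mu>: "norm \<mu> = \<rho>" and nz: "\<exists>r\<in>Orbs m n. x r \<noteq> 0"
    and eig: "\<And>r. r \<in> Orbs m n \<Longrightarrow> (\<Sum>c\<in>Orbs m n. complex_of_real (T_hat m n r c) * x c) = \<mu> * x r"
    using spectral_radius_on_attained[OF finite_Orbs Orbs_ne] by blast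
  obtain r where r: "r \<in> Orbs m n" "x r \<noteq> 0" using nz by blast
  obtain U where U: "U \<subseteq> L" "r = orb m n U" by (rule OrbsE[OF r(1)])
  have "\<exists>V\<subseteq>L. card V \<le> m * n div 2 \<and> x (orb m n V) \<noteq> 0"
  proof (cases "card U \<le> m * n div 2")
    case True then show ?thesis using U r by blast
  next
    case False
    have "\<mu> * x r \<noteq> 0" using r(2) \<mu> rho_pos by auto
    then have "(\<Sum>c\<in>Orbs m n. complex_of_real (T_hat m n r c) * x c) \<noteq> 0" unfolding eig[OF r(1)] .
    then obtain c where c: "c \<in> Orbs m n" "complex_of_real (T_hat m n r c) * x c \<noteq> 0"
      by (rule sum.not_neutral_contains_not_neutral)
    obtain V where V: "V \<subseteq> L" "c = orb m n V" by (rule OrbsE[OF c(1)])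
    have "card U + card V = m * n"
    proof (rule ccontr)
      assume "card U + card V \<noteq> m * n"
      from T_hat_zero[OF U(1) V(1) this] show False using c(2) unfolding U(2) V(2) by simp
    qed
    then have "card V \<le> m * n div 2" using False by linarith
    moreover have "x (orb m n V) \<noteq> 0" using c(2) unfolding V(2) by simp
    ultimately show ?thesis using V(1) by blast
  qed
  then obtain V where V: "V \<subseteq> L" "card V \<le> m * n div 2" "x (orb m n V) \<noteq> 0" by blast
  define i where "i = card V"
  have i: "i \<le> m * n" using V by (simp add: i_def card_le)
  interpret P: primitive_kernel "S_minus m n i" "two_step i" by (rule two_step_primitive[OF i])
  have nz': "\<exists>r\<in>S_minus m n i. x r \<noteq> 0" 
  proof (intro bexI)
    show "x (orb m n V) \<noteq> 0" by (rule V(3))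
    show "orb m n V \<in> S_minus m n i" unfolding S_minus_iff[OF V(1)] i_def by (rule refl)
  qed
  have eig2: "(\<Sum>c\<in>S_minus m n i. complex_of_real (two_step i r c) * x c) = \<mu>\<^sup>2 * x r" if rS: "r \<in> S_minus m n i" for r
  proof -
    obtain W where W: "W \<subseteq> L" "card W = i" "r = orb m n W" using rS unfolding S_minus_eq by blast
    have "(\<Sum>c\<in>S_minus m n i. complex_of_real (two_step i r c) * x c)
        = (\<Sum>s\<in>Orbs m n. complex_of_real (T_hat m n r s) * (\<Sum>c\<in>Orbs m n. complex_of_real (T_hat m n s c) * x c))"
      using T_hat_twice[OF W(1), of x] unfolding W(2) W(3)[symmetric] by (rule sym)
    also have "\<dots> = (\<Sum>s\<in>Orbs m n. \<mu> * (complex_of_real (T_hat m n r s) * x s))"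
    proof (rule sum.cong[OF refl])
      fix s assume "s \<in> Orbs m n"
      from eig[OF this] show "complex_of_real (T_hat m n r s) * (\<Sum>c\<in>Orbs m n. complex_of_real (T_hat m n s c) * x c)
          = \<mu> * (complex_of_real (T_hat m n r s) * x s)" by (simp only: mult.left_commute)
    qed
    also have "\<dots> = \<mu> * (\<mu> * x r)"
    proof -
      have "r \<in> Orbs m n" using rS S_sub by blast
      then show ?thesis unfolding sum_distrib_left[symmetric] by (simp only: eig)
    qed
    finally show ?thesis by (simp add: power2_eq_square mult.assoc)
  qed
  have "\<rho>\<^sup>2 \<le> sector_bound i p" for p
    using P.eigenvalue_le_cw_bound[OF nz' eig2, of p] \<mu> by (simp add: norm_power)
  then have "\<rho>\<^sup>2 \<le> sector_value i" unfolding P.pf_value_def by (intro cINF_greatest) auto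
  then show ?thesis using V(2) by (auto simp: i_def)
qed

lemma C_seq_decseq: assumes i: "i \<le> m * n" shows "decseq (C_seq m n i)"
proof -
  interpret P: primitive_kernel "S_minus m n i" "two_step i" by (rule two_step_primitive[OF i])
  show ?thesis unfolding decseq_def C_seq_eq[OF i]
    using P.decseq_cw_bound P.cw_bound_pos m2 n2
    by (auto intro!: divide_right_mono simp: decseq_def)
qed

lemma C_seq_tendsto:
  assumes i: "i \<le> m * n" shows "C_seq m n i \<longlonglongrightarrow> 1 / (2 * real m * real n) * ln (sector_value i)"
proof -
  interpret P: primitive_kernel "S_minus m n i" "two_step i" by (rule two_step_primitive[OF i])
  show ?thesis unfolding C_seq_eq[OF i, abs_def]
    using P.cw_bound_tendsto P.pf_value_pos by (intro tendsto_intros) auto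
qed

lemma C_seq_ge:
  assumes i: "i \<le> m * n" shows "1 / (2 * real m * real n) * ln (sector_value i) \<le> C_seq m n i p"
proof -
  interpret P: primitive_kernel "S_minus m n i" "two_step i" by (rule two_step_primitive[OF i])
  show ?thesis unfolding C_seq_eq[OF i]
    using P.pf_value_le[of p] P.pf_value_pos by (intro mult_left_mono ln_mono) auto
qed

lemma
  shows max_C_seq_tendsto: "(\<lambda>p. MAX i \<in> {0..m * n div 2}. C_seq m n i p) \<longlonglongrightarrow> 1 / (real m * real n) * ln \<rho>"
    and max_C_seq_INF: "1 / (real m * real n) * ln \<rho> = (INF p. MAX i \<in> {0..m * n div 2}. C_seq m n i p)"
proof -
  define u where "u = 1 / (real m * real n) * ln \<rho>"
  define M where "M p = (MAX i \<in> {0..m * n div 2}. C_seq m n i p)" for p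
  define l where "l i = 1 / (2 * real m * real n) * ln (sector_value i)" for i
  have mn: "0 < real m * real n" using m2 n2 by simp
  have u2: "u = 1 / (2 * real m * real n) * ln (\<rho>\<^sup>2)" using rho_pos by (simp add: u_def ln_realpow)
  have le_i: "i \<le> m * n" if "i \<le> m * n div 2" for i using that by simp
  have l_le: "l i \<le> u" if "i \<le> m * n" for i
  proof -
    interpret P: primitive_kernel "S_minus m n i" "two_step i" by (rule two_step_primitive[OF that])
    have "sector_value i \<le> \<rho>\<^sup>2" using sqrt_sector_value_le_rho[OF that] by (rule sqrt_le_D)
    then show ?thesis unfolding l_def u2 using P.pf_value_pos mn by (intro mult_left_mono ln_mono) auto
  qed
  obtain i0 where i0: "i0 \<le> m * n div 2" "\<rho>\<^sup>2 \<le> sector_value i0" using rho_attained by blast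
  have lower: "u \<le> M p" for p
  proof -
    have "u \<le> l i0" unfolding l_def u2 using i0(2) rho_pos mn by (intro mult_left_mono ln_mono) auto
    also have "\<dots> \<le> C_seq m n i0 p" unfolding l_def by (rule C_seq_ge[OF le_i[OF i0(1)]])
    also have "\<dots> \<le> M p" unfolding M_def using i0(1) by (intro Max_ge) auto
    finally show ?thesis .
  qed
  have lim: "M \<longlonglongrightarrow> u"
  proof (rule order_tendstoI)
    fix a assume "a < u"
    then have "a < M p" for p using lower by (rule less_le_trans)
    then show "\<forall>\<^sub>F p in sequentially. a < M p" by simp
  next
    fix a assume a: "u < a"
    have "\<forall>\<^sub>F p in sequentially. \<forall>i\<in>{0..m * n div 2}. C_seq m n i p < a"
    proof (rule eventually_ball_finite)
      show "\<forall>i\<in>{0..m * n div 2}. \<forall>\<^sub>F p in sequentially. C_seq m n i p < a"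
      proof
        fix i assume i: "i \<in> {0..m * n div 2}"
        then have "l i < a" using l_le[OF le_i] a by force
        then show "\<forall>\<^sub>F p in sequentially. C_seq m n i p < a"
          using order_tendstoD(2)[OF C_seq_tendsto[OF le_i]] i by (simp add: l_def)
      qed
    qed simp
    then show "\<forall>\<^sub>F p in sequentially. M p < a"
      by eventually_elim (auto simp: M_def)
  qed
  then show "(\<lambda>p. MAX i \<in> {0..m * n div 2}. C_seq m n i p) \<longlonglongrightarrow> 1 / (real m * real n) * ln \<rho>"
    by (simp add: M_def[abs_def] u_def)
  have "(INF p. M p) = u"
  proof (rule antisym)
    have bdd: "bdd_below (range M)" using lower by (auto intro!: bdd_belowI[of _ u])
    have "(INF p. M p) \<le> M p" for p by (rule cINF_lower[OF bdd]) simp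
    then show "(INF p. M p) \<le> u" using LIMSEQ_le_const[OF lim] by blast
    show "u \<le> (INF p. M p)" using lower by (intro cINF_greatest) auto
  qed
  then show "1 / (real m * real n) * ln \<rho> = (INF p. MAX i \<in> {0..m * n div 2}. C_seq m n i p)"
    by (simp add: M_def[abs_def] u_def)
qed

lemma T_op_cong: "(\<And>V. V \<subseteq> L \<Longrightarrow> T U V \<noteq> 0 \<Longrightarrow> f V = g V) \<Longrightarrow> T_op m n f U = T_op m n g U"
  unfolding T_op_def by (rule sum.cong) auto

abbreviation T_ones where "T_ones k \<equiv> ((T_op m n) ^^ k) (\<lambda>_. 1)"

text \<open>Powers of the transfer matrix applied to a constant function are constant on orbits, so they can
  be computed in the sector of the orbit.\<close>

lemma T_ones_eq_sector_ones:
  assumes "U \<subseteq> L" "card U = i" shows "T_ones (2 * p) U = sector_ones i p (orb m n U)"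
  using assms
proof (induction p arbitrary: U)
  case 0
  then have i: "i \<le> m * n" using card_le by auto
  show ?case using 0 S_minus_iff[of U i] by (simp add: primitive_kernel.K_ones_def[OF two_step_primitive[OF i]])
next
  case (Suc p)
  have i: "i \<le> m * n" using Suc.prems card_le by auto
  interpret P: primitive_kernel "S_minus m n i" "two_step i" by (rule two_step_primitive[OF i])
  have inner: "T_op m n (T_ones (2 * p)) V = T_op m n (\<lambda>W. sector_ones i p (orb m n W)) V" if V: "T U V \<noteq> 0" for V
  proof (rule T_op_cong)
    fix W assume W: "W \<subseteq> L" "T V W \<noteq> 0"
    have "card U + card V = m * n" "card V + card W = m * n" using V W(2) T_zero by blast+
    then have "card W = i" using Suc.prems by simp
    then show "T_ones (2 * p) W = sector_ones i p (orb m n W)" using Suc.IH W(1) by simp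
  qed
  have "T_ones (2 * Suc p) U = T_op m n (T_op m n (T_ones (2 * p))) U" by simp
  also have "\<dots> = T_op m n (\<lambda>V. T_op m n (\<lambda>W. sector_ones i p (orb m n W)) V) U"
    by (rule T_op_cong) (rule inner)
  also have "\<dots> = T_op m n (\<lambda>V. \<Sum>c\<in>Orbs m n. T_hat m n (orb m n V) c * sector_ones i p c) U"
    by (rule T_op_cong) (rule sum_orbits[symmetric])
  also have "\<dots> = (\<Sum>s\<in>Orbs m n. T_hat m n (orb m n U) s * (\<Sum>c\<in>Orbs m n. T_hat m n s c * sector_ones i p c))"
    by (rule sum_orbits[symmetric, OF Suc.prems(1)])
  also have "\<dots> = (\<Sum>c\<in>S_minus m n i. two_step i (orb m n U) c * sector_ones i p c)"
    using T_hat_twice[OF Suc.prems(1), of "sector_ones i p"] Suc.prems(2) by simp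
  also have "\<dots> = sector_ones i (Suc p) (orb m n U)"
    using S_minus_iff[OF Suc.prems(1)] Suc.prems(2) by (simp add: P.K_ones_Suc P.K_op_def)
  finally show ?case .
qed

lemma T_ones_growth:
  assumes a: "\<rho>\<^sup>2 < a"
  shows "\<exists>C>0. \<forall>p. \<forall>U\<subseteq>L. T_ones (2 * p + 2) U \<le> C * a ^ p"
proof -
  have a0: "0 < a" using a by (meson le_less_trans zero_le_power2)
  have "\<forall>i. \<exists>C. i \<le> m * n \<longrightarrow> 0 < C \<and> (\<forall>p. \<forall>r\<in>S_minus m n i. sector_ones i p r \<le> C * a ^ p)"
  proof
    fix i
    show "\<exists>C. i \<le> m * n \<longrightarrow> 0 < C \<and> (\<forall>p. \<forall>r\<in>S_minus m n i. sector_ones i p r \<le> C * a ^ p)"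
    proof (cases "i \<le> m * n")
      case True
      interpret P: primitive_kernel "S_minus m n i" "two_step i" by (rule two_step_primitive[OF True])
      have "sector_value i = (sqrt (sector_value i))\<^sup>2" using P.pf_value_pos by simp
      also have "\<dots> \<le> \<rho>\<^sup>2" using sqrt_sector_value_le_rho[OF True] P.pf_value_pos by (intro power_mono) auto
      finally have "sector_value i < a" using a by simp
      then show ?thesis using P.K_ones_growth[of a] by metis
    qed simp
  qed
  then obtain Cf where Cf: "\<And>i. i \<le> m * n \<Longrightarrow> 0 < Cf i"
    "\<And>i p r. i \<le> m * n \<Longrightarrow> r \<in> S_minus m n i \<Longrightarrow> sector_ones i p r \<le> Cf i * a ^ p" by metis
  define C where "C = (\<Sum>i\<le>m * n. Cf i)"
  have C0: "0 < C" unfolding C_def using Cf(1) by (intro sum_pos) auto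
  have bound: "T_ones (2 * p) U \<le> C * a ^ p" if U: "U \<subseteq> L" for p U
  proof -
    have c: "card U \<le> m * n" by (rule card_le[OF U])
    have "T_ones (2 * p) U \<le> Cf (card U) * a ^ p"
      unfolding T_ones_eq_sector_ones[OF U refl] using S_minus_iff[OF U] by (intro Cf(2) c) simp
    also have "\<dots> \<le> C * a ^ p"
      unfolding C_def using c Cf(1) a0 by (intro mult_right_mono member_le_sum) (auto simp: less_imp_le)
    finally show ?thesis .
  qed
  have "T_ones (2 * p + 2) U \<le> (C * a) * a ^ p" if "U \<subseteq> L" for p U
    using bound[OF that, of "Suc p"] by (simp add: mult_ac)
  then show ?thesis using C0 a0 by (intro exI[of _ "C * a"]) simp
qed

lemma filterlim_even_boxes:
  assumes "filterlim f at_top F" "filterlim g at_top F" "filterlim h at_top F" "\<And>p. even (f p * g p * h p)"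
  shows "filterlim (\<lambda>p. (f p, g p, h p)) even_boxes F"
  unfolding even_boxes_def filterlim_inf filterlim_principal
  using assms by (intro conjI filterlim_Pair) auto

text \<open>Suppose that some even box has density larger than \<open>x\<close>, where \<open>x\<close> exceeds the claimed bound.  By tiling
  the same holds for all large boxes of even volume, in particular for \<open>(2 p + 2) \<times> 2\<^sup>p m \<times> 2\<^sup>p n\<close>.  But
  the density of this box is at most that of the torus with \<open>2 p + 2\<close> layers of size \<open>m \<times> n\<close>, whose
  limit is below \<open>x\<close>.\<close>

lemma dimer_constant_le_ln_rho: "dimer_constant \<le> 1 / (real m * real n) * ln \<rho>"
proof (rule dimer_constant_le, rule ccontr)
  fix a b c :: nat
  assume abc: "even a" "even b" "even c" "0 < a" "0 < b" "0 < c"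
    and "\<not> density (a, b, c) \<le> 1 / (real m * real n) * ln \<rho>"
  then have gt: "1 / (real m * real n) * ln \<rho> < density (a, b, c)" by simp
  obtain x where x: "1 / (real m * real n) * ln \<rho> < x" "x < density (a, b, c)" using dense[OF gt] by blast
  obtain y where y: "1 / (real m * real n) * ln \<rho> < y" "y < x" using dense[OF x(1)] by blast
  have mn: "0 < real m * real n" using m2 n2 by simp
  define e where "e = exp (2 * (real m * real n) * y)"
  have "2 * ln \<rho> < 2 * (real m * real n) * y" using y(1) mn by (simp add: field_simps)
  then have "ln (\<rho>\<^sup>2) < 2 * (real m * real n) * y" using rho_pos by (simp add: ln_realpow)
  then have "\<rho>\<^sup>2 < e" unfolding e_def using rho_pos by (metis exp_less_mono exp_ln zero_less_power)
  then obtain C where C: "0 < C" "\<And>p U. U \<subseteq> L \<Longrightarrow> T_ones (2 * p + 2) U \<le> C * e ^ p" using T_ones_growth by blast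
  \<comment> \<open>the summand \<open>1\<close> only keeps the logarithm of \<open>D\<close> defined\<close>
  define D where "D = 1 + real (card (Pow L)) * C"
  have D1: "1 \<le> D" using C(1) by (simp add: D_def)
  have tor: "real (card (torus_matchings m n (2 * p + 2))) \<le> D * e ^ p" if p: "1 \<le> p" for p
  proof -
    have "real (card (torus_matchings m n (2 * p + 2))) \<le> (\<Sum>U\<in>Pow L. T_ones (2 * p + 2) U)"
      by (rule card_torus_matchings_le[OF m2 n2]) (use p in auto)
    also have "\<dots> \<le> (\<Sum>U\<in>Pow L. C * e ^ p)" by (intro sum_mono C(2)) auto
    also have "\<dots> = real (card (Pow L)) * C * e ^ p" by simp
    also have "\<dots> \<le> D * e ^ p" unfolding D_def by (intro mult_right_mono) (auto simp: e_def)
    finally show ?thesis .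
  qed
  have dens: "density (2 * p + 2, 2 ^ p * m, 2 ^ p * n) \<le> (ln D + real p * (2 * (real m * real n) * y)) / (real (2 * p + 2) * (real m * real n))"
    if p: "1 \<le> p" for p
  proof -
    let ?k = "2 * p + 2" and ?N = "num_matchings (2 * p + 2) (2 ^ p * m) (2 ^ p * n)"
    have N1: "1 \<le> ?N" by (rule num_matchings_even) simp
    have "?N \<le> card (torus_matchings (2 ^ p * m) (2 ^ p * n) ?k)" by (rule num_matchings_le_torus) simp
    also have "\<dots> \<le> card (torus_matchings m n ?k) ^ (4 ^ p)"
      by (rule card_torus_matchings_double_iterate[OF m2 n2]) (use p in simp)
    finally have "real ?N \<le> real (card (torus_matchings m n ?k)) ^ (4 ^ p)" by (metis of_nat_le_iff of_nat_power)
    also have "\<dots> \<le> (D * e ^ p) ^ (4 ^ p)" by (intro power_mono tor p) simp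
    finally have "ln (real ?N) \<le> ln ((D * e ^ p) ^ (4 ^ p))" using N1 by (intro ln_mono) auto
    also have "\<dots> = 4 ^ p * (ln D + real p * (2 * (real m * real n) * y))"
      using D1 by (simp add: ln_realpow ln_mult e_def)
    finally have "density (?k, 2 ^ p * m, 2 ^ p * n)
        \<le> 4 ^ p * (ln D + real p * (2 * (real m * real n) * y)) / real (?k * (2 ^ p * m) * (2 ^ p * n))"
      unfolding density_def prod.case by (rule divide_right_mono) simp
    also have "real (?k * (2 ^ p * m) * (2 ^ p * n)) = 4 ^ p * (real ?k * (real m * real n))"
    proof -
      have "(4::real) ^ p = 2 ^ p * 2 ^ p" by (simp add: power_mult_distrib[symmetric])
      then show ?thesis by (simp add: algebra_simps)
    qed
    finally show ?thesis by simp
  qed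
  have p2: "filterlim (\<lambda>p. 2 ^ p * l) at_top sequentially" if "2 \<le> l" for l :: nat
  proof (rule filterlim_at_top_mono[OF filterlim_ident])
    show "\<forall>\<^sub>F p in sequentially. p \<le> 2 ^ p * l"
    proof (rule always_eventually, rule allI)
      fix p
      have "p < 2 ^ p" by (rule less_exp)
      moreover have "2 ^ p * 1 \<le> 2 ^ p * l" using that by (intro mult_le_mono2) simp
      ultimately show "p \<le> 2 ^ p * l" by linarith
    qed
  qed
  have cancel: "(A + q * (2 * c * y)) / (k * c) = (A / c + q * (2 * y)) / k"
    if "0 < c" "0 < k" for A q c k :: real
    using that by (simp add: field_simps)
  have "filterlim (\<lambda>p. (2 * p + 2, 2 ^ p * m, 2 ^ p * n)) even_boxes sequentially"
    by (intro filterlim_even_boxes p2 m2 n2 filterlim_at_top_mono[OF filterlim_ident]) auto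
  then have "\<forall>\<^sub>F p in sequentially. x < density (2 * p + 2, 2 ^ p * m, 2 ^ p * n)"
    using density_liminf[OF abc x(2)] by (auto simp: filterlim_iff)
  moreover have "\<forall>\<^sub>F p in sequentially. 1 \<le> (p::nat)" by (rule eventually_ge_at_top)
  moreover have "\<forall>\<^sub>F p in sequentially. (ln D / (real m * real n) - 2 * x) / (2 * (x - y)) < real p"
    using filterlim_real_sequentially by (rule filterlim_at_top_dense[THEN iffD1, rule_format])
  ultimately have "\<forall>\<^sub>F p::nat in sequentially. False"
  proof eventually_elim
    case (elim p)
    have "x < (ln D + real p * (2 * (real m * real n) * y)) / (real (2 * p + 2) * (real m * real n))"
      using elim(1) dens[OF elim(2)] by simp
    also have "\<dots> = (ln D / (real m * real n) + real p * (2 * y)) / real (2 * p + 2)"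
      using mn by (intro cancel) auto
    finally have "x * real (2 * p + 2) < ln D / (real m * real n) + real p * (2 * y)"
      by (subst (asm) pos_less_divide_eq) auto
    moreover have "ln D / (real m * real n) - 2 * x < 2 * (x - y) * real p"
      using elim(3) y(2) by (simp add: pos_divide_less_eq mult.commute)
    ultimately show False by (simp add: algebra_simps)
  qed
  then show False by simp
qed

end

theorem corollary3p4:
  fixes m n :: nat
  assumes "m \<ge> 2" and "n \<ge> 2"
  shows "(\<forall>i \<le> m * n div 2. decseq (C_seq m n i))
    \<and> dimer_constant \<le> 1 / (real m * real n) * ln (spectral_radius_on (Orbs m n) (T_hat m n))
    \<and> (\<lambda>p. MAX i \<in> {0..m * n div 2}. C_seq m n i p)
        \<longlonglongrightarrow> 1 / (real m * real n) * ln (spectral_radius_on (Orbs m n) (T_hat m n))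
    \<and> 1 / (real m * real n) * ln (spectral_radius_on (Orbs m n) (T_hat m n))
        = (INF p. MAX i \<in> {0..m * n div 2}. C_seq m n i p)"
proof -
  interpret torus_layer m n using assms by unfold_locales
  show ?thesis
  proof (intro conjI allI impI)
    show "decseq (C_seq m n i)" if "i \<le> m * n div 2" for i
      using that by (intro C_seq_decseq) simp
  qed (rule dimer_constant_le_ln_rho max_C_seq_tendsto max_C_seq_INF)+
qed

end
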